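(* Let $\theta\in(0,\pi/2)$ and let $\widehat\Sigma\in\mathcal{K}_\theta$ be a capillary convex body. Then $$\inf_{z\in\mathrm{int}(\widehat{\partial\Sigma})}\mathrm{Vol}(\widehat\Sigma)\,\mathrm{Vol}(\widehat\Sigma^*_z)\le \tfrac12\,\mathrm{Vol}(\mathbb{B}^{n+1})^2,$$ where $\mathbb{B}^{n+1}$ is the unit ball in $\mathbb{R}^{n+1}$ and $\widehat\Sigma^*_z$ is the capillary polar body of $\widehat\Sigma$ with respect to $z$.
   Context: $\mathbb{R}^{n+1}_+=\{x\in\mathbb{R}^{n+1}: x_{n+1}>0\}$, $e:=-E_{n+1}$ with $E_{n+1}$ the $(n+1)$-th coordinate vector. A capillary hypersurface with contact angle $\theta$ is a properly embedded, smooth, compact hypersurface $\Sigma\subset\overline{\mathbb{R}^{n+1}_+}$ with $\partial\Sigma\subset\partial\mathbb{R}^{n+1}_+$ such that $\langle\nu,e\rangle=-\cos\theta$ along $\partial\Sigma$, $\nu$ being the unit outward normal. $\widehat\Sigma$ is the bounded closed region enclosed by $\Sigma$ and $\partial\mathbb{R}^{n+1}_+$; its flat boundary part is $\widehat{\partial\Sigma}=\widehat\Sigma\cap\partial\mathbb{R}^{n+1}_+$, with interior taken relative to $\partial\mathbb{R}^{n+1}_+$. $\mathcal{K}_\theta$ is the set of all such $\widehat\Sigma$ that are convex (capillary convex bodies). Unit spherical cap: $\mathcal{C}_\theta:=\{\xi\in\overline{\mathbb{R}^{n+1}_+}:|\xi-\cos\theta\, e|=1\}$; $\ell(\xi):=\sin^2\theta+\cos\theta\langle\xi,e\rangle$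 on $\mathcal{C}_\theta$. For $z\in\widehat\Sigma$ the support function is $h_z(\xi):=\max_{X\in\Sigma}\langle\xi-\cos\theta\, e,X-z\rangle$ and the capillary support function is $u_z(\xi):=h_z(\xi)/\ell(\xi)$, $\xi\in\mathcal{C}_\theta$. For $z\in\mathrm{int}(\widehat{\partial\Sigma})$ the capillary polar body is $\widehat\Sigma_z^*:=\{X+z\in\overline{\mathbb{R}^{n+1}_+}: r\,u_z(\xi)\le1,\ \text{where } X=r\xi,\ r\ge0,\ \xi\in\mathcal{C}_\theta\}$. *)

theory Defs
  imports "HOL-Analysis.Analysis"
begin

text \<open>
  The space of dimension \<open>n + 1\<close> is the product of \<open>real ^ 'n\<close> (with \<open>n = CARD('n) \<ge> 1\<close>) and
  \<open>real\<close>, carrying the library's Euclidean structure on products; the coordinate of index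
  \<open>n + 1\<close> is \<open>snd\<close>.
\<close>

type_synonym 'n space = "(real ^ 'n) \<times> real"

definition half_space :: "'n::finite space set" where
  "half_space = {x. snd x > 0}"

definition bounding_plane :: "'n::finite space set" where
  "bounding_plane = {x. snd x = 0}"

definition closed_half_space :: "'n::finite space set" where
  "closed_half_space = {x. snd x \<ge> 0}"

definition e_vec :: "'n::finite space" where
  "e_vec = - (0, 1)"


section \<open>Smooth hypersurfaces with boundary\<close>

text \<open>
  Only used for open \<open>S\<close>. Regularity of order \<open>k + 1\<close> asks that each directional derivative be
  regular of order \<open>k\<close>; in finite dimension this is the usual notion for \<open>k + 1 \<ge> 1\<close>.
\<close>

primrec Ck_on :: "nat \<Rightarrow> ('a::real_normed_vector \<Rightarrow> 'b::real_normed_vector) \<Rightarrow> 'a set \<Rightarrow> bool" where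
  "Ck_on 0 f S \<longleftrightarrow> continuous_on S f"
| "Ck_on (Suc k) f S \<longleftrightarrow>
     (\<forall>x\<in>S. f differentiable (at x)) \<and> (\<forall>v. Ck_on k (\<lambda>x. frechet_derivative f (at x) v) S)"

definition smooth_on :: "'a set \<Rightarrow> ('a::real_normed_vector \<Rightarrow> 'b::real_normed_vector) \<Rightarrow> bool" where
  "smooth_on S f \<longleftrightarrow> (\<forall>k. Ck_on k f S)"

definition diffeo_on ::
  "'a set \<Rightarrow> 'b set \<Rightarrow> ('a::real_normed_vector \<Rightarrow> 'b::real_normed_vector) \<Rightarrow> bool" where
  "diffeo_on U V \<phi> \<longleftrightarrow> open U \<and> open V \<and>
     (\<exists>\<psi>. homeomorphism U V \<phi> \<psi> \<and> smooth_on U \<phi> \<and> smooth_on V \<psi>)"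

text \<open>
  Manifold interior and manifold boundary of a subset, by slice charts: near an interior point
  the set is straightened to the hyperplane \<open>snd y = 0\<close>, near a boundary point to one half of it.
\<close>

definition surface_interior :: "'n::finite space set \<Rightarrow> 'n space set" where
  "surface_interior S = {p \<in> S. \<exists>U V (\<phi> :: 'n space \<Rightarrow> 'n space).
     diffeo_on U V \<phi> \<and> p \<in> U \<and> \<phi> ` (S \<inter> U) = {y \<in> V. snd y = 0}}"

definition surface_boundary :: "'n::finite space set \<Rightarrow> 'n space set" where
  "surface_boundary S = {p \<in> S. \<exists>U V (\<phi> :: 'n space \<Rightarrow> 'n space) i.
     diffeo_on U V \<phi> \<and> p \<in> U \<and> fst (\<phi> p) $ i = 0 \<and>
     \<phi> ` (S \<inter> U) = {y \<in> V. snd y = 0 \<and> fst y $ i \<ge> 0}}"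

definition smooth_hypersurface :: "'n::finite space set \<Rightarrow> bool" where
  "smooth_hypersurface S \<longleftrightarrow> S = surface_interior S \<union> surface_boundary S"

text \<open>
  At a boundary point the initial velocities of curves in the surface only fill a half-space of
  the tangent space, whence the span.
\<close>

definition tangent_space :: "'n::finite space set \<Rightarrow> 'n space \<Rightarrow> 'n space set" where
  "tangent_space S p = span {v. \<exists>\<gamma> :: real \<Rightarrow> 'n space.
     \<gamma> 0 = p \<and> \<gamma> ` {0..1} \<subseteq> S \<and> (\<gamma> has_vector_derivative v) (at 0 within {0..1})}"


section \<open>Capillary hypersurfaces and capillary convex bodies\<close>

text \<open>\<open>inside A\<close> is the union of the bounded components of the complement of \<open>A\<close>.\<close>

definition enclosed_region :: "'n::finite space set \<Rightarrow> 'n space set" where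
  "enclosed_region S = closure (inside (S \<union> bounding_plane))"

definition flat_part :: "'n::finite space set \<Rightarrow> 'n space set" where
  "flat_part S = enclosed_region S \<inter> bounding_plane"

definition flat_interior :: "'n::finite space set \<Rightarrow> 'n space set" where
  "flat_interior S = (top_of_set bounding_plane) interior_of (flat_part S)"

text \<open>
  Pointing out of the enclosed region is required at the points of the open half-space only. At the
  edge, where moving along the normal or its opposite may leave the closed half-space, the direction
  is then fixed by continuity.
\<close>

definition unit_outward_normal ::
  "'n::finite space set \<Rightarrow> ('n space \<Rightarrow> 'n space) \<Rightarrow> bool" where
  "unit_outward_normal S \<nu> \<longleftrightarrow>
     continuous_on S \<nu> \<and>
     (\<forall>p\<in>S. norm (\<nu> p) = 1 \<and> (\<forall>v\<in>tangent_space S p. \<nu> p \<bullet> v = 0)) \<and>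
     (\<forall>p\<in>S \<inter> half_space. \<forall>\<^sub>F t in at_right 0. p + t *\<^sub>R \<nu> p \<notin> enclosed_region S)"

text \<open>
  Properness of the embedding is the requirement that the surface meets the bounding hyperplane
  exactly along its boundary. The boundary is nonempty, so closed surfaces are excluded, for which
  the contact angle condition would be void.
\<close>

definition capillary_hypersurface :: "real \<Rightarrow> 'n::finite space set \<Rightarrow> bool" where
  "capillary_hypersurface \<theta> S \<longleftrightarrow>
     compact S \<and> smooth_hypersurface S \<and>
     S \<subseteq> closed_half_space \<and> S \<inter> bounding_plane = surface_boundary S \<and>
     surface_boundary S \<noteq> {} \<and>
     (\<exists>\<nu>. unit_outward_normal S \<nu> \<and> (\<forall>p\<in>surface_boundary S. \<nu> p \<bullet> e_vec = - cos \<theta>))"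

definition capillary_convex_bodies :: "real \<Rightarrow> 'n::finite space set set" where
  "capillary_convex_bodies \<theta> =
     {enclosed_region S | S. capillary_hypersurface \<theta> S \<and> convex (enclosed_region S)}"


section \<open>Capillary support function and capillary polar body\<close>

definition unit_cap :: "real \<Rightarrow> 'n::finite space set" where
  "unit_cap \<theta> = {\<xi> \<in> closed_half_space. norm (\<xi> - cos \<theta> *\<^sub>R e_vec) = 1}"

definition cap_ell :: "real \<Rightarrow> 'n::finite space \<Rightarrow> real" where
  "cap_ell \<theta> \<xi> = (sin \<theta>)\<^sup>2 + cos \<theta> * (\<xi> \<bullet> e_vec)"

text \<open>The supremum is a maximum, as \<open>S\<close> is compact and nonempty in all uses.\<close>

definition support_fun ::
  "real \<Rightarrow> 'n::finite space set \<Rightarrow> 'n space \<Rightarrow> 'n space \<Rightarrow> real" where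
  "support_fun \<theta> S z \<xi> = (SUP X\<in>S. (\<xi> - cos \<theta> *\<^sub>R e_vec) \<bullet> (X - z))"

definition capillary_support_fun ::
  "real \<Rightarrow> 'n::finite space set \<Rightarrow> 'n space \<Rightarrow> 'n space \<Rightarrow> real" where
  "capillary_support_fun \<theta> S z \<xi> = support_fun \<theta> S z \<xi> / cap_ell \<theta> \<xi>"

definition capillary_polar_body ::
  "real \<Rightarrow> 'n::finite space set \<Rightarrow> 'n space \<Rightarrow> 'n space set" where
  "capillary_polar_body \<theta> S z =
     {X + z | X. X + z \<in> closed_half_space \<and>
        (\<exists>r \<xi>. X = r *\<^sub>R \<xi> \<and> r \<ge> 0 \<and> \<xi> \<in> unit_cap \<theta> \<and> r * capillary_support_fun \<theta> S z \<xi> \<le> 1)}"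

end

theory Submission
  imports Defs "HOL-Probability.Probability"
begin

text \<open>
  Write \<open>Q\<close> for the enclosed region and \<open>D\<close> for its flat part, and let \<open>K\<close> be the union of \<open>Q\<close> and
  its mirror image in the bounding plane, so that the volume of \<open>K\<close> is twice that of \<open>Q\<close>. For \<open>z\<close> in
  the plane the capillary polar body, moved by \<open>-z\<close>, consists of vectors \<open>X\<close> with \<open>X \<bullet> (Y - z) \<le> 1\<close> for
  all \<open>Y\<close> in \<open>K\<close>: the defining inequality compares the support function with \<open>\<ell> \<le> 1\<close>, the centre of
  the cap lies below the plane, and a linear form with nonnegative last coefficient takes its
  maximum over \<open>Q\<close> on the surface (\<open>capillary_polar_body_in_polar\<close>). So it suffices to find \<open>z\<close> in the
  interior of \<open>D\<close> at which \<open>K\<close> and its polar satisfy the Blaschke-Santalo inequality; the factor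
  \<open>1/2\<close> is the ratio of the volumes of \<open>Q\<close> and \<open>K\<close> (\<open>double_santalo\<close>).

  The point \<open>z\<close> minimises the integral of \<open>exp (- h y + y \<bullet> z)\<close> over \<open>D\<close>, where \<open>h\<close> is the support
  function of \<open>K\<close>; up to a factorial this integral is the volume of the polar of \<open>K\<close> about \<open>z\<close>. It is
  infinite on the boundary of \<open>D\<close>, because \<open>K\<close> projects into \<open>D\<close>, so the minimum lies inside. The
  first variation in the plane and the reflection symmetry across it show that the polar has its
  centroid at the origin.

  For a polar with centroid at the origin the volume inequality (\<open>blaschke_santalo_centred\<close>) is a
  case of a functional one: if \<open>f x * g y \<le> exp (- (x \<bullet> y))\<close> and \<open>f\<close> has barycentre \<open>0\<close>, then the product
  of the two integrals is at most the squared Gaussian integral. Its proof, due to Lehec, is an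
  induction on the number of coordinates (\<open>exp_santalo_insert\<close>). A hyperplane bisects the mass of \<open>g\<close>,
  and a shear along the line through the two half-barycentres makes the marginals of both halves
  centred; on each half the one-dimensional Prekopa-Leindler inequality passes the hypothesis to
  the marginals. The translation that this costs multiplies \<open>f\<close> by an exponential, which does not
  decrease the integral of \<open>f\<close>, because \<open>exp s \<ge> 1 + s\<close> and \<open>f\<close> is centred.

  What remains is that \<open>Q\<close> is compact with nonempty interior and lies above \<open>D\<close>
  (\<open>capillary_body_geometry\<close>). A surface with a
  continuous unit normal separates the half-space: a circle-valued map that winds once across the
  surface has a continuous argument on the half-space, and its difference from the explicit local
  argument is an integer that jumps at the surface only (\<open>surface_in_closure_inside\<close>). Hence the
  surface lies in \<open>Q\<close>, its normals support \<open>Q\<close>, and since the contact angle is acute these normals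
  point upwards near the plane, which forces horizontal slices to shrink with height.
\<close>

section \<open>The one-dimensional Prekopa-Leindler inequality\<close>

text \<open>
  Scaled by one half, the part of \<open>A\<close> below \<open>a\<close> moved by \<open>b\<close> and the part of \<open>B\<close> above \<open>b\<close> moved by \<open>a\<close>
  lie in \<open>C\<close> on the two sides of the midpoint of \<open>a\<close> and \<open>b\<close>, so their measures add up.
\<close>

lemma midpoint_set_measure_aux:
  fixes A B C :: "real set"
  assumes [measurable]: "A \<in> sets borel" "B \<in> sets borel" "C \<in> sets borel"
    and mid: "\<And>x y. x \<in> A \<Longrightarrow> y \<in> B \<Longrightarrow> (x + y) / 2 \<in> C"
    and ab: "a \<in> A" "b \<in> B"
  shows "(emeasure lborel (A \<inter> {..a}) + emeasure lborel (B \<inter> {b<..})) / 2 \<le> emeasure lborel C"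
proof -
  define m where "m = (a + b) / 2"
  have half: "ennreal \<bar>1/2\<bar> * x = x / 2" for x :: ennreal
    by (simp add: ennreal_divide_numeral divide_ennreal_def mult.commute)
  have "emeasure lborel (A \<inter> {..a}) / 2 = ennreal \<bar>1/2\<bar> * (\<integral>\<^sup>+x. indicator (A \<inter> {..a}) x \<partial>lborel)"
    unfolding half by simp
  also have "\<dots> \<le> ennreal \<bar>1/2\<bar> * (\<integral>\<^sup>+x. indicator (C \<inter> {..m}) (b/2 + (1/2) * x) \<partial>lborel)"
  proof (intro mult_left_mono nn_integral_mono)
    fix x
    show "indicator (A \<inter> {..a}) x \<le> (indicator (C \<inter> {..m}) (b/2 + (1/2) * x) :: ennreal)"
    proof (cases "x \<in> A \<and> x \<le> a")
      case True
      have eq: "b/2 + (1/2) * x = (x + b) / 2" by simp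
      with True mid[of x b] ab show ?thesis unfolding eq by (simp add: m_def)
    qed auto
  qed auto
  also have "\<dots> = emeasure lborel (C \<inter> {..m})"
    by (subst nn_integral_real_affine[symmetric]) auto
  finally have 1: "emeasure lborel (A \<inter> {..a}) / 2 \<le> emeasure lborel (C \<inter> {..m})" .
  have "emeasure lborel (B \<inter> {b<..}) / 2 = ennreal \<bar>1/2\<bar> * (\<integral>\<^sup>+x. indicator (B \<inter> {b<..}) x \<partial>lborel)"
    unfolding half by simp
  also have "\<dots> \<le> ennreal \<bar>1/2\<bar> * (\<integral>\<^sup>+x. indicator (C \<inter> {m<..}) (a/2 + (1/2) * x) \<partial>lborel)"
  proof (intro mult_left_mono nn_integral_mono)
    fix x
    show "indicator (B \<inter> {b<..}) x \<le> (indicator (C \<inter> {m<..}) (a/2 + (1/2) * x) :: ennreal)"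
    proof (cases "x \<in> B \<and> b < x")
      case True
      have eq: "a/2 + (1/2) * x = (a + x) / 2" by simp
      with True mid[of a x] ab show ?thesis unfolding eq by (simp add: m_def)
    qed auto
  qed auto
  also have "\<dots> = emeasure lborel (C \<inter> {m<..})"
    by (subst nn_integral_real_affine[symmetric]) auto
  finally have 2: "emeasure lborel (B \<inter> {b<..}) / 2 \<le> emeasure lborel (C \<inter> {m<..})" .
  have "emeasure lborel C = emeasure lborel ((C \<inter> {..m}) \<union> (C \<inter> {m<..}))"
    by (rule arg_cong[where f="emeasure lborel"]) auto
  also have "\<dots> = emeasure lborel (C \<inter> {..m}) + emeasure lborel (C \<inter> {m<..})"
    by (rule plus_emeasure[symmetric]) auto
  finally show ?thesis using add_mono[OF 1 2] by (simp add: add_divide_distrib_ennreal)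
qed

text \<open>
  The one-dimensional Brunn-Minkowski inequality. Choosing \<open>a\<close> close to the supremum of \<open>A\<close> and \<open>b\<close> close
  to the infimum of \<open>B\<close> makes the preceding bound lose arbitrarily little.
\<close>

lemma midpoint_set_measure:
  fixes A B C :: "real set"
  assumes [measurable]: "A \<in> sets borel" "B \<in> sets borel" "C \<in> sets borel"
    and "bounded A" "bounded B" "A \<noteq> {}" "B \<noteq> {}"
    and mid: "\<And>x y. x \<in> A \<Longrightarrow> y \<in> B \<Longrightarrow> (x + y) / 2 \<in> C"
  shows "(emeasure lborel A + emeasure lborel B) / 2 \<le> emeasure lborel C"
proof (rule ennreal_le_epsilon)
  fix e :: real assume "e > 0"
  have bA: "bdd_above A" and bB: "bdd_below B"
    using assms bounded_imp_bdd_above bounded_imp_bdd_below by auto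
  obtain a where a: "a \<in> A" "Sup A - e < a"
    using less_cSupD[of A "Sup A - e"] assms \<open>e > 0\<close> by auto
  obtain b where b: "b \<in> B" "b < Inf B + e"
    using cInf_lessD[of B "Inf B + e"] assms \<open>e > 0\<close> by auto
  have le: "a \<le> Sup A" "Inf B \<le> b" using a b bA bB by (auto intro: cSup_upper cInf_lower)
  have "emeasure lborel A \<le> emeasure lborel ((A \<inter> {..a}) \<union> {a..Sup A})"
    using bA by (intro emeasure_mono) (auto intro: cSup_upper)
  also have "\<dots> \<le> emeasure lborel (A \<inter> {..a}) + emeasure lborel {a..Sup A}"
    by (rule emeasure_subadditive) auto
  also have "emeasure lborel {a..Sup A} \<le> ennreal e"
    using a le by (auto intro!: ennreal_leI)
  finally have 1: "emeasure lborel A \<le> emeasure lborel (A \<inter> {..a}) + ennreal e"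
    by (simp add: add_left_mono)
  have "emeasure lborel B \<le> emeasure lborel ((B \<inter> {b<..}) \<union> {Inf B..b})"
    using bB by (intro emeasure_mono) (auto intro: cInf_lower)
  also have "\<dots> \<le> emeasure lborel (B \<inter> {b<..}) + emeasure lborel {Inf B..b}"
    by (rule emeasure_subadditive) auto
  also have "emeasure lborel {Inf B..b} \<le> ennreal e"
    using b le by (auto intro!: ennreal_leI)
  finally have 2: "emeasure lborel B \<le> emeasure lborel (B \<inter> {b<..}) + ennreal e"
    by (simp add: add_left_mono)
  have "(emeasure lborel A + emeasure lborel B) / 2
      \<le> (emeasure lborel (A \<inter> {..a}) + emeasure lborel (B \<inter> {b<..}) + (ennreal e + ennreal e)) / 2"
    using add_mono[OF 1 2] by (intro divide_right_mono_ennreal) (simp add: ac_simps)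
  also have "\<dots> = (emeasure lborel (A \<inter> {..a}) + emeasure lborel (B \<inter> {b<..})) / 2 + ennreal e"
    using \<open>e > 0\<close>
    by (simp add: add_divide_distrib_ennreal ennreal_plus[symmetric] ennreal_divide_numeral del: ennreal_plus)
  also have "\<dots> \<le> emeasure lborel C + ennreal e"
    by (intro add_right_mono midpoint_set_measure_aux a b mid) auto
  finally show "(emeasure lborel A + emeasure lborel B) / 2 \<le> emeasure lborel C + ennreal e" .
qed

lemma layer_cake:
  fixes f :: "real \<Rightarrow> real"
  assumes [measurable]: "f \<in> borel_measurable borel" and nn: "\<And>x. 0 \<le> f x"
  shows "(\<integral>\<^sup>+x. ennreal (f x) \<partial>lborel) = (\<integral>\<^sup>+t. emeasure lborel {x. t < f x} * indicator {0..} t \<partial>lborel)"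
proof -
  have "(\<integral>\<^sup>+x. ennreal (f x) \<partial>lborel) = (\<integral>\<^sup>+x. (\<integral>\<^sup>+t. indicator {x. t < f x} x * indicator {0..} t \<partial>lborel) \<partial>lborel)"
  proof (intro nn_integral_cong)
    fix x
    have "(\<integral>\<^sup>+t. indicator {x. t < f x} x * indicator {0..} t \<partial>lborel) = (\<integral>\<^sup>+t. indicator {0..<f x} t \<partial>lborel)"
      by (intro nn_integral_cong) (auto simp: indicator_def)
    then show "ennreal (f x) = (\<integral>\<^sup>+t. indicator {x. t < f x} x * indicator {0..} t \<partial>lborel)"
      using nn[of x] by simp
  qed
  also have "\<dots> = (\<integral>\<^sup>+t. (\<integral>\<^sup>+x. indicator {x. t < f x} x * indicator {0..} t \<partial>lborel) \<partial>lborel)"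
    by (rule lborel_pair.Fubini') (auto simp: indicator_def split_beta')
  also have "\<dots> = (\<integral>\<^sup>+t. emeasure lborel {x. t < f x} * indicator {0..} t \<partial>lborel)"
    by (intro nn_integral_cong) (simp add: nn_integral_multc)
  finally show ?thesis .
qed

lemma product_le_mean_squared: "p * q \<le> ((p + q) / 2)\<^sup>2" for p q :: real
  using zero_le_power2[of "p - q"] by (simp add: power_divide power2_sum power2_diff)

text \<open>
  After division by their suprema \<open>f\<close> and \<open>g\<close> have nonempty superlevel sets at exactly the same levels
  \<open>t < 1\<close>. There the midpoints of these sets lie in a superlevel set of \<open>h\<close>, and Brunn-Minkowski for the
  level sets integrates to an arithmetic mean, which dominates the geometric mean.
\<close>

lemma prekopa_leindler_bounded:
  fixes f g h :: "real \<Rightarrow> real"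
  assumes [measurable]: "f \<in> borel_measurable borel" "g \<in> borel_measurable borel" "h \<in> borel_measurable borel"
    and nn: "\<And>x. 0 \<le> f x" "\<And>x. 0 \<le> g x" "\<And>x. 0 \<le> h x"
    and bd: "\<And>x. f x \<le> L" "\<And>x. g x \<le> L" "\<And>x. L < \<bar>x\<bar> \<Longrightarrow> f x = 0" "\<And>x. L < \<bar>x\<bar> \<Longrightarrow> g x = 0"
    and le: "\<And>x y. f x * g y \<le> (h ((x + y) / 2))\<^sup>2"
  shows "(\<integral>\<^sup>+x. ennreal (f x) \<partial>lborel) * (\<integral>\<^sup>+x. ennreal (g x) \<partial>lborel) \<le> (\<integral>\<^sup>+x. ennreal (h x) \<partial>lborel)\<^sup>2"
proof (cases "(\<forall>x. f x = 0) \<or> (\<forall>x. g x = 0)")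
  case True
  then show ?thesis by auto
next
  case False
  then obtain x0 y0 where x0: "f x0 > 0" and y0: "g y0 > 0" using nn by (metis less_eq_real_def)
  have bf: "bdd_above (range f)" "bdd_above (range g)" using bd by (auto intro!: bdd_aboveI)
  define a where "a = (SUP x. f x)"
  define b where "b = (SUP x. g x)"
  have fa: "f x \<le> a" and gb: "g x \<le> b" for x using bf by (auto simp: a_def b_def intro: cSUP_upper)
  have a: "a > 0" and b: "b > 0" using fa[of x0] gb[of y0] x0 y0 by auto
  define s where "s = sqrt (a * b)"
  have s: "s > 0" "s\<^sup>2 = a * b" using a b by (auto simp: s_def)
  have norm: "(\<integral>\<^sup>+x. ennreal (k x / c) \<partial>lborel) = (\<integral>\<^sup>+x. ennreal (k x) \<partial>lborel) / ennreal c"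
    if "c > 0" "k \<in> borel_measurable borel" "\<And>x. 0 \<le> k x" for k :: "real \<Rightarrow> real" and c
  proof -
    have "(\<integral>\<^sup>+x. ennreal (k x / c) \<partial>lborel) = (\<integral>\<^sup>+x. ennreal (k x) / ennreal c \<partial>lborel)"
      using that by (intro nn_integral_cong) (simp add: divide_ennreal)
    also have "\<dots> = (\<integral>\<^sup>+x. ennreal (k x) \<partial>lborel) / ennreal c"
      using that by (intro nn_integral_divide) auto
    finally show ?thesis .
  qed
  have main: "((\<integral>\<^sup>+x. ennreal (f x / a) \<partial>lborel) + (\<integral>\<^sup>+x. ennreal (g x / b) \<partial>lborel)) / 2 \<le> (\<integral>\<^sup>+x. ennreal (h x / s) \<partial>lborel)"
  proof -
    have "((\<integral>\<^sup>+x. ennreal (f x / a) \<partial>lborel) + (\<integral>\<^sup>+x. ennreal (g x / b) \<partial>lborel)) / 2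
      = ((\<integral>\<^sup>+t. emeasure lborel {x. t < f x / a} * indicator {0..} t \<partial>lborel)
        + (\<integral>\<^sup>+t. emeasure lborel {x. t < g x / b} * indicator {0..} t \<partial>lborel)) / 2"
      using nn a b by (subst (1 2) layer_cake) auto
    also have "\<dots> = (\<integral>\<^sup>+t. (emeasure lborel {x. t < f x / a} * indicator {0..} t
       + emeasure lborel {x. t < g x / b} * indicator {0..} t) / 2 \<partial>lborel)"
      by (subst nn_integral_add[symmetric]) (auto intro!: nn_integral_divide[symmetric])
    also have "\<dots> \<le> (\<integral>\<^sup>+t. emeasure lborel {x. t < h x / s} * indicator {0..} t \<partial>lborel)"
    proof (intro nn_integral_mono)
      fix t :: real
      consider "t < 0" | "t \<ge> 1" | "0 \<le> t" "t < 1" by linarith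
      then show "(emeasure lborel {x. t < f x / a} * indicator {0..} t
       + emeasure lborel {x. t < g x / b} * indicator {0..} t) / 2 \<le> emeasure lborel {x. t < h x / s} * indicator {0..} t"
      proof cases
        case 2
        have "a \<le> t * a" "b \<le> t * b" using 2 a b by simp_all
        then have "f x / a \<le> t" "g x / b \<le> t" for x
          using order_trans[OF fa] order_trans[OF gb] a b by (simp_all add: pos_divide_le_eq)
        then have "{x. t < f x / a} = {}" "{x. t < g x / b} = {}" by (auto simp: not_less)
        then show ?thesis by simp
      next
        case 3
        have "(emeasure lborel {x. t < f x / a} + emeasure lborel {x. t < g x / b}) / 2 \<le> emeasure lborel {x. t < h x / s}"
        proof (rule midpoint_set_measure)
          have "\<bar>x\<bar> \<le> L" if "t < f x / a" for x
            using bd(3)[of x] 3 that by (cases "L < \<bar>x\<bar>") auto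
          moreover have "\<bar>x\<bar> \<le> L" if "t < g x / b" for x
            using bd(4)[of x] 3 that by (cases "L < \<bar>x\<bar>") auto
          ultimately have "{x. t < f x / a} \<subseteq> cball 0 L" "{x. t < g x / b} \<subseteq> cball 0 L"
            by auto
          then show "bounded {x. t < f x / a}" "bounded {x. t < g x / b}"
            using bounded_cball bounded_subset by blast+
          have "t * a < a" "t * b < b" using 3 a b by auto
          then obtain x y where "t * a < f x" "t * b < g y"
            using less_cSUP_iff[OF UNIV_not_empty bf(1), of "t * a"] less_cSUP_iff[OF UNIV_not_empty bf(2), of "t * b"]
            unfolding a_def[symmetric] b_def[symmetric] by auto
          then show "{x. t < f x / a} \<noteq> {}" "{x. t < g x / b} \<noteq> {}"
            using a b by (auto simp: pos_less_divide_eq)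
          fix x y assume "x \<in> {x. t < f x / a}" "y \<in> {x. t < g x / b}"
          then have "t * a < f x" "t * b < g y" using a b by (auto simp: pos_less_divide_eq)
          then have "(t * a) * (t * b) < f x * g y"
            using 3 a b by (intro mult_strict_mono') auto
          also have "(t * a) * (t * b) = (t * s)\<^sup>2"
            unfolding power_mult_distrib s(2) by (simp add: power2_eq_square)
          finally have "(t * s)\<^sup>2 < (h ((x + y) / 2))\<^sup>2"
            using le[of x y] by simp
          then have "t * s < h ((x + y) / 2)" using nn(3) power2_less_imp_less by blast
          then show "(x + y) / 2 \<in> {x. t < h x / s}" using s by (simp add: pos_less_divide_eq)
        qed auto
        then show ?thesis using 3 by simp
      qed auto
    qed
    also have "\<dots> = (\<integral>\<^sup>+x. ennreal (h x / s) \<partial>lborel)"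
      using nn s by (subst layer_cake) auto
    finally show ?thesis .
  qed
  show ?thesis
  proof (cases "(\<integral>\<^sup>+x. ennreal (h x) \<partial>lborel)")
    case top
    then show ?thesis by simp
  next
    case (real H)
    have fin: "(\<integral>\<^sup>+x. ennreal (f x) \<partial>lborel) / a < \<top>" "(\<integral>\<^sup>+x. ennreal (g x) \<partial>lborel) / b < \<top>"
    proof -
      have "((\<integral>\<^sup>+x. ennreal (f x) \<partial>lborel) / a + (\<integral>\<^sup>+x. ennreal (g x) \<partial>lborel) / b) / 2 \<le> ennreal H / ennreal s"
        using main norm[OF a, of f] norm[OF b, of g] norm[OF s(1), of h] nn real by simp
      also have "\<dots> < \<top>" using real s by (simp add: divide_ennreal)
      finally show "(\<integral>\<^sup>+x. ennreal (f x) \<partial>lborel) / a < \<top>" "(\<integral>\<^sup>+x. ennreal (g x) \<partial>lborel) / b < \<top>"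
        by (auto simp: ennreal_divide_eq_top_iff less_top[symmetric] divide_ennreal_def ennreal_mult_eq_top_iff)
    qed
    then have "(\<integral>\<^sup>+x. ennreal (f x) \<partial>lborel) \<noteq> \<top>" "(\<integral>\<^sup>+x. ennreal (g x) \<partial>lborel) \<noteq> \<top>"
      using a b by (auto simp: ennreal_divide_eq_top_iff ennreal_top_divide)
    then obtain F G where F: "(\<integral>\<^sup>+x. ennreal (f x) \<partial>lborel) = ennreal F" "F \<ge> 0"
        and G: "(\<integral>\<^sup>+x. ennreal (g x) \<partial>lborel) = ennreal G" "G \<ge> 0"
      by (metis ennreal_cases)
    have "ennreal ((F / a + G / b) / 2) = ((\<integral>\<^sup>+x. ennreal (f x) \<partial>lborel) / a + (\<integral>\<^sup>+x. ennreal (g x) \<partial>lborel) / b) / 2"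
      using F G a b by (simp add: divide_ennreal ennreal_plus[symmetric] ennreal_divide_numeral del: ennreal_plus)
    also have "\<dots> \<le> ennreal (H / s)"
      using main norm[OF a, of f] norm[OF b, of g] norm[OF s(1), of h] nn real s by (simp add: divide_ennreal)
    finally have 1: "(F / a + G / b) / 2 \<le> H / s" using real s by simp
    have "(F * G) / (a * b) = (F / a) * (G / b)" by simp
    also have "\<dots> \<le> ((F / a + G / b) / 2)\<^sup>2"
      using product_le_mean_squared[of "F / a" "G / b"] by simp
    also have "\<dots> \<le> (H / s)\<^sup>2" using 1 F G a b by (intro power_mono) auto
    also have "\<dots> = H\<^sup>2 / (a * b)" using s by (simp add: power_divide)
    finally have "F * G \<le> H\<^sup>2" using a b by (simp add: divide_le_cancel)
    then show ?thesis using F G real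
      by (simp add: ennreal_mult[symmetric] ennreal_power)
  qed
qed

lemma prekopa_leindler:
  fixes f g h :: "real \<Rightarrow> real"
  assumes [measurable]: "f \<in> borel_measurable borel" "g \<in> borel_measurable borel" "h \<in> borel_measurable borel"
    and nn: "\<And>x. 0 \<le> f x" "\<And>x. 0 \<le> g x" "\<And>x. 0 \<le> h x"
    and le: "\<And>x y. f x * g y \<le> (h ((x + y) / 2))\<^sup>2"
  shows "(\<integral>\<^sup>+x. ennreal (f x) \<partial>lborel) * (\<integral>\<^sup>+x. ennreal (g x) \<partial>lborel) \<le> (\<integral>\<^sup>+x. ennreal (h x) \<partial>lborel)\<^sup>2"
proof -
  define T where "T k n x = min (k x) (real n) * indicator {-real n..real n} x" for k :: "real \<Rightarrow> real" and n x
  have [measurable]: "T k n \<in> borel_measurable borel" if [measurable]: "k \<in> borel_measurable borel" for k n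
    unfolding T_def by measurable
  have sup: "(\<integral>\<^sup>+x. ennreal (k x) \<partial>lborel) = (SUP n. \<integral>\<^sup>+x. ennreal (T k n x) \<partial>lborel)"
    if k: "k \<in> borel_measurable borel" "\<And>x. 0 \<le> k x" for k
  proof -
    have "(\<lambda>n. \<integral>\<^sup>+x. ennreal (T k n x) \<partial>lborel) \<longlonglongrightarrow> (\<integral>\<^sup>+x. ennreal (k x) \<partial>lborel)"
    proof (rule nn_integral_LIMSEQ)
      show "incseq (\<lambda>n x. ennreal (T k n x))"
        using k(2) by (auto simp: incseq_def le_fun_def T_def indicator_def intro!: ennreal_leI)
      show "(\<lambda>x. ennreal (T k n x)) \<in> borel_measurable lborel" for n using k by simp
      fix x
      have "T k n x = k x" if "n \<ge> nat \<lceil>max (k x) \<bar>x\<bar>\<rceil>" for n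
      proof -
        have "max (k x) \<bar>x\<bar> \<le> real n" using that by linarith
        then show ?thesis by (auto simp: T_def indicator_def)
      qed
      then show "(\<lambda>n. ennreal (T k n x)) \<longlonglongrightarrow> ennreal (k x)"
        by (intro tendsto_eventually) (auto simp: eventually_sequentially intro!: exI[of _ "nat \<lceil>max (k x) \<bar>x\<bar>\<rceil>"])
    qed
    moreover have "incseq (\<lambda>n. \<integral>\<^sup>+x. ennreal (T k n x) \<partial>lborel)"
      using k(2) by (auto simp: incseq_def T_def indicator_def intro!: ennreal_leI nn_integral_mono)
    ultimately show ?thesis
      using LIMSEQ_SUP LIMSEQ_unique by blast
  qed
  have "(\<integral>\<^sup>+x. ennreal (T f n x) \<partial>lborel) * (\<integral>\<^sup>+x. ennreal (T g m x) \<partial>lborel) \<le> (\<integral>\<^sup>+x. ennreal (h x) \<partial>lborel)\<^sup>2" for n m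
  proof (rule prekopa_leindler_bounded[where L="real (max n m)"])
    fix x y
    have "T f n x * T g m y \<le> f x * g y"
      using nn by (intro mult_mono) (auto simp: T_def indicator_def)
    then show "T f n x * T g m y \<le> (h ((x + y) / 2))\<^sup>2" using le[of x y] by linarith
  qed (use nn in \<open>auto simp: T_def indicator_def min_le_iff_disj\<close>)
  then show ?thesis
    unfolding sup[of f, OF assms(1) nn(1)] sup[of g, OF assms(2) nn(2)]
    by (auto simp: SUP_mult_left_ennreal SUP_mult_right_ennreal intro!: SUP_least)
qed

lemma nn_integral_exp_substitution:
  fixes f :: "real \<Rightarrow> real"
  assumes [measurable]: "f \<in> borel_measurable borel" and nn: "\<And>x. 0 \<le> f x"
  shows "(\<integral>\<^sup>+s. ennreal (f s) * indicator {0<..} s \<partial>lborel) = (\<integral>\<^sup>+u. ennreal (f (exp u) * exp u) \<partial>lborel)"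
proof -
  have "(\<lambda>n. \<integral>\<^sup>+s. ennreal (f s) * indicator {exp (- real n)..exp (real n)} s \<partial>lborel)
      \<longlonglongrightarrow> (\<integral>\<^sup>+s. ennreal (f s) * indicator {0<..} s \<partial>lborel)"
  proof (rule nn_integral_LIMSEQ)
    show "incseq (\<lambda>n s. ennreal (f s) * indicator {exp (- real n)..exp (real n)} s)"
    proof (intro incseq_SucI le_funI)
      fix m :: nat and x
      define n where "n = Suc m"
      have "m \<le> n" by (simp add: n_def)
      then have "exp (- real n) \<le> exp (- real m)" "exp (real m) \<le> exp (real n)" by auto
      then have "{exp (- real m)..exp (real m)} \<subseteq> {exp (- real n)..exp (real n)}"
        unfolding atLeastatMost_subset_iff by blast
      then show "ennreal (f x) * indicator {exp (- real m)..exp (real m)} x \<le> ennreal (f x) * indicator {exp (- real (Suc m))..exp (real (Suc m))} x"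
        unfolding n_def[symmetric] by (intro mult_left_mono indicator_leI) (simp_all only: zero_le subset_iff)
    qed
    fix s :: real
    show "(\<lambda>n. ennreal (f s) * indicator {exp (- real n)..exp (real n)} s) \<longlonglongrightarrow> ennreal (f s) * indicator {0<..} s"
    proof (cases "s > 0")
      case True
      have "indicator {exp (- real n)..exp (real n)} s = (1::ennreal)" if "n \<ge> nat \<lceil>\<bar>ln s\<bar>\<rceil>" for n
      proof -
        have "\<bar>ln s\<bar> \<le> real n" using that by linarith
        then have "exp (- real n) \<le> exp (ln s)" "exp (ln s) \<le> exp (real n)" by auto
        then show ?thesis using True by simp
      qed
      then show ?thesis using True
        by (intro tendsto_eventually) (auto simp: eventually_sequentially intro!: exI[of _ "nat \<lceil>\<bar>ln s\<bar>\<rceil>"])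
    next
      case False
      then have "s < exp (- real n)" for n using exp_gt_zero[of "- real n"] by linarith
      then have "indicator {exp (- real n)..exp (real n)} s = (0::ennreal)" for n
        by (simp add: not_le indicator_def)
      then show ?thesis using False by simp
    qed
  qed simp
  moreover have "(\<lambda>n. \<integral>\<^sup>+u. ennreal (f (exp u) * exp u) * indicator {- real n..real n} u \<partial>lborel)
      \<longlonglongrightarrow> (\<integral>\<^sup>+u. ennreal (f (exp u) * exp u) \<partial>lborel)"
  proof (rule nn_integral_LIMSEQ)
    show "incseq (\<lambda>n s. ennreal (f (exp s) * exp s) * indicator {- real n..real n} s)"
      by (auto simp: incseq_def le_fun_def intro!: mult_left_mono indicator_leI)
    fix s :: real
    have "indicator {- real n..real n} s = (1::ennreal)" if "n \<ge> nat \<lceil>\<bar>s\<bar>\<rceil>" for n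
    proof -
      have "\<bar>s\<bar> \<le> real n" using that by linarith
      then show ?thesis by (auto simp: indicator_def)
    qed
    then show "(\<lambda>n. ennreal (f (exp s) * exp s) * indicator {- real n..real n} s) \<longlonglongrightarrow> ennreal (f (exp s) * exp s)"
      by (intro tendsto_eventually) (auto simp: eventually_sequentially intro!: exI[of _ "nat \<lceil>\<bar>s\<bar>\<rceil>"])
  qed simp
  moreover have "(\<integral>\<^sup>+s. ennreal (f s) * indicator {exp (- real n)..exp (real n)} s \<partial>lborel)
     = (\<integral>\<^sup>+u. ennreal (f (exp u) * exp u) * indicator {- real n..real n} u \<partial>lborel)" for n
  proof -
    have ind: "ennreal a * indicator S x = ennreal (a * indicator S x)" for a and S :: "real set" and x
      by (simp add: indicator_def)
    show ?thesis
      using nn_integral_substitution[of exp "- real n" "real n" f exp]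
      by (auto simp: ind set_borel_measurable_def continuous_on_exp)
  qed
  ultimately show ?thesis using LIMSEQ_unique by simp blast
qed

text \<open>
  The constant is kept symbolic: the same Gaussian integral occurs for the unit ball, and only the
  comparison of the two matters.
\<close>

definition gauss_half :: real where
  "gauss_half = (LINT s|lborel. exp (- (s\<^sup>2 / 2))) / 2"

lemma integrable_gauss: "integrable lborel (\<lambda>s::real. exp (- (s\<^sup>2 / 2)))"
proof -
  have "integrable lborel (\<lambda>s. sqrt (2 * pi) * std_normal_density s)"
    using integrable_std_normal_moment[of 0] by (intro integrable_mult_right) simp
  then show ?thesis by (simp add: std_normal_density_def)
qed

lemma gauss_half_nonneg: "0 \<le> gauss_half"
  unfolding gauss_half_def by simp

lemma nn_integral_gauss: "(\<integral>\<^sup>+s. ennreal (exp (- (s\<^sup>2 / 2))) \<partial>lborel) = ennreal (2 * gauss_half)"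
  using nn_integral_eq_integral[OF integrable_gauss] by (simp add: gauss_half_def)

lemma nn_integral_gauss_half:
  "(\<integral>\<^sup>+s. ennreal (exp (- (s\<^sup>2 / 2))) * indicator {0<..} s \<partial>lborel) = ennreal gauss_half" (is "?P = _")
proof -
  have "(\<integral>\<^sup>+s. ennreal (exp (- (s\<^sup>2 / 2))) \<partial>lborel)
     = (\<integral>\<^sup>+s. ennreal (exp (- (s\<^sup>2 / 2))) * indicator {0<..} s + ennreal (exp (- (s\<^sup>2 / 2))) * indicator {..<0} s \<partial>lborel)"
    using AE_lborel_singleton[of "0::real"] by (intro nn_integral_cong_AE) (auto simp: indicator_def)
  also have "\<dots> = ?P + (\<integral>\<^sup>+s. ennreal (exp (- (s\<^sup>2 / 2))) * indicator {..<0} s \<partial>lborel)"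
    by (rule nn_integral_add) auto
  also have "(\<integral>\<^sup>+s. ennreal (exp (- (s\<^sup>2 / 2))) * indicator {..<0} s \<partial>lborel) = ?P"
    by (subst nn_integral_real_affine[where c="-1" and t=0]) (auto intro!: nn_integral_cong simp: indicator_def)
  finally have "?P + ?P = ennreal (2 * gauss_half)" by (simp add: nn_integral_gauss)
  moreover from this obtain p where p: "?P = ennreal p" "p \<ge> 0"
    by (cases ?P) (auto simp: top_add)
  ultimately show ?thesis
    using gauss_half_nonneg by (simp add: ennreal_plus[symmetric] del: ennreal_plus)
qed

text \<open>
  Prekopa-Leindler in logarithmic coordinates: with \<open>s = exp x\<close> and \<open>t = exp y\<close> the product \<open>s * t\<close> is the
  square of the exponential of the midpoint, so the hypothesis becomes the midpoint condition for a
  Gaussian on the half-line.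
\<close>

lemma half_line_santalo_nn:
  fixes F G :: "real \<Rightarrow> real"
  assumes [measurable]: "F \<in> borel_measurable borel" "G \<in> borel_measurable borel"
    and nn: "\<And>x. 0 \<le> F x" "\<And>x. 0 \<le> G x"
    and le: "\<And>s t. 0 < s \<Longrightarrow> 0 < t \<Longrightarrow> F s * G t \<le> C * exp (- (s * t))"
  shows "(\<integral>\<^sup>+s. ennreal (F s) * indicator {0<..} s \<partial>lborel) * (\<integral>\<^sup>+t. ennreal (G t) * indicator {0<..} t \<partial>lborel)
     \<le> ennreal (C * gauss_half\<^sup>2)"
proof -
  have C: "0 \<le> C"
    using le[of 1 1] nn(1)[of 1] nn(2)[of 1]
    by (smt (verit) mult_nonneg_nonneg exp_gt_zero zero_le_mult_iff)
  have "(\<integral>\<^sup>+s. ennreal (F s) * indicator {0<..} s \<partial>lborel) * (\<integral>\<^sup>+t. ennreal (G t) * indicator {0<..} t \<partial>lborel)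
     = (\<integral>\<^sup>+u. ennreal (F (exp u) * exp u) \<partial>lborel) * (\<integral>\<^sup>+u. ennreal (G (exp u) * exp u) \<partial>lborel)"
    using nn by (simp add: nn_integral_exp_substitution)
  also have "\<dots> \<le> (\<integral>\<^sup>+u. ennreal (sqrt C * exp (- ((exp u)\<^sup>2 / 2)) * exp u) \<partial>lborel)\<^sup>2"
  proof (rule prekopa_leindler)
    fix x y :: real
    have e: "exp ((x + y) / 2) ^ 2 = exp x * exp y"
      by (simp add: exp_add[symmetric] exp_double[symmetric])
    have "F (exp x) * exp x * (G (exp y) * exp y) = (F (exp x) * G (exp y)) * (exp x * exp y)" by simp
    also have "\<dots> \<le> (C * exp (- (exp x * exp y))) * (exp x * exp y)"
      by (intro mult_right_mono le) auto
    also have "\<dots> = C * exp (- (exp ((x + y) / 2))\<^sup>2) * (exp ((x + y) / 2))\<^sup>2"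
      unfolding e by simp
    also have "exp (- (exp ((x + y) / 2))\<^sup>2) = (exp (- ((exp ((x + y) / 2))\<^sup>2 / 2)))\<^sup>2"
      by (simp add: exp_double[symmetric])
    also have "C * (exp (- ((exp ((x + y) / 2))\<^sup>2 / 2)))\<^sup>2 * (exp ((x + y) / 2))\<^sup>2
        = (sqrt C * exp (- ((exp ((x + y) / 2))\<^sup>2 / 2)) * exp ((x + y) / 2))\<^sup>2"
      using C by (simp add: power_mult_distrib)
    finally show "F (exp x) * exp x * (G (exp y) * exp y)
      \<le> (sqrt C * exp (- ((exp ((x + y) / 2))\<^sup>2 / 2)) * exp ((x + y) / 2))\<^sup>2" .
  qed (use nn C in auto)
  also have "(\<integral>\<^sup>+u. ennreal (sqrt C * exp (- ((exp u)\<^sup>2 / 2)) * exp u) \<partial>lborel)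
     = (\<integral>\<^sup>+s. ennreal (sqrt C * exp (- (s\<^sup>2 / 2))) * indicator {0<..} s \<partial>lborel)"
    using C by (subst nn_integral_exp_substitution) auto
  also have "\<dots> = (\<integral>\<^sup>+s. ennreal (sqrt C) * (ennreal (exp (- (s\<^sup>2 / 2))) * indicator {0<..} s) \<partial>lborel)"
    using C by (simp add: ennreal_mult mult.assoc)
  also have "\<dots> = ennreal (sqrt C) * ennreal gauss_half"
    by (subst nn_integral_cmult) (auto simp: nn_integral_gauss_half)
  finally show ?thesis
    using C gauss_half_nonneg by (simp add: ennreal_mult[symmetric] ennreal_power power_mult_distrib)
qed

lemma half_line_santalo:
  fixes F G :: "real \<Rightarrow> real"
  assumes F: "integrable lborel F" and G: "integrable lborel G"
    and nn: "\<And>x. 0 \<le> F x" "\<And>x. 0 \<le> G x"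
    and le: "\<And>s t. 0 < s \<Longrightarrow> 0 < t \<Longrightarrow> F s * G t \<le> C * exp (- (s * t))"
  shows "(LINT s|lborel. indicator {0<..} s * F s) * (LINT t|lborel. indicator {0<..} t * G t) \<le> C * gauss_half\<^sup>2"
proof -
  have C: "0 \<le> C"
    using le[of 1 1] nn(1)[of 1] nn(2)[of 1]
    by (smt (verit) mult_nonneg_nonneg exp_gt_zero zero_le_mult_iff)
  have eq: "(\<integral>\<^sup>+s. ennreal (k s) * indicator {0<..} s \<partial>lborel) = ennreal (LINT s|lborel. indicator {0<..} s * k s)"
    if k: "integrable lborel k" "\<And>x. 0 \<le> k x" for k :: "real \<Rightarrow> real"
  proof -
    have "integrable lborel (\<lambda>s. indicator {0<..} s * k s)"
      using integrable_mult_indicator[OF _ k(1), of "{0<..}"] by simp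
    then have "(\<integral>\<^sup>+s. ennreal (indicator {0<..} s * k s) \<partial>lborel) = ennreal (LINT s|lborel. indicator {0<..} s * k s)"
      using k by (intro nn_integral_eq_integral) auto
    moreover have "(\<integral>\<^sup>+s. ennreal (k s) * indicator {0<..} s \<partial>lborel) = (\<integral>\<^sup>+s. ennreal (indicator {0<..} s * k s) \<partial>lborel)"
      by (intro nn_integral_cong) (auto simp: indicator_def)
    ultimately show ?thesis by simp
  qed
  have "F \<in> borel_measurable borel" "G \<in> borel_measurable borel" using F G by auto
  from half_line_santalo_nn[where F=F and G=G, OF this nn le]
  have "ennreal (LINT s|lborel. indicator {0<..} s * F s) * ennreal (LINT t|lborel. indicator {0<..} t * G t) \<le> ennreal (C * gauss_half\<^sup>2)"
    unfolding eq[OF F nn(1)] eq[OF G nn(2)] by simp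
  moreover have "0 \<le> (LINT s|lborel. indicator {0<..} s * F s)" "0 \<le> (LINT s|lborel. indicator {0<..} s * G s)"
    using nn by (auto intro!: integral_nonneg)
  ultimately show ?thesis
    using C by (simp add: ennreal_mult[symmetric])
qed

section \<open>Coordinate space and shears\<close>

abbreviation coords :: "'i set \<Rightarrow> ('i \<Rightarrow> real) measure" where
  "coords I \<equiv> PiM I (\<lambda>_. lborel)"

interpretation coords: product_sigma_finite "\<lambda>_. lborel :: real measure" ..

text \<open>
  A class of functions that contains every integrand of the induction: it is closed under
  multiplication by locally bounded functions, under shears and under marginals, and all iterated
  integrals exist without further hypotheses.
\<close>

definition box_supported :: "'i set \<Rightarrow> (('i \<Rightarrow> real) \<Rightarrow> real) \<Rightarrow> bool" where
  "box_supported I f \<longleftrightarrow> f \<in> borel_measurable (coords I) \<and>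
     (\<exists>B. \<forall>x\<in>space (coords I). \<bar>f x\<bar> \<le> B \<and> (f x \<noteq> 0 \<longrightarrow> (\<forall>i\<in>I. \<bar>x i\<bar> \<le> B)))"

lemma box_supported_measurable: "box_supported I f \<Longrightarrow> f \<in> borel_measurable (coords I)"
  by (simp add: box_supported_def)

lemma box_supportedE:
  assumes "box_supported I f"
  obtains B where "B > 0" "\<And>x. x \<in> space (coords I) \<Longrightarrow> \<bar>f x\<bar> \<le> B"
    "\<And>x i. x \<in> space (coords I) \<Longrightarrow> f x \<noteq> 0 \<Longrightarrow> i \<in> I \<Longrightarrow> \<bar>x i\<bar> \<le> B"
proof -
  obtain B where B: "\<And>x. x \<in> space (coords I) \<Longrightarrow> \<bar>f x\<bar> \<le> B \<and> (f x \<noteq> 0 \<longrightarrow> (\<forall>i\<in>I. \<bar>x i\<bar> \<le> B))"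
    using assms by (auto simp: box_supported_def)
  show thesis
  proof (rule that[of "\<bar>B\<bar> + 1"])
    show "\<bar>f x\<bar> \<le> \<bar>B\<bar> + 1" if "x \<in> space (coords I)" for x
      using B[OF that] by linarith
    show "\<bar>x i\<bar> \<le> \<bar>B\<bar> + 1" if "x \<in> space (coords I)" "f x \<noteq> 0" "i \<in> I" for x i
      using B[OF that(1)] that by fastforce
  qed simp
qed

lemma box_supported_integrable:
  assumes "finite I" "box_supported I f"
  shows "integrable (coords I) f"
proof -
  obtain B where B: "B > 0" "\<And>x. x \<in> space (coords I) \<Longrightarrow> \<bar>f x\<bar> \<le> B"
    "\<And>x i. x \<in> space (coords I) \<Longrightarrow> f x \<noteq> 0 \<Longrightarrow> i \<in> I \<Longrightarrow> \<bar>x i\<bar> \<le> B"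
    using box_supportedE[OF assms(2)] by blast
  define A where "A = PiE I (\<lambda>_. {-B..B})"
  show ?thesis
  proof (rule integrableI_bounded_set[where A=A and B=B])
    show "A \<in> sets (coords I)" unfolding A_def using assms(1) by (intro sets_PiM_I_finite) auto
    show "emeasure (coords I) A < \<infinity>"
      unfolding A_def using assms(1)
      using B(1) by (subst coords.emeasure_PiM) (simp_all add: ennreal_power)
    show "AE x in coords I. x \<notin> A \<longrightarrow> f x = 0"
    proof (rule AE_I2, rule impI, rule ccontr)
      fix x assume x: "x \<in> space (coords I)" "x \<notin> A" "f x \<noteq> 0"
      have "x \<in> A" unfolding A_def
      proof (rule PiE_I)
        show "x i \<in> {-B..B}" if "i \<in> I" for i
          using B(3)[OF x(1,3) that] by (simp add: abs_le_iff)
        show "x i = undefined" if "i \<notin> I" for i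
          using x(1) that by (simp add: space_PiM PiE_iff extensional_def)
      qed
      with x show False by simp
    qed
  qed (use B box_supported_measurable[OF assms(2)] in auto)
qed

lemma box_supported_mult:
  assumes f: "box_supported I f" and [measurable]: "\<phi> \<in> borel_measurable (coords I)"
    and bd: "\<And>R. \<exists>C. \<forall>x\<in>space (coords I). (\<forall>i\<in>I. \<bar>x i\<bar> \<le> R) \<longrightarrow> \<bar>\<phi> x\<bar> \<le> C"
  shows "box_supported I (\<lambda>x. \<phi> x * f x)"
proof -
  obtain B where B: "B > 0" "\<And>x. x \<in> space (coords I) \<Longrightarrow> \<bar>f x\<bar> \<le> B"
    "\<And>x i. x \<in> space (coords I) \<Longrightarrow> f x \<noteq> 0 \<Longrightarrow> i \<in> I \<Longrightarrow> \<bar>x i\<bar> \<le> B"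
    using box_supportedE[OF f] by blast
  obtain C where C: "\<And>x. x \<in> space (coords I) \<Longrightarrow> (\<forall>i\<in>I. \<bar>x i\<bar> \<le> B) \<Longrightarrow> \<bar>\<phi> x\<bar> \<le> C"
    using bd[of B] by blast
  note [measurable] = box_supported_measurable[OF f]
  have "\<bar>\<phi> x * f x\<bar> \<le> max (\<bar>C\<bar> * B) B \<and> (\<phi> x * f x \<noteq> 0 \<longrightarrow> (\<forall>i\<in>I. \<bar>x i\<bar> \<le> max (\<bar>C\<bar> * B) B))"
    if x: "x \<in> space (coords I)" for x
  proof (cases "f x = 0")
    case True
    then show ?thesis using B(1) by (simp add: le_max_iff_disj)
  next
    case False
    have i: "\<forall>i\<in>I. \<bar>x i\<bar> \<le> B" using B(3)[OF x False] by blast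
    have "\<bar>\<phi> x\<bar> * \<bar>f x\<bar> \<le> \<bar>C\<bar> * B"
      using C[OF x i] B(2)[OF x] by (intro mult_mono) auto
    then show ?thesis using i by (auto simp: abs_mult le_max_iff_disj)
  qed
  then show ?thesis unfolding box_supported_def by (intro conjI exI[of _ "max (\<bar>C\<bar> * B) B"]) auto
qed

lemma box_supported_compose:
  assumes f: "box_supported I f" and T: "T \<in> measurable (coords I) (coords I)"
    and bd: "\<And>R. \<exists>R'. \<forall>x\<in>space (coords I). (\<forall>i\<in>I. \<bar>T x i\<bar> \<le> R) \<longrightarrow> (\<forall>i\<in>I. \<bar>x i\<bar> \<le> R')"
  shows "box_supported I (\<lambda>x. f (T x))"
proof -
  obtain B where B: "B > 0" "\<And>x. x \<in> space (coords I) \<Longrightarrow> \<bar>f x\<bar> \<le> B"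
    "\<And>x i. x \<in> space (coords I) \<Longrightarrow> f x \<noteq> 0 \<Longrightarrow> i \<in> I \<Longrightarrow> \<bar>x i\<bar> \<le> B"
    using box_supportedE[OF f] by blast
  obtain R' where R': "\<And>x. x \<in> space (coords I) \<Longrightarrow> (\<forall>i\<in>I. \<bar>T x i\<bar> \<le> B) \<Longrightarrow> (\<forall>i\<in>I. \<bar>x i\<bar> \<le> R')"
    using bd[of B] by blast
  have "\<bar>f (T x)\<bar> \<le> max B R' \<and> (f (T x) \<noteq> 0 \<longrightarrow> (\<forall>i\<in>I. \<bar>x i\<bar> \<le> max B R'))"
    if x: "x \<in> space (coords I)" for x
  proof -
    have Tx: "T x \<in> space (coords I)" using measurable_space[OF T x] .
    show ?thesis
      using B(2)[OF Tx] B(3)[OF Tx] R'[OF x] by (auto simp: le_max_iff_disj)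
  qed
  then show ?thesis unfolding box_supported_def
    using measurable_compose[OF T box_supported_measurable[OF f]] by blast
qed

lemma space_coords_upd: "x \<in> space (coords I) \<Longrightarrow> x(k := t) \<in> space (coords (insert k I))"
  unfolding space_PiM by (rule PiE_fun_upd) auto

lemma box_supported_section:
  assumes "k \<notin> I" "box_supported (insert k I) f" "x \<in> space (coords I)"
  shows "integrable lborel (\<lambda>t. f (x(k := t)))"
proof -
  obtain B where B: "B > 0" "\<And>x. x \<in> space (coords (insert k I)) \<Longrightarrow> \<bar>f x\<bar> \<le> B"
    "\<And>x i. x \<in> space (coords (insert k I)) \<Longrightarrow> f x \<noteq> 0 \<Longrightarrow> i \<in> insert k I \<Longrightarrow> \<bar>x i\<bar> \<le> B"
    using box_supportedE[OF assms(2)] by blast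
  have upd: "x(k := t) \<in> space (coords (insert k I))" for t
    by (rule space_coords_upd[OF assms(3)])
  have m: "(\<lambda>t. f (x(k := t))) \<in> borel_measurable lborel"
    using measurable_compose[OF measurable_component_update[OF assms(3,1)] box_supported_measurable[OF assms(2)]] by simp
  show ?thesis
  proof (rule integrableI_bounded_set[where A="{-B..B}" and B=B])
    show "AE t in lborel. t \<notin> {-B..B} \<longrightarrow> f (x(k := t)) = 0"
    proof (rule AE_I2, rule impI, rule ccontr)
      fix t assume t: "t \<notin> {-B..B}" "f (x(k := t)) \<noteq> 0"
      have "\<bar>(x(k := t)) k\<bar> \<le> B" by (rule B(3)[OF upd t(2)]) simp
      with t(1) show False by (simp add: abs_le_iff)
    qed
  qed (use B(1) B(2)[OF upd] m in auto)
qed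

lemma box_supported_marginal:
  assumes "k \<notin> I" "box_supported (insert k I) f"
  shows "box_supported I (\<lambda>x. LINT t|lborel. f (x(k := t)))"
proof -
  obtain B where B: "B > 0" "\<And>x. x \<in> space (coords (insert k I)) \<Longrightarrow> \<bar>f x\<bar> \<le> B"
    "\<And>x i. x \<in> space (coords (insert k I)) \<Longrightarrow> f x \<noteq> 0 \<Longrightarrow> i \<in> insert k I \<Longrightarrow> \<bar>x i\<bar> \<le> B"
    using box_supportedE[OF assms(2)] by blast
  note [measurable] = box_supported_measurable[OF assms(2)]
  have "(\<lambda>x. LINT t|lborel. f (x(k := t))) \<in> borel_measurable (coords I)"
    by (rule lborel.borel_measurable_lebesgue_integral) measurable
  moreover have "\<bar>LINT t|lborel. f (x(k := t))\<bar> \<le> max (B * (2 * B)) B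
      \<and> ((LINT t|lborel. f (x(k := t))) \<noteq> 0 \<longrightarrow> (\<forall>i\<in>I. \<bar>x i\<bar> \<le> max (B * (2 * B)) B))"
    if x: "x \<in> space (coords I)" for x
  proof -
    have upd: "x(k := t) \<in> space (coords (insert k I))" for t
      by (rule space_coords_upd[OF x])
    have "\<bar>LINT t|lborel. f (x(k := t))\<bar> \<le> (LINT t|lborel. \<bar>f (x(k := t))\<bar>)"
      using integral_norm_bound[of lborel "\<lambda>t. f (x(k := t))"] by simp
    also have "\<dots> \<le> (LINT t|lborel. B * indicator {-B..B} t)"
    proof (rule integral_mono)
      show "integrable lborel (\<lambda>t. B * indicator {-B..B} t :: real)"
        by (intro integrable_mult_right integrable_real_indicator) (auto simp: emeasure_lborel_Icc_eq)
      show "\<bar>f (x(k := t))\<bar> \<le> B * indicator {-B..B} t" for t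
      proof (cases "f (x(k := t)) = 0")
        case False
        have "\<bar>(x(k := t)) k\<bar> \<le> B" by (rule B(3)[OF upd False]) simp
        then show ?thesis using B(2)[OF upd, of t] by (simp add: abs_le_iff)
      qed (use B(1) in simp)
    qed (use box_supported_section[OF assms x] in auto)
    also have "\<dots> = B * (2 * B)" using B(1) by simp
    finally have 1: "\<bar>LINT t|lborel. f (x(k := t))\<bar> \<le> B * (2 * B)" .
    have 2: "\<bar>x i\<bar> \<le> B" if ne: "(LINT t|lborel. f (x(k := t))) \<noteq> 0" and i: "i \<in> I" for i
    proof -
      obtain t where "f (x(k := t)) \<noteq> 0" using ne by fastforce
      from B(3)[OF upd this, of i] i have "\<bar>(x(k := t)) i\<bar> \<le> B" by simp
      moreover have "i \<noteq> k" using i assms(1) by blast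
      ultimately show ?thesis by simp
    qed
    show ?thesis using 1 2 by (auto simp: le_max_iff_disj)
  qed
  ultimately show ?thesis unfolding box_supported_def by blast
qed

lemma integral_coords_insert:
  assumes "finite I" "k \<notin> I" "box_supported (insert k I) f"
  shows "(LINT x|coords (insert k I). f x) = (LINT x|coords I. LINT t|lborel. f (x(k := t)))"
  by (rule coords.product_integral_insert[OF assms(1,2) box_supported_integrable[OF _ assms(3)]]) (simp add: assms(1))

lemma coords_translate:
  assumes "finite I"
  shows "distr (coords I) (coords I) (\<lambda>x. \<lambda>i\<in>I. x i + a i) = coords I"
proof (rule coords.PiM_eqI)
  fix A :: "'a \<Rightarrow> real set" assume A: "\<And>i. i \<in> I \<Longrightarrow> A i \<in> sets lborel"
  have T: "(\<lambda>x. \<lambda>i\<in>I. x i + a i) \<in> measurable (coords I) (coords I)"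
    by measurable
  have pre: "(\<lambda>x. \<lambda>i\<in>I. x i + a i) -` PiE I A \<inter> space (coords I) = PiE I (\<lambda>i. (\<lambda>t. t + a i) -` A i)"
    by (auto simp: space_PiM PiE_iff)
  have m: "(\<lambda>t. t + a i) -` A i \<in> sets lborel" if "i \<in> I" for i
    using A[OF that] measurable_sets_borel[of "\<lambda>t. t + a i" borel "A i"] by simp
  have eq: "emeasure lborel ((\<lambda>t. t + a i) -` A i) = emeasure lborel (A i)" if "i \<in> I" for i
  proof -
    have [measurable]: "A i \<in> sets borel" using A[OF that] by simp
    have "emeasure lborel (A i) = (\<integral>\<^sup>+t. indicator (A i) t \<partial>lborel)" using A[OF that] by simp
    also have "\<dots> = (\<integral>\<^sup>+t. indicator (A i) (a i + 1 * t) \<partial>lborel)"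
      by (subst nn_integral_real_affine[where c=1 and t="a i"]) auto
    also have "\<dots> = (\<integral>\<^sup>+t. indicator ((\<lambda>t. t + a i) -` A i) t \<partial>lborel)"
      by (intro nn_integral_cong) (auto simp: indicator_def add.commute)
    also have "\<dots> = emeasure lborel ((\<lambda>t. t + a i) -` A i)" using m[OF that] by simp
    finally show ?thesis ..
  qed
  have "emeasure (distr (coords I) (coords I) (\<lambda>x. \<lambda>i\<in>I. x i + a i)) (PiE I A)
    = emeasure (coords I) (PiE I (\<lambda>i. (\<lambda>t. t + a i) -` A i))"
    using A assms by (subst emeasure_distr[OF T]) (auto simp: pre intro!: sets_PiM_I_finite)
  also have "\<dots> = (\<Prod>i\<in>I. emeasure lborel (A i))"
    using assms m eq by (subst coords.emeasure_PiM) auto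
  finally show "emeasure (distr (coords I) (coords I) (\<lambda>x. \<lambda>i\<in>I. x i + a i)) (PiE I A) = (\<Prod>i\<in>I. emeasure lborel (A i))" .
qed (use assms in simp_all)

text \<open>
  In the coordinates of \<open>insert k I\<close>: the affine map that moves coordinate \<open>k\<close> by \<open>c\<close> and the others by
  \<open>z + y k * v\<close>. It takes the axis of direction \<open>k\<close> to the line through \<open>(z, c)\<close> with direction \<open>(v, 1)\<close>.
\<close>

definition shear :: "'i \<Rightarrow> 'i set \<Rightarrow> ('i \<Rightarrow> real) \<Rightarrow> ('i \<Rightarrow> real) \<Rightarrow> real \<Rightarrow> ('i \<Rightarrow> real) \<Rightarrow> 'i \<Rightarrow> real" where
  "shear k I v z c y = (\<lambda>i\<in>insert k I. if i = k then y k + c else y i + (z i + y k * v i))"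

text \<open>
  The inverse transpose of the linear part of \<open>shear\<close>, so that pairing the images of two vectors under
  \<open>coshear\<close> and the linear part of \<open>shear\<close> gives the pairing of the vectors themselves.
\<close>

definition coshear :: "'i \<Rightarrow> 'i set \<Rightarrow> ('i \<Rightarrow> real) \<Rightarrow> ('i \<Rightarrow> real) \<Rightarrow> 'i \<Rightarrow> real" where
  "coshear k I v x = (\<lambda>i\<in>insert k I. if i = k then x k - (\<Sum>j\<in>I. x j * v j) else x i)"

lemma shear_measurable [measurable]:
  assumes "finite I"
  shows "shear k I v z c \<in> measurable (coords (insert k I)) (coords (insert k I))"
  unfolding shear_def
proof (rule measurable_restrict)
  fix i assume "i \<in> insert k I"
  then have [measurable]: "(\<lambda>y. y i) \<in> borel_measurable (coords (insert k I))" "(\<lambda>y. y k) \<in> borel_measurable (coords (insert k I))"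
    using measurable_component_singleton[of _ "insert k I" "\<lambda>_. lborel :: real measure"] by auto
  show "(\<lambda>y. if i = k then y k + c else y i + (z i + y k * v i)) \<in> measurable (coords (insert k I)) lborel"
    by (cases "i = k") simp_all
qed

lemma coshear_measurable [measurable]:
  assumes "finite I"
  shows "coshear k I v \<in> measurable (coords (insert k I)) (coords (insert k I))"
  unfolding coshear_def
proof (rule measurable_restrict)
  fix i assume "i \<in> insert k I"
  have [measurable]: "(\<lambda>y. y j) \<in> borel_measurable (coords (insert k I))" if "j \<in> insert k I" for j
    using measurable_component_singleton[OF that, of "\<lambda>_. lborel :: real measure"] by auto
  have "(\<lambda>x. \<Sum>j\<in>I. x j * v j) \<in> borel_measurable (coords (insert k I))"
    by (intro borel_measurable_sum borel_measurable_times) auto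
  with \<open>i \<in> insert k I\<close> show "(\<lambda>x. if i = k then x k - (\<Sum>j\<in>I. x j * v j) else x i) \<in> measurable (coords (insert k I)) lborel"
    by (cases "i = k") simp_all
qed

lemma distr_eqI_nn_integral:
  assumes T: "T \<in> measurable M M"
    and eq: "\<And>\<phi>. \<phi> \<in> borel_measurable M \<Longrightarrow> (\<integral>\<^sup>+x. \<phi> (T x) \<partial>M) = (\<integral>\<^sup>+x. \<phi> x \<partial>M)"
  shows "distr M M T = M"
proof (rule measure_eqI)
  fix A assume "A \<in> sets (distr M M T)"
  then have A: "A \<in> sets M" by simp
  have "emeasure (distr M M T) A = (\<integral>\<^sup>+x. indicator A x \<partial>distr M M T)" using A by simp
  also have "\<dots> = (\<integral>\<^sup>+x. indicator A (T x) \<partial>M)" using A T by (subst nn_integral_distr) auto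
  also have "\<dots> = emeasure M A" using A by (subst eq) auto
  finally show "emeasure (distr M M T) A = emeasure M A" .
qed simp

lemma distr_coshear:
  assumes "finite I" "k \<notin> I"
  shows "distr (coords (insert k I)) (coords (insert k I)) (coshear k I v) = coords (insert k I)"
proof (rule distr_eqI_nn_integral)
  fix \<phi> :: "('a \<Rightarrow> real) \<Rightarrow> ennreal" assume [measurable]: "\<phi> \<in> borel_measurable (coords (insert k I))"
  have "(\<integral>\<^sup>+x. \<phi> (coshear k I v x) \<partial>coords (insert k I))
    = (\<integral>\<^sup>+x. \<integral>\<^sup>+t. \<phi> (coshear k I v (x(k := t))) \<partial>lborel \<partial>coords I)"
    using assms by (subst coords.product_nn_integral_insert) auto
  also have "\<dots> = (\<integral>\<^sup>+x. \<integral>\<^sup>+t. \<phi> (x(k := t)) \<partial>lborel \<partial>coords I)"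
  proof (rule nn_integral_cong)
    fix x assume x: "x \<in> space (coords I)"
    have m [measurable]: "(\<lambda>t. \<phi> (x(k := t))) \<in> borel_measurable borel"
      using measurable_compose[OF measurable_component_update[OF x assms(2)], of \<phi> borel] by simp
    have "coshear k I v (x(k := t)) = x(k := - (\<Sum>j\<in>I. x j * v j) + 1 * t)" for t
    proof -
      have "(\<Sum>j\<in>I. (x(k := t)) j * v j) = (\<Sum>j\<in>I. x j * v j)"
        using assms by (intro sum.cong) auto
      then show ?thesis using x assms
        by (auto simp: coshear_def fun_eq_iff space_PiM PiE_iff extensional_def restrict_def)
    qed
    then have "(\<integral>\<^sup>+t. \<phi> (coshear k I v (x(k := t))) \<partial>lborel) = (\<integral>\<^sup>+t. \<phi> (x(k := - (\<Sum>j\<in>I. x j * v j) + 1 * t)) \<partial>lborel)"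
      by simp
    also have "\<dots> = (\<integral>\<^sup>+t. \<phi> (x(k := t)) \<partial>lborel)"
      using nn_integral_real_affine[OF m, of 1 "- (\<Sum>j\<in>I. x j * v j)"] by simp
    finally show "(\<integral>\<^sup>+t. \<phi> (coshear k I v (x(k := t))) \<partial>lborel) = (\<integral>\<^sup>+t. \<phi> (x(k := t)) \<partial>lborel)" .
  qed
  also have "\<dots> = (\<integral>\<^sup>+x. \<phi> x \<partial>coords (insert k I))"
    using assms by (subst coords.product_nn_integral_insert) auto
  finally show "(\<integral>\<^sup>+x. \<phi> (coshear k I v x) \<partial>coords (insert k I)) = (\<integral>\<^sup>+x. \<phi> x \<partial>coords (insert k I))" .
qed (rule coshear_measurable[OF assms(1)])

lemma distr_shear:
  assumes "finite I" "k \<notin> I"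
  shows "distr (coords (insert k I)) (coords (insert k I)) (shear k I v z c) = coords (insert k I)"
proof (rule distr_eqI_nn_integral)
  fix \<phi> :: "('a \<Rightarrow> real) \<Rightarrow> ennreal" assume [measurable]: "\<phi> \<in> borel_measurable (coords (insert k I))"
  have sec: "(\<lambda>x. \<phi> (x(k := t))) \<in> borel_measurable (coords I)" for t
  proof -
    have "(\<lambda>x. x(k := t)) \<in> measurable (coords I) (coords (insert k I))"
      by (rule measurable_fun_upd[where J=I]) auto
    from measurable_compose[OF this, of \<phi> borel] show ?thesis by simp
  qed
  have "(\<integral>\<^sup>+x. \<phi> (shear k I v z c x) \<partial>coords (insert k I))
    = (\<integral>\<^sup>+t. \<integral>\<^sup>+x. \<phi> (shear k I v z c (x(k := t))) \<partial>coords I \<partial>lborel)"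
    using assms by (subst coords.product_nn_integral_insert_rev) auto
  also have "\<dots> = (\<integral>\<^sup>+t. \<integral>\<^sup>+x. \<phi> (x(k := c + 1 * t)) \<partial>coords I \<partial>lborel)"
  proof (rule nn_integral_cong)
    fix t
    have T: "(\<lambda>x. \<lambda>i\<in>I. x i + (z i + t * v i)) \<in> measurable (coords I) (coords I)" by measurable
    have "(\<integral>\<^sup>+x. \<phi> (x(k := c + 1 * t)) \<partial>coords I)
       = (\<integral>\<^sup>+x. \<phi> (x(k := c + 1 * t)) \<partial>distr (coords I) (coords I) (\<lambda>x. \<lambda>i\<in>I. x i + (z i + t * v i)))"
      by (simp add: coords_translate[OF assms(1)])
    also have "\<dots> = (\<integral>\<^sup>+x. \<phi> ((\<lambda>i\<in>I. x i + (z i + t * v i))(k := c + 1 * t)) \<partial>coords I)"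
      using sec by (subst nn_integral_distr[OF T]) simp_all
    also have "\<dots> = (\<integral>\<^sup>+x. \<phi> (shear k I v z c (x(k := t))) \<partial>coords I)"
      using assms by (intro nn_integral_cong arg_cong[where f=\<phi>]) (auto simp: shear_def fun_eq_iff)
    finally show "(\<integral>\<^sup>+x. \<phi> (shear k I v z c (x(k := t))) \<partial>coords I) = (\<integral>\<^sup>+x. \<phi> (x(k := c + 1 * t)) \<partial>coords I)" ..
  qed
  also have "\<dots> = (\<integral>\<^sup>+t. \<integral>\<^sup>+x. \<phi> (x(k := t)) \<partial>coords I \<partial>lborel)"
  proof -
    interpret fI: finite_product_sigma_finite "\<lambda>_. lborel :: real measure" I by standard fact
    have m: "(\<lambda>t. \<integral>\<^sup>+x. \<phi> (x(k := t)) \<partial>coords I) \<in> borel_measurable borel"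
      by (rule fI.borel_measurable_nn_integral) measurable
    show ?thesis using nn_integral_real_affine[OF m, of 1 c] by simp
  qed
  also have "\<dots> = (\<integral>\<^sup>+x. \<phi> x \<partial>coords (insert k I))"
    using assms by (subst coords.product_nn_integral_insert_rev) auto
  finally show "(\<integral>\<^sup>+x. \<phi> (shear k I v z c x) \<partial>coords (insert k I)) = (\<integral>\<^sup>+x. \<phi> x \<partial>coords (insert k I))" .
qed (rule shear_measurable[OF assms(1)])

lemma AE_coords_neq:
  assumes "finite I" "k \<in> I"
  shows "AE x in coords I. x k \<noteq> c"
proof -
  define A where "A = PiE I (\<lambda>i. if i = k then {c} else UNIV :: real set)"
  have "emeasure (coords I) A = (\<Prod>i\<in>I. emeasure lborel (if i = k then {c} else UNIV :: real set))"
    unfolding A_def using assms by (intro coords.emeasure_PiM) auto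
  also have "\<dots> = 0" using assms by (intro prod_zero) auto
  finally have "emeasure (coords I) A = 0" .
  moreover have "A \<in> sets (coords I)" unfolding A_def using assms by (intro sets_PiM_I_finite) auto
  ultimately have "A \<in> null_sets (coords I)" by auto
  then show ?thesis
    by (rule AE_I') (auto simp: A_def space_PiM PiE_iff extensional_def)
qed

section \<open>The functional Santalo inequality\<close>

lemma box_supported_indicator:
  assumes "box_supported I g" "finite I" "S \<in> sets borel" "k \<in> I"
  shows "box_supported I (\<lambda>y. indicator S (y k) * g y)"
proof (rule box_supported_mult[OF assms(1)])
  note [measurable] = assms(3)
  show "(\<lambda>y. indicator S (y k) :: real) \<in> borel_measurable (coords I)"
    using assms(4) by measurable
  show "\<exists>C. \<forall>x\<in>space (coords I). (\<forall>i\<in>I. \<bar>x i\<bar> \<le> R) \<longrightarrow> \<bar>indicator S (x k) :: real\<bar> \<le> C" for R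
    by (intro exI[of _ 1]) (auto simp: indicator_def)
qed

lemma box_supported_mult_coord:
  assumes "box_supported I g" "k \<in> I"
  shows "box_supported I (\<lambda>y. y k * g y)"
proof (rule box_supported_mult[OF assms(1)])
  show "(\<lambda>y. y k) \<in> borel_measurable (coords I)" using assms(2) by measurable
  show "\<exists>C. \<forall>x\<in>space (coords I). (\<forall>i\<in>I. \<bar>x i\<bar> \<le> R) \<longrightarrow> \<bar>x k\<bar> \<le> C" for R
    using assms(2) by blast
qed

lemma half_line_santalo_signed:
  fixes F G :: "real \<Rightarrow> real"
  assumes F: "integrable lborel F" and G: "integrable lborel G"
    and nn: "\<And>x. 0 \<le> F x" "\<And>x. 0 \<le> G x" and e: "\<epsilon> = 1 \<or> \<epsilon> = - 1"
    and le: "\<And>s t. F s * G t \<le> C * exp (- (s * t))"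
  shows "(LINT s|lborel. indicator {0<..} (\<epsilon> * s) * F s) * (LINT t|lborel. indicator {0<..} (\<epsilon> * t) * G t) \<le> C * gauss_half\<^sup>2"
proof -
  have eps: "\<epsilon> \<noteq> 0" "\<bar>\<epsilon>\<bar> = 1" "\<epsilon> * \<epsilon> = 1" "\<epsilon> * (\<epsilon> * s) = s" for s using e by auto
  have flip: "(LINT s|lborel. indicator {0<..} (\<epsilon> * s) * K s) = (LINT s|lborel. indicator {0<..} s * K (\<epsilon> * s))" for K :: "real \<Rightarrow> real"
    using lborel_integral_real_affine[OF eps(1), of "\<lambda>s. indicator {0<..} (\<epsilon> * s) * K s" 0] eps by simp
  show ?thesis unfolding flip
  proof (rule half_line_santalo)
    show "integrable lborel (\<lambda>s. F (\<epsilon> * s))" "integrable lborel (\<lambda>s. G (\<epsilon> * s))"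
      using lborel_integrable_real_affine[OF F eps(1), of 0] lborel_integrable_real_affine[OF G eps(1), of 0] by auto
    show "F (\<epsilon> * s) * G (\<epsilon> * t) \<le> C * exp (- (s * t))" for s t
      using le[of "\<epsilon> * s" "\<epsilon> * t"] e by auto
  qed (use nn in auto)
qed

text \<open>
  The functional inequality for the coordinates in \<open>I\<close>. The constant \<open>C\<close> absorbs the one-dimensional
  factors that the induction produces.
\<close>

definition exp_santalo :: "'i set \<Rightarrow> bool" where
  "exp_santalo I \<longleftrightarrow> (\<forall>f g C. box_supported I f \<longrightarrow> box_supported I g \<longrightarrow> (\<forall>x. 0 \<le> f x) \<longrightarrow> (\<forall>x. 0 \<le> g x) \<longrightarrow>
     (\<forall>i\<in>I. (LINT x|coords I. x i * f x) = 0) \<longrightarrow>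
     (\<forall>x\<in>space (coords I). \<forall>y\<in>space (coords I). f x * g y \<le> C * exp (- (\<Sum>i\<in>I. x i * y i))) \<longrightarrow>
     (LINT x|coords I. f x) * (LINT x|coords I. g x) \<le> C * (2 * gauss_half) ^ (2 * card I))"

lemma exp_santalo_empty: "exp_santalo {}"
  by (auto simp: exp_santalo_def PiM_empty space_PiM lebesgue_integral_count_space_finite)

text \<open>
  The marginals of the restrictions to a half-space satisfy the hypothesis of the inequality in one
  dimension less, by the inequality on the half-line applied fibre by fibre; \<open>g\<close> provides the
  centred marginal, so \<open>f\<close> and \<open>g\<close> exchange their roles.
\<close>

lemma exp_santalo_half_space:
  assumes IH: "exp_santalo I" and I: "finite I" "k \<notin> I" and e: "\<epsilon> = 1 \<or> \<epsilon> = - 1"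
    and f: "box_supported (insert k I) f" "\<And>x. 0 \<le> f x" and g: "box_supported (insert k I) g" "\<And>x. 0 \<le> g x"
    and le: "\<And>x y. x \<in> space (coords (insert k I)) \<Longrightarrow> y \<in> space (coords (insert k I)) \<Longrightarrow>
        f x * g y \<le> C * exp (- (\<Sum>i\<in>insert k I. x i * y i))"
    and bar: "\<And>i. i \<in> I \<Longrightarrow> (LINT y|coords (insert k I). indicator {0<..} (\<epsilon> * y k) * (y i * g y)) = 0"
  shows "(LINT y|coords (insert k I). indicator {0<..} (\<epsilon> * y k) * g y)
       * (LINT x|coords (insert k I). indicator {0<..} (\<epsilon> * x k) * f x)
      \<le> C * gauss_half\<^sup>2 * (2 * gauss_half) ^ (2 * card I)"
proof -
  define S where "S = {t. 0 < \<epsilon> * t}"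
  have S: "S \<in> sets borel" unfolding S_def by measurable
  have ind: "indicator {0<..} (\<epsilon> * t) = (indicator S t :: real)" for t by (simp add: S_def indicator_def)
  define F where "F x = (LINT t|lborel. indicator S t * f (x(k := t)))" for x
  define G where "G x = (LINT t|lborel. indicator S t * g (x(k := t)))" for x
  have nf: "box_supported (insert k I) (\<lambda>x. indicator S (x k) * f x)" and ng: "box_supported (insert k I) (\<lambda>x. indicator S (x k) * g x)"
    using box_supported_indicator[OF f(1) _ S, of k] box_supported_indicator[OF g(1) _ S, of k] I by auto
  have nF: "box_supported I F" and nG: "box_supported I G"
    using box_supported_marginal[OF I(2) nf] box_supported_marginal[OF I(2) ng] unfolding F_def G_def by simp_all
  have upd: "x(k := t) \<in> space (coords (insert k I))" if "x \<in> space (coords I)" for x t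
    using that by (rule space_coords_upd)
  have bound: "G x * F y \<le> C * gauss_half\<^sup>2 * exp (- (\<Sum>i\<in>I. x i * y i))"
    if x: "x \<in> space (coords I)" and y: "y \<in> space (coords I)" for x y
  proof -
    have "G x * F y \<le> (C * exp (- (\<Sum>i\<in>I. x i * y i))) * gauss_half\<^sup>2"
      unfolding F_def G_def ind[symmetric]
    proof (rule half_line_santalo_signed[OF box_supported_section[OF I(2) g(1) x] box_supported_section[OF I(2) f(1) y] g(2) f(2) e])
      fix s t
      have "g (x(k := s)) * f (y(k := t)) \<le> C * exp (- (\<Sum>i\<in>insert k I. (y(k := t)) i * (x(k := s)) i))"
        using le[OF upd[OF y] upd[OF x], of t s] by (simp add: mult.commute)
      also have "(\<Sum>i\<in>insert k I. (y(k := t)) i * (x(k := s)) i) = s * t + (\<Sum>i\<in>I. x i * y i)"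
        using I by (auto intro!: sum.cong simp: mult.commute)
      also have "exp (- (s * t + (\<Sum>i\<in>I. x i * y i))) = exp (- (\<Sum>i\<in>I. x i * y i)) * exp (- (s * t))"
        unfolding exp_add[symmetric] by (rule arg_cong[where f=exp]) simp
      finally show "g (x(k := s)) * f (y(k := t)) \<le> C * exp (- (\<Sum>i\<in>I. x i * y i)) * exp (- (s * t))"
        unfolding mult.assoc .
    qed
    then show ?thesis by (simp add: ac_simps)
  qed
  have intF: "(LINT x|coords I. F x) = (LINT x|coords (insert k I). indicator {0<..} (\<epsilon> * x k) * f x)"
    and intG: "(LINT x|coords I. G x) = (LINT x|coords (insert k I). indicator {0<..} (\<epsilon> * x k) * g x)"
    unfolding ind by (simp_all add: integral_coords_insert[OF I nf] integral_coords_insert[OF I ng] F_def G_def)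
  have barG: "(LINT x|coords I. x i * G x) = 0" if i: "i \<in> I" for i
  proof -
    have n: "box_supported (insert k I) (\<lambda>y. indicator S (y k) * (y i * g y))"
      using box_supported_indicator[OF box_supported_mult_coord[OF g(1)] _ S, of i k] i I by simp
    have "x i * G x = (LINT t|lborel. indicator S t * (x i * g (x(k := t))))" for x
      unfolding G_def by (subst integral_mult_right_zero[symmetric]) (simp add: mult.left_commute)
    then have "(LINT x|coords I. x i * G x) = (LINT x|coords (insert k I). indicator S (x k) * (x i * g x))"
      unfolding integral_coords_insert[OF I n] using i I(2) by (auto intro!: Bochner_Integration.integral_cong)
    then show ?thesis using bar[OF i] by (simp add: ind)
  qed
  have "(LINT x|coords I. G x) * (LINT x|coords I. F x) \<le> (C * gauss_half\<^sup>2) * (2 * gauss_half) ^ (2 * card I)"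
    using IH[unfolded exp_santalo_def, rule_format, OF nG nF, of "C * gauss_half\<^sup>2"] barG bound f(2) g(2)
    unfolding F_def G_def by (auto intro!: Bochner_Integration.integral_nonneg)
  then show ?thesis by (simp add: intF intG)
qed

text \<open>
  The two halves of \<open>f\<close> obey the same bound, a quarter of the full one divided by \<open>m\<close>, and almost every
  point lies in one of the half-spaces.
\<close>

lemma exp_santalo_balanced:
  assumes IH: "exp_santalo I" and I: "finite I" "k \<notin> I"
    and f: "box_supported (insert k I) f" "\<And>x. 0 \<le> f x" and g: "box_supported (insert k I) g" "\<And>x. 0 \<le> g x"
    and le: "\<And>x y. x \<in> space (coords (insert k I)) \<Longrightarrow> y \<in> space (coords (insert k I)) \<Longrightarrow>
        f x * g y \<le> C * exp (- (\<Sum>i\<in>insert k I. x i * y i))"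
    and bar: "\<And>\<epsilon> i. \<epsilon> = 1 \<or> \<epsilon> = -1 \<Longrightarrow> i \<in> I \<Longrightarrow> (LINT y|coords (insert k I). indicator {0<..} (\<epsilon> * y k) * (y i * g y)) = 0"
    and m: "\<And>\<epsilon>. \<epsilon> = 1 \<or> \<epsilon> = -1 \<Longrightarrow> (LINT y|coords (insert k I). indicator {0<..} (\<epsilon> * y k) * g y) = m"
  shows "m * (LINT x|coords (insert k I). f x) \<le> C / 2 * (2 * gauss_half) ^ (2 * card (insert k I))"
proof -
  let ?h = "\<lambda>\<epsilon>. LINT x|coords (insert k I). indicator {0<..} (\<epsilon> * x k) * f x"
  have n: "box_supported (insert k I) (\<lambda>x. indicator {0<..} (\<epsilon> * x k) * f x)" for \<epsilon> :: real
    using box_supported_indicator[OF f(1), of "{t. 0 < \<epsilon> * t}" k] I by (simp add: indicator_def)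
  have i: "integrable (coords (insert k I)) (\<lambda>x. indicator {0<..} (\<epsilon> * x k) * f x)" for \<epsilon> :: real
    using box_supported_integrable[OF _ n] I by auto
  have half: "m * ?h \<epsilon> \<le> C * gauss_half\<^sup>2 * (2 * gauss_half) ^ (2 * card I)" if "\<epsilon> = 1 \<or> \<epsilon> = -1" for \<epsilon>
    using exp_santalo_half_space[OF IH I that f g le bar[OF that]] by (simp add: m[OF that])
  have "(LINT x|coords (insert k I). f x) = (LINT x|coords (insert k I). indicator {0<..} (1 * x k) * f x + indicator {0<..} (-1 * x k) * f x)"
    using AE_coords_neq[of "insert k I" k 0] I box_supported_measurable[OF f(1)] box_supported_measurable[OF n, of 1] box_supported_measurable[OF n, of "-1"]
    by (intro integral_cong_AE borel_measurable_add) (auto simp: indicator_def)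
  also have "\<dots> = ?h 1 + ?h (-1)"
    by (rule Bochner_Integration.integral_add[OF i i])
  finally have "m * (LINT x|coords (insert k I). f x) = m * ?h 1 + m * ?h (-1)"
    by (simp add: distrib_left)
  also have "\<dots> \<le> 2 * (C * gauss_half\<^sup>2 * (2 * gauss_half) ^ (2 * card I))"
    using half[of 1] half[of "-1"] by simp
  also have "\<dots> = C / 2 * (2 * gauss_half) ^ (2 * card (insert k I))"
    using I by (simp add: power2_eq_square power_add)
  finally show ?thesis .
qed

text \<open>
  The mass below a level depends continuously on the level, since hyperplanes are null sets.
\<close>

lemma halving_value:
  assumes I: "finite I" "k \<in> I" and g: "box_supported I g" "\<And>x. 0 \<le> g x"
  obtains c where "(LINT y|coords I. indicator {..<c} (y k) * g y) = (LINT y|coords I. g y) / 2"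
    "(LINT y|coords I. indicator {c<..} (y k) * g y) = (LINT y|coords I. g y) / 2"
proof -
  define \<phi> where "\<phi> c = (LINT y|coords I. indicator {..<c} (y k) * g y)" for c
  have ng: "integrable (coords I) g" using box_supported_integrable[OF I(1) g(1)] .
  have n: "box_supported I (\<lambda>y. indicator {..<c} (y k) * g y)" "box_supported I (\<lambda>y. indicator {c<..} (y k) * g y)" for c
    using box_supported_indicator[OF g(1) I(1) _ I(2)] by auto
  have cont: "isCont \<phi> c" for c
    unfolding isCont_def
  proof (rule iffD2[OF tendsto_at_iff_sequentially], intro allI impI)
    fix X :: "nat \<Rightarrow> real" assume X: "\<forall>i. X i \<in> UNIV - {c}" "X \<longlonglongrightarrow> c"
    show "(\<phi> \<circ> X) \<longlonglongrightarrow> \<phi> c"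
      unfolding \<phi>_def comp_def
    proof (rule integral_dominated_convergence[where w=g])
      show "AE y in coords I. (\<lambda>i. indicator {..<X i} (y k) * g y) \<longlonglongrightarrow> indicator {..<c} (y k) * g y"
      proof (rule AE_mp[OF AE_coords_neq[OF I, of c]], rule AE_I2, rule impI)
        fix y assume "y k \<noteq> c"
        have "\<forall>\<^sub>F i in sequentially. indicator {..<X i} (y k) * g y = indicator {..<c} (y k) * g y"
        proof (cases "y k < c")
          case True
          show ?thesis
            by (rule eventually_mono[OF order_tendstoD(1)[OF X(2) True]]) (use True in \<open>simp add: indicator_def\<close>)
        next
          case False
          with \<open>y k \<noteq> c\<close> have "c < y k" by simp
          show ?thesis
            by (rule eventually_mono[OF order_tendstoD(2)[OF X(2) \<open>c < y k\<close>]]) (use False in \<open>simp add: indicator_def\<close>)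
        qed
        then show "(\<lambda>i. indicator {..<X i} (y k) * g y) \<longlonglongrightarrow> indicator {..<c} (y k) * g y"
          by (rule tendsto_eventually)
      qed
      show "AE y in coords I. norm (indicator {..<X i} (y k) * g y) \<le> g y" for i
        using g(2) by (auto simp: indicator_def)
    qed (use ng box_supported_measurable[OF n(1)] in auto)
  qed
  obtain B where B: "B > 0" "\<And>x. x \<in> space (coords I) \<Longrightarrow> \<bar>g x\<bar> \<le> B"
    "\<And>x i. x \<in> space (coords I) \<Longrightarrow> g x \<noteq> 0 \<Longrightarrow> i \<in> I \<Longrightarrow> \<bar>x i\<bar> \<le> B"
    using box_supportedE[OF g(1)] by blast
  have z: "indicator {..<-B} (y k) * g y = 0" "indicator {..<B + 1} (y k) * g y = g y" if "y \<in> space (coords I)" for y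
    using B(3)[OF that _ I(2)] by (cases "g y = 0"; auto simp: indicator_def)+
  have "\<phi> (-B) = (LINT y|coords I. 0)" unfolding \<phi>_def by (intro Bochner_Integration.integral_cong z) auto
  then have 0: "\<phi> (-B) = 0" by simp
  have 1: "\<phi> (B + 1) = (LINT y|coords I. g y)" unfolding \<phi>_def by (intro Bochner_Integration.integral_cong z) auto
  have pos: "0 \<le> (LINT y|coords I. g y)" using g(2) by (intro Bochner_Integration.integral_nonneg) auto
  have "\<exists>c\<ge>-B. c \<le> B + 1 \<and> \<phi> c = (LINT y|coords I. g y) / 2"
    using 0 1 pos B(1) cont by (intro IVT) auto
  then obtain c where c: "\<phi> c = (LINT y|coords I. g y) / 2" by blast
  have "(LINT y|coords I. g y) = (LINT y|coords I. indicator {..<c} (y k) * g y + indicator {c<..} (y k) * g y)"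
    using AE_coords_neq[OF I, of c] box_supported_measurable[OF g(1)] box_supported_measurable[OF n(1), of c] box_supported_measurable[OF n(2), of c]
    by (intro integral_cong_AE borel_measurable_add) (auto simp: indicator_def)
  also have "\<dots> = \<phi> c + (LINT y|coords I. indicator {c<..} (y k) * g y)"
    unfolding \<phi>_def by (intro Bochner_Integration.integral_add box_supported_integrable I n)
  finally show thesis using c by (intro that[of c]) (auto simp: \<phi>_def)
qed

text \<open>
  The bisecting level \<open>c\<close>, the foot \<open>z\<close> and the slope \<open>v\<close> of the line through the two half-barycentres
  of \<open>g\<close> turn the general case into the balanced one. The substitution replaces \<open>f\<close> by \<open>f\<close> times an
  exponential of a linear form, and the barycentre hypothesis on \<open>f\<close> shows that the integral has not
  become smaller.
\<close>

lemma exp_santalo_insert: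
  assumes IH: "exp_santalo I" and I: "finite I" "k \<notin> I"
  shows "exp_santalo (insert k I)"
  unfolding exp_santalo_def
proof (intro allI impI)
  let ?J = "insert k I"
  fix f g :: "('a \<Rightarrow> real) \<Rightarrow> real" and C
  assume f: "box_supported ?J f" "\<forall>x. 0 \<le> f x" and g: "box_supported ?J g" "\<forall>x. 0 \<le> g x"
    and bar: "\<forall>i\<in>?J. (LINT x|coords ?J. x i * f x) = 0"
    and le: "\<forall>x\<in>space (coords ?J). \<forall>y\<in>space (coords ?J). f x * g y \<le> C * exp (- (\<Sum>i\<in>?J. x i * y i))"
  have fJ: "finite ?J" and kJ: "k \<in> ?J" and IJ: "i \<in> I \<Longrightarrow> i \<in> ?J" and ik: "i \<in> I \<Longrightarrow> i \<noteq> k" for i using I by auto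
  define m where "m = (LINT y|coords ?J. g y) / 2"
  have C: "0 \<le> C"
  proof -
    have "(\<lambda>i\<in>?J. 0) \<in> space (coords ?J)" by (auto simp: space_PiM)
    from le[rule_format, OF this this] f(2) g(2) show ?thesis
      by (smt (verit) exp_gt_zero mult_nonneg_nonneg zero_le_mult_iff)
  qed
  show "(LINT x|coords ?J. f x) * (LINT x|coords ?J. g x) \<le> C * (2 * gauss_half) ^ (2 * card ?J)"
  proof (cases "m = 0")
    case True
    then show ?thesis using C gauss_half_nonneg by (simp add: m_def)
  next
    case False
    have m: "m > 0"
    proof -
      have "0 \<le> (LINT y|coords ?J. g y)" using g(2) by (intro Bochner_Integration.integral_nonneg) auto
      then show ?thesis using False by (simp add: m_def)
    qed
    obtain c where c: "(LINT y|coords ?J. indicator {..<c} (y k) * g y) = m"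
        "(LINT y|coords ?J. indicator {c<..} (y k) * g y) = m"
      using halving_value[OF fJ kJ g(1)] g(2) unfolding m_def by blast
    define H where "H \<epsilon> = {t. 0 < \<epsilon> * (t - c)}" for \<epsilon> :: real
    have H[measurable]: "H \<epsilon> \<in> sets borel" for \<epsilon> unfolding H_def by measurable
    have H1: "H 1 = {c<..}" "H (-1) = {..<c}" by (auto simp: H_def)
    have nH: "box_supported ?J (\<lambda>y. indicator (H \<epsilon>) (y k) * u y)" if "box_supported ?J u" for \<epsilon> u
      using box_supported_indicator[OF that fJ H kJ] .
    have ng: "box_supported ?J (\<lambda>y. y i * g y)" if "i \<in> ?J" for i using box_supported_mult_coord[OF g(1) that] .
    define mass where "mass \<epsilon> u = (LINT y|coords ?J. indicator (H \<epsilon>) (y k) * u y)" for \<epsilon> and u :: "('a \<Rightarrow> real) \<Rightarrow> real"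
    have mg: "mass \<epsilon> g = m" if "\<epsilon> = 1 \<or> \<epsilon> = -1" for \<epsilon>
      using that c by (auto simp: mass_def H1)
    define p where "p \<epsilon> = mass \<epsilon> (\<lambda>y. (y k - c) * g y)" for \<epsilon>
    define q where "q \<epsilon> i = mass \<epsilon> (\<lambda>y. y i * g y)" for \<epsilon> i
    have nkc: "box_supported ?J (\<lambda>y. (y k - c) * g y)"
    proof (rule box_supported_mult[OF g(1)])
      show "(\<lambda>y. y k - c) \<in> borel_measurable (coords ?J)" using kJ by measurable
      show "\<exists>C. \<forall>x\<in>space (coords ?J). (\<forall>i\<in>?J. \<bar>x i\<bar> \<le> R) \<longrightarrow> \<bar>x k - c\<bar> \<le> C" for R
        by (rule exI[of _ "R + \<bar>c\<bar>"]) auto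
    qed
    have ppos: "0 < \<epsilon> * p \<epsilon>" if e: "\<epsilon> = 1 \<or> \<epsilon> = -1" for \<epsilon>
    proof -
      let ?u = "\<lambda>y. \<epsilon> * (indicator (H \<epsilon>) (y k) * ((y k - c) * g y))"
      have int: "integrable (coords ?J) ?u"
        by (intro integrable_mult_right box_supported_integrable fJ nH nkc)
      have nn: "0 \<le> ?u y" for y
      proof (cases "y k \<in> H \<epsilon>")
        case True
        then have "0 < \<epsilon> * (y k - c)" by (simp add: H_def)
        then have "0 \<le> (\<epsilon> * (y k - c)) * g y" using g(2)[rule_format, of y] by (rule mult_nonneg_nonneg[OF less_imp_le])
        then show ?thesis using True by (simp add: mult.assoc)
      qed simp
      have eq: "\<epsilon> * p \<epsilon> = (LINT y|coords ?J. ?u y)" by (simp add: p_def mass_def)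
      have ne: "(LINT y|coords ?J. ?u y) \<noteq> 0"
      proof
        assume "(LINT y|coords ?J. ?u y) = 0"
        then have "AE y in coords ?J. ?u y = 0"
          using integral_nonneg_eq_0_iff_AE[OF int] nn by simp
        then have "AE y in coords ?J. indicator (H \<epsilon>) (y k) * g y = 0"
          by (rule AE_mp) (use e in \<open>auto simp: H_def indicator_def\<close>)
        then have "mass \<epsilon> g = (LINT y|coords ?J. 0)"
          unfolding mass_def using box_supported_measurable[OF nH[OF g(1)]] by (intro integral_cong_AE) auto
        then show False using mg[OF e] m by simp
      qed
      have le0: "0 \<le> (LINT y|coords ?J. ?u y)" using nn by (intro Bochner_Integration.integral_nonneg) auto
      show ?thesis unfolding eq by (rule order.not_eq_order_implies_strict[OF not_sym[OF ne] le0])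
    qed
    have pd: "0 < p 1 - p (-1)" using ppos[of 1] ppos[of "-1"] by simp
    \<comment> \<open>The pair \<open>(v, z)\<close> solves the two equations \<open>q \<epsilon> = m z + p \<epsilon> v\<close>, which say that both halves become centred.\<close>
    define v where "v i = (q 1 i - q (-1) i) / (p 1 - p (-1))" for i
    define z where "z i = (q 1 i - v i * p 1) / m" for i
    have vz: "q \<epsilon> i - m * z i - v i * p \<epsilon> = 0" if "\<epsilon> = 1 \<or> \<epsilon> = -1" for \<epsilon> i
    proof -
      have "v i * (p 1 - p (-1)) = q 1 i - q (-1) i" using pd by (simp add: v_def)
      then have "v i * p 1 - v i * p (-1) = q 1 i - q (-1) i" by (simp add: right_diff_distrib)
      moreover have "m * z i = q 1 i - v i * p 1" using m by (simp add: z_def)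
      ultimately show ?thesis using that by auto
    qed
    define T where "T = shear k I v z c"
    define U where "U = coshear k I v"
    have T: "T \<in> measurable (coords ?J) (coords ?J)" and U: "U \<in> measurable (coords ?J) (coords ?J)"
      using I by (auto simp: T_def U_def)
    have Tk: "T y k = y k + c" and Ti: "i \<in> I \<Longrightarrow> T y i = y i + (z i + y k * v i)" for y i
      using ik by (auto simp: T_def shear_def)
    have Uk: "U x k = x k - (\<Sum>j\<in>I. x j * v j)" and Ui: "i \<in> I \<Longrightarrow> U x i = x i" for x i
      using ik by (auto simp: U_def coshear_def)
    have intT: "(LINT y|coords ?J. \<psi> (T y)) = (LINT y|coords ?J. \<psi> y)" if "\<psi> \<in> borel_measurable (coords ?J)" for \<psi> :: "_ \<Rightarrow> real"
      using integral_distr[OF T, of \<psi>] that distr_shear[OF I, of v z c] by (simp add: T_def)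
    have intU: "(LINT y|coords ?J. \<psi> (U y)) = (LINT y|coords ?J. \<psi> y)" if "\<psi> \<in> borel_measurable (coords ?J)" for \<psi> :: "_ \<Rightarrow> real"
      using integral_distr[OF U, of \<psi>] that distr_coshear[OF I, of v] by (simp add: U_def)
    \<comment> \<open>Translating \<open>g\<close> by \<open>(z, c)\<close> costs the factor \<open>w\<close> on the side of \<open>f\<close>.\<close>
    define w where "w x = exp ((\<Sum>i\<in>I. x i * z i) + c * x k)" for x
    have wm: "w \<in> borel_measurable (coords ?J)" unfolding w_def using I by measurable
    have nw: "box_supported ?J (\<lambda>x. w x * f x)"
    proof (rule box_supported_mult[OF f(1) wm])
      fix R
      have "\<bar>w x\<bar> \<le> exp ((\<Sum>i\<in>I. R * \<bar>z i\<bar>) + \<bar>c\<bar> * R)" if "\<forall>i\<in>?J. \<bar>x i\<bar> \<le> R" for x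
      proof -
        have "x i * z i \<le> R * \<bar>z i\<bar>" if "i \<in> I" for i
          using \<open>\<forall>i\<in>?J. \<bar>x i\<bar> \<le> R\<close> that abs_ge_self[of "x i * z i"] mult_right_mono[of "\<bar>x i\<bar>" R "\<bar>z i\<bar>"]
          by (simp add: abs_mult)
        moreover have "c * x k \<le> \<bar>c\<bar> * R"
          using that abs_ge_self[of "c * x k"] mult_left_mono[of "\<bar>x k\<bar>" R "\<bar>c\<bar>"] by (simp add: abs_mult)
        ultimately show ?thesis unfolding w_def by (auto intro!: add_mono sum_mono)
      qed
      then show "\<exists>C. \<forall>x\<in>space (coords ?J). (\<forall>i\<in>?J. \<bar>x i\<bar> \<le> R) \<longrightarrow> \<bar>w x\<bar> \<le> C" by blast
    qed
    have nU: "box_supported ?J (\<lambda>x. w (U x) * f (U x))"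
    proof (rule box_supported_compose[OF nw U])
      fix R
      have "\<bar>x i\<bar> \<le> R + (\<Sum>j\<in>I. R * \<bar>v j\<bar>)" if R: "\<forall>i\<in>?J. \<bar>U x i\<bar> \<le> R" and i: "i \<in> ?J" for x i
      proof -
        have xi: "\<bar>x j\<bar> \<le> R" if "j \<in> I" for j using R Ui[OF that, of x] that by (metis IJ)
        have R0: "0 \<le> R" using R kJ by (meson abs_ge_zero order_trans)
        have s: "\<bar>\<Sum>j\<in>I. x j * v j\<bar> \<le> (\<Sum>j\<in>I. R * \<bar>v j\<bar>)"
          by (rule sum_abs[THEN order_trans]) (auto intro!: sum_mono mult_right_mono xi simp: abs_mult)
        show ?thesis
        proof (cases "i = k")
          case True
          then show ?thesis using s R kJ Uk[of x] by fastforce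
        next
          case False
          then show ?thesis using xi[of i] i s by auto
        qed
      qed
      then show "\<exists>R'. \<forall>x\<in>space (coords ?J). (\<forall>i\<in>?J. \<bar>U x i\<bar> \<le> R) \<longrightarrow> (\<forall>i\<in>?J. \<bar>x i\<bar> \<le> R')" by blast
    qed
    have nT: "box_supported ?J (\<lambda>x. g (T x))"
    proof (rule box_supported_compose[OF g(1) T])
      fix R
      have "\<bar>x i\<bar> \<le> (R + \<bar>c\<bar>) + (\<Sum>j\<in>I. R + \<bar>z j\<bar> + (R + \<bar>c\<bar>) * \<bar>v j\<bar>)" if R: "\<forall>i\<in>?J. \<bar>T x i\<bar> \<le> R" and i: "i \<in> ?J" for x i
      proof -
        have R0: "0 \<le> R" using R kJ by (meson abs_ge_zero order_trans)
        have xk: "\<bar>x k\<bar> \<le> R + \<bar>c\<bar>" using R kJ Tk[of x] by fastforce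
        have xj: "\<bar>x j\<bar> \<le> R + \<bar>z j\<bar> + (R + \<bar>c\<bar>) * \<bar>v j\<bar>" if j: "j \<in> I" for j
        proof -
          have "\<bar>x j + (z j + x k * v j)\<bar> \<le> R" using R Ti[OF j, of x] IJ[OF j] by fastforce
          moreover have "\<bar>x k * v j\<bar> \<le> (R + \<bar>c\<bar>) * \<bar>v j\<bar>" by (auto intro!: mult_right_mono xk simp: abs_mult)
          ultimately show ?thesis by linarith
        qed
        have nn: "0 \<le> R + \<bar>z j\<bar> + (R + \<bar>c\<bar>) * \<bar>v j\<bar>" for j using R0 by simp
        show ?thesis
        proof (cases "i = k")
          case True
          then show ?thesis using xk sum_nonneg[of I "\<lambda>j. R + \<bar>z j\<bar> + (R + \<bar>c\<bar>) * \<bar>v j\<bar>"] nn by simp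
        next
          case False
          then have "i \<in> I" using i by simp
          moreover have "0 \<le> R + \<bar>c\<bar>" using R0 by simp
          ultimately show ?thesis using xj[of i] member_le_sum[of i I "\<lambda>j. R + \<bar>z j\<bar> + (R + \<bar>c\<bar>) * \<bar>v j\<bar>"] nn I(1) by simp
        qed
      qed
      then show "\<exists>R'. \<forall>x\<in>space (coords ?J). (\<forall>i\<in>?J. \<bar>T x i\<bar> \<le> R) \<longrightarrow> (\<forall>i\<in>?J. \<bar>x i\<bar> \<le> R')" by blast
    qed
    have bal: "m * (LINT x|coords ?J. w (U x) * f (U x)) \<le> C / 2 * (2 * gauss_half) ^ (2 * card ?J)"
    proof (rule exp_santalo_balanced[OF IH I nU _ nT])
      fix x y assume x: "x \<in> space (coords ?J)" and y: "y \<in> space (coords ?J)"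
      have "w (U x) * f (U x) * g (T y) \<le> w (U x) * (C * exp (- (\<Sum>i\<in>?J. U x i * T y i)))"
        using le measurable_space[OF T y] measurable_space[OF U x] by (simp add: w_def mult.assoc)
      also have "(\<Sum>i\<in>?J. U x i * T y i) = (\<Sum>i\<in>?J. x i * y i) + ((\<Sum>i\<in>I. x i * z i) + c * U x k)"
      proof -
        have "(\<Sum>i\<in>I. U x i * T y i) = (\<Sum>i\<in>I. x i * y i) + (\<Sum>i\<in>I. x i * z i) + y k * (\<Sum>i\<in>I. x i * v i)"
          unfolding sum_distrib_left sum.distrib[symmetric]
          by (intro sum.cong) (auto simp: Ui Ti algebra_simps)
        then show ?thesis using I by (simp add: Uk Tk algebra_simps)
      qed
      also have "w (U x) * (C * exp (- ((\<Sum>i\<in>?J. x i * y i) + ((\<Sum>i\<in>I. x i * z i) + c * U x k)))) = C * exp (- (\<Sum>i\<in>?J. x i * y i))"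
      proof -
        have "(\<Sum>i\<in>I. U x i * z i) = (\<Sum>i\<in>I. x i * z i)" by (intro sum.cong) (auto simp: Ui)
        then show ?thesis unfolding w_def by (simp add: exp_add[symmetric] mult.left_commute)
      qed
      finally show "w (U x) * f (U x) * g (T y) \<le> C * exp (- (\<Sum>i\<in>?J. x i * y i))" .
    next
      fix \<epsilon> :: real and i assume e: "\<epsilon> = 1 \<or> \<epsilon> = -1" and i: "i \<in> I"
      define \<psi> where "\<psi> y = indicator (H \<epsilon>) (y k) * (y i * g y) - z i * (indicator (H \<epsilon>) (y k) * g y)
          - v i * (indicator (H \<epsilon>) (y k) * ((y k - c) * g y))" for y
      have n: "box_supported ?J (\<lambda>y. indicator (H \<epsilon>) (y k) * (y i * g y))" "box_supported ?J (\<lambda>y. indicator (H \<epsilon>) (y k) * g y)"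
          "box_supported ?J (\<lambda>y. indicator (H \<epsilon>) (y k) * ((y k - c) * g y))"
        by (intro nH ng g nkc IJ i)+
      have \<psi>m: "\<psi> \<in> borel_measurable (coords ?J)" unfolding \<psi>_def
        by (rule borel_measurable_diff[OF borel_measurable_diff[OF box_supported_measurable[OF n(1)]
            borel_measurable_times[OF borel_measurable_const box_supported_measurable[OF n(2)]]]
            borel_measurable_times[OF borel_measurable_const box_supported_measurable[OF n(3)]]])
      have "(LINT y|coords ?J. indicator {0<..} (\<epsilon> * y k) * (y i * g (T y))) = (LINT y|coords ?J. \<psi> (T y))"
        by (intro Bochner_Integration.integral_cong refl) (auto simp: \<psi>_def Tk Ti[OF i] H_def indicator_def algebra_simps)
      also have "\<dots> = (LINT y|coords ?J. \<psi> y)" by (rule intT[OF \<psi>m])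
      also have "\<dots> = q \<epsilon> i - z i * m - v i * p \<epsilon>"
        unfolding \<psi>_def q_def p_def mg[OF e, symmetric] mass_def
        using n[THEN box_supported_integrable[OF fJ]] by simp
      also have "\<dots> = 0" using vz[OF e, of i] by (simp add: mult.commute)
      finally show "(LINT y|coords ?J. indicator {0<..} (\<epsilon> * y k) * (y i * g (T y))) = 0" .
    next
      fix \<epsilon> :: real assume e: "\<epsilon> = 1 \<or> \<epsilon> = -1"
      have "(LINT y|coords ?J. indicator {0<..} (\<epsilon> * y k) * g (T y)) = (LINT y|coords ?J. (\<lambda>y. indicator (H \<epsilon>) (y k) * g y) (T y))"
        by (intro Bochner_Integration.integral_cong refl) (auto simp: Tk H_def indicator_def)
      also have "\<dots> = m" using intT[OF box_supported_measurable[OF nH[OF g(1)]]] mg[OF e] by (simp add: mass_def)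
      finally show "(LINT y|coords ?J. indicator {0<..} (\<epsilon> * y k) * g (T y)) = m" .
    qed (use f g in \<open>auto simp: w_def\<close>)
    have intf: "integrable (coords ?J) (\<lambda>x. x i * f x)" if "i \<in> ?J" for i
      by (intro box_supported_integrable fJ box_supported_mult_coord f that)
    have "(LINT x|coords ?J. f x) = (LINT x|coords ?J. f x + ((\<Sum>i\<in>I. z i * (x i * f x)) + c * (x k * f x)))"
      using intf bar I box_supported_integrable[OF fJ f(1)] by (simp add: Bochner_Integration.integral_add Bochner_Integration.integral_sum)
    also have "\<dots> \<le> (LINT x|coords ?J. w x * f x)"
    proof (rule integral_mono)
      fix x assume "x \<in> space (coords ?J)"
      have "(1 + ((\<Sum>i\<in>I. x i * z i) + c * x k)) * f x \<le> w x * f x"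
        unfolding w_def using f(2) by (intro mult_right_mono exp_ge_add_one_self) auto
      then show "f x + ((\<Sum>i\<in>I. z i * (x i * f x)) + c * (x k * f x)) \<le> w x * f x"
        by (simp add: algebra_simps sum_distrib_left sum_distrib_right)
    qed (use intf I box_supported_integrable[OF fJ f(1)] box_supported_integrable[OF fJ nw] in auto)
    also have "\<dots> = (LINT x|coords ?J. w (U x) * f (U x))"
      using intU[OF box_supported_measurable[OF nw]] by simp
    finally have "(LINT x|coords ?J. f x) * m \<le> m * (LINT x|coords ?J. w (U x) * f (U x))"
      using m by simp
    with bal have "(LINT x|coords ?J. f x) * m \<le> C / 2 * (2 * gauss_half) ^ (2 * card ?J)" by linarith
    then show ?thesis by (simp add: m_def)
  qed
qed

lemma exp_santalo_finite: "finite I \<Longrightarrow> exp_santalo I"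
  by (induction I rule: finite_induct) (auto intro: exp_santalo_empty exp_santalo_insert)

lemma gauss_half_pos: "0 < gauss_half"
proof -
  have "(LINT s|lborel. exp (- (s\<^sup>2 / 2))) \<noteq> (0::real)"
  proof
    assume "(LINT s|lborel. exp (- (s\<^sup>2 / 2))) = (0::real)"
    then have "AE s::real in lborel. exp (- (s\<^sup>2 / 2)) = 0"
      using integral_nonneg_eq_0_iff_AE[OF integrable_gauss] by simp
    then have "AE s::real in lborel. False" by simp
    then have "emeasure lborel (UNIV :: real set) = 0"
      by (simp add: AE_iff_null null_sets_def)
    then show False by simp
  qed
  moreover have "0 \<le> (LINT s|lborel. exp (- (s\<^sup>2 / 2)) :: real)" by (rule Bochner_Integration.integral_nonneg) simp
  ultimately have "0 < (LINT s|lborel. exp (- (s\<^sup>2 / 2)) :: real)" by (metis less_le)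
  then show ?thesis unfolding gauss_half_def by simp
qed

text \<open>
  The Euclidean form, by identification of a Euclidean space with its coordinates in the standard basis.
\<close>

lemma exp_santalo_euclidean:
  fixes f g :: "'a::euclidean_space \<Rightarrow> real"
  assumes [measurable]: "f \<in> borel_measurable borel" "g \<in> borel_measurable borel"
    and nn: "\<And>x. 0 \<le> f x" "\<And>x. 0 \<le> g x"
    and bf: "\<And>x. f x \<le> B" "\<And>x. f x \<noteq> 0 \<Longrightarrow> norm x \<le> B"
    and bg: "\<And>x. g x \<le> B" "\<And>x. g x \<noteq> 0 \<Longrightarrow> norm x \<le> B"
    and bar: "\<And>b. b \<in> Basis \<Longrightarrow> (LINT x|lborel. (x \<bullet> b) * f x) = 0"
    and le: "\<And>x y. f x * g y \<le> exp (- (x \<bullet> y))"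
  shows "(LINT x|lborel. f x) * (LINT x|lborel. g x) \<le> (2 * gauss_half) ^ (2 * DIM('a))"
proof -
  define E where "E x = (\<Sum>b\<in>Basis. x b *\<^sub>R b)" for x :: "'a \<Rightarrow> real"
  have E[measurable]: "E \<in> borel_measurable (coords Basis)"
    unfolding E_def by measurable
  have lb: "lborel = distr (coords Basis) borel E"
    unfolding E_def by (rule lborel_eq)
  have Eb: "E x \<bullet> b = x b" if "b \<in> Basis" for x b using that by (simp add: E_def)
  have int: "(LINT x|lborel. h x) = (LINT x|coords Basis. h (E x))" if "h \<in> borel_measurable borel" for h :: "'a \<Rightarrow> real"
    using that by (subst lb) (simp add: integral_distr)
  have box_supported: "box_supported Basis (\<lambda>x. h (E x))"
    if [measurable]: "h \<in> borel_measurable borel" and h: "\<And>x. 0 \<le> h x" "\<And>x. h x \<le> B" "\<And>x. h x \<noteq> 0 \<Longrightarrow> norm x \<le> B" for h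
    unfolding box_supported_def
  proof (intro conjI exI[of _ B] ballI impI)
    show "(\<lambda>x. h (E x)) \<in> borel_measurable (coords Basis)" by measurable
    show "\<bar>h (E x)\<bar> \<le> B" for x using h(1,2)[of "E x"] by simp
    show "\<bar>x i\<bar> \<le> B" if "h (E x) \<noteq> 0" "i \<in> Basis" for x i
      using h(3)[OF that(1)] Basis_le_norm[OF that(2), of "E x"] Eb[OF that(2), of x] by simp
  qed
  have ES: "exp_santalo (Basis :: 'a set)" by (rule exp_santalo_finite) simp
  have "(LINT x|coords Basis. f (E x)) * (LINT x|coords Basis. g (E x)) \<le> 1 * (2 * gauss_half) ^ (2 * card (Basis :: 'a set))"
  proof (rule ES[unfolded exp_santalo_def, rule_format])
    show "box_supported Basis (\<lambda>x. f (E x))" by (rule box_supported[OF assms(1) nn(1) bf])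
    show "box_supported Basis (\<lambda>x. g (E x))" by (rule box_supported[OF assms(2) nn(2) bg])
    show "(LINT x|coords Basis. x i * f (E x)) = 0" if "i \<in> Basis" for i
    proof -
      have "(LINT x|lborel. (x \<bullet> i) * f x) = (LINT x|coords Basis. (E x \<bullet> i) * f (E x))"
        by (rule int) measurable
      then show ?thesis using bar[OF that] by (simp add: Eb[OF that])
    qed
    show "f (E x) * g (E y) \<le> 1 * exp (- (\<Sum>i\<in>Basis. x i * y i))" for x y
    proof -
      have "E x \<bullet> E y = (\<Sum>i\<in>Basis. x i * y i)"
        unfolding euclidean_inner[of "E x" "E y"] by (intro sum.cong) (auto simp: Eb)
      then show ?thesis using le[of "E x" "E y"] by simp
    qed
  qed (use nn in auto)
  then show ?thesis by (simp add: int)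
qed

section \<open>The Blaschke-Santalo inequality for a centred polar\<close>

lemma nn_integral_scale:
  fixes u :: "'a::euclidean_space \<Rightarrow> ennreal"
  assumes [measurable]: "u \<in> borel_measurable borel" and r: "0 < r"
  shows "(\<integral>\<^sup>+y. u y \<partial>lborel) = ennreal (r ^ DIM('a)) * (\<integral>\<^sup>+y. u (r *\<^sub>R y) \<partial>lborel)"
  using r by (subst lborel_affine[of r 0]) (simp_all add: nn_integral_density nn_integral_distr nn_integral_cmult)

text \<open>
  Fubini and scaling: a superposition of the dilates \<open>r P\<close> integrates a homogeneous function like \<open>P\<close>
  itself, up to a factor that does not depend on \<open>P\<close>.
\<close>

lemma radial_nn_integral:
  fixes P :: "'a::euclidean_space set" and u :: "'a \<Rightarrow> ennreal" and w :: "real \<Rightarrow> ennreal"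
  assumes [measurable]: "P \<in> sets borel" "u \<in> borel_measurable borel" "w \<in> borel_measurable borel"
    and u: "\<And>r y. 0 < r \<Longrightarrow> u (r *\<^sub>R y) = ennreal (r ^ d) * u y"
  shows "(\<integral>\<^sup>+y. u y * (\<integral>\<^sup>+r. w r * indicator {0<..} r * indicator P (inverse r *\<^sub>R y) \<partial>lborel) \<partial>lborel)
    = (\<integral>\<^sup>+y. u y * indicator P y \<partial>lborel) * (\<integral>\<^sup>+r. ennreal (r ^ (DIM('a) + d)) * w r * indicator {0<..} r \<partial>lborel)"
proof -
  have [measurable]: "(\<lambda>p. indicator P (inverse (snd p) *\<^sub>R fst p) :: ennreal) \<in> borel_measurable (borel \<Otimes>\<^sub>M borel)"
    by (rule measurable_compose[of _ _ borel]) measurable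
  have [measurable]: "(\<lambda>y. indicator P (inverse r *\<^sub>R y) :: ennreal) \<in> borel_measurable borel" for r :: real
    by (rule measurable_compose[of _ _ borel]) measurable
  have [measurable]: "(\<lambda>r. indicator P (inverse r *\<^sub>R y) :: ennreal) \<in> borel_measurable borel" for y
    by (rule measurable_compose[of _ _ borel]) measurable
  have "(\<integral>\<^sup>+y. u y * (\<integral>\<^sup>+r. w r * indicator {0<..} r * indicator P (inverse r *\<^sub>R y) \<partial>lborel) \<partial>lborel)
    = (\<integral>\<^sup>+y. (\<integral>\<^sup>+r. u y * (w r * indicator {0<..} r * indicator P (inverse r *\<^sub>R y)) \<partial>lborel) \<partial>lborel)"
    by (intro nn_integral_cong nn_integral_cmult[symmetric]) simp
  also have "\<dots> = (\<integral>\<^sup>+r. (\<integral>\<^sup>+y. u y * (w r * indicator {0<..} r * indicator P (inverse r *\<^sub>R y)) \<partial>lborel) \<partial>lborel)"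
    by (rule lborel_pair.Fubini') (simp add: split_beta')
  also have "\<dots> = (\<integral>\<^sup>+r. (\<integral>\<^sup>+y. u y * indicator P y \<partial>lborel) * (ennreal (r ^ (DIM('a) + d)) * w r * indicator {0<..} r) \<partial>lborel)"
  proof (rule nn_integral_cong)
    fix r :: real
    show "(\<integral>\<^sup>+y. u y * (w r * indicator {0<..} r * indicator P (inverse r *\<^sub>R y)) \<partial>lborel)
      = (\<integral>\<^sup>+y. u y * indicator P y \<partial>lborel) * (ennreal (r ^ (DIM('a) + d)) * w r * indicator {0<..} r)"
    proof (cases "0 < r")
      case True
      have "(\<integral>\<^sup>+y. u y * (w r * indicator {0<..} r * indicator P (inverse r *\<^sub>R y)) \<partial>lborel)
        = ennreal (r ^ DIM('a)) * (\<integral>\<^sup>+y. u (r *\<^sub>R y) * (w r * indicator {0<..} r * indicator P (inverse r *\<^sub>R (r *\<^sub>R y))) \<partial>lborel)"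
        by (rule nn_integral_scale[OF _ True]) simp
      also have "\<dots> = ennreal (r ^ DIM('a)) * (\<integral>\<^sup>+y. (ennreal (r ^ d) * w r) * (u y * indicator P y) \<partial>lborel)"
        using True by (simp add: u ac_simps)
      also have "\<dots> = ennreal (r ^ DIM('a)) * ((ennreal (r ^ d) * w r) * (\<integral>\<^sup>+y. u y * indicator P y \<partial>lborel))"
        by (subst nn_integral_cmult) auto
      also have "\<dots> = (\<integral>\<^sup>+y. u y * indicator P y \<partial>lborel) * (ennreal (r ^ (DIM('a) + d)) * w r * indicator {0<..} r)"
        using True by (simp add: power_add ennreal_mult ac_simps)
      finally show ?thesis .
    qed simp
  qed
  also have "\<dots> = (\<integral>\<^sup>+y. u y * indicator P y \<partial>lborel) * (\<integral>\<^sup>+r. ennreal (r ^ (DIM('a) + d)) * w r * indicator {0<..} r \<partial>lborel)"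
    by (rule nn_integral_cmult) simp
  finally show ?thesis .
qed

lemma gauss_tail:
  assumes "0 \<le> a"
  shows "(\<integral>\<^sup>+r. ennreal (r * exp (- (r\<^sup>2 / 2))) * indicator {a..} r \<partial>lborel) = ennreal (exp (- (a\<^sup>2 / 2)))"
proof -
  have "((\<lambda>r::real. - exp (- (r\<^sup>2 / 2))) \<longlongrightarrow> 0) at_top"
    by real_asymp
  then have "(\<integral>\<^sup>+r. ennreal (r * exp (- (r\<^sup>2 / 2))) * indicator {a..} r \<partial>lborel) = ennreal (0 - - exp (- (a\<^sup>2 / 2)))"
    using assms by (intro nn_integral_FTC_atLeast) (auto intro!: derivative_eq_intros simp: power2_eq_square)
  then show ?thesis by simp
qed

text \<open>
  For star-shaped \<open>P\<close> with gauge \<open>p\<close> and \<open>S = UNIV\<close> this is \<open>exp (- (p y)\<^sup>2 / 2)\<close>. The superposition of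
  dilates makes sense without gauges, and a bounded \<open>S\<close> gives it bounded support.
\<close>

definition layered :: "real set \<Rightarrow> 'a::euclidean_space set \<Rightarrow> 'a \<Rightarrow> ennreal" where
  "layered S P y = (\<integral>\<^sup>+r. (ennreal (r * exp (- (r\<^sup>2 / 2))) * indicator S r) * indicator {0<..} r * indicator P (inverse r *\<^sub>R y) \<partial>lborel)"

definition layered_const :: "real set \<Rightarrow> nat \<Rightarrow> ennreal" where
  "layered_const S n = (\<integral>\<^sup>+r. ennreal (r ^ n) * (ennreal (r * exp (- (r\<^sup>2 / 2))) * indicator S r) * indicator {0<..} r \<partial>lborel)"

lemma layered_measurable [measurable]:
  fixes P :: "'a::euclidean_space set"
  assumes [measurable]: "P \<in> sets borel" "S \<in> sets borel"
  shows "layered S P \<in> borel_measurable borel"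
proof -
  have [measurable]: "(\<lambda>p. indicator P (inverse (snd p) *\<^sub>R fst p) :: ennreal) \<in> borel_measurable (borel \<Otimes>\<^sub>M borel)"
    by (rule measurable_compose[of _ _ borel]) measurable
  show ?thesis unfolding layered_def
    by (rule lborel.borel_measurable_nn_integral) (simp add: split_beta')
qed

lemma nn_integral_layered:
  fixes P :: "'a::euclidean_space set"
  assumes [measurable]: "P \<in> sets borel" "S \<in> sets borel" "u \<in> borel_measurable borel"
    and u: "\<And>r y. 0 < r \<Longrightarrow> u (r *\<^sub>R y) = ennreal (r ^ d) * u y"
  shows "(\<integral>\<^sup>+y. u y * layered S P y \<partial>lborel) = (\<integral>\<^sup>+y. u y * indicator P y \<partial>lborel) * layered_const S (DIM('a) + d)"
  unfolding layered_def layered_const_def by (rule radial_nn_integral) (use u in auto)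

lemma layered_le:
  assumes "0 \<le> a" "\<And>r. 0 < r \<Longrightarrow> inverse r *\<^sub>R y \<in> P \<Longrightarrow> a \<le> r"
  shows "layered S P y \<le> ennreal (exp (- (a\<^sup>2 / 2)))"
proof -
  have "layered S P y \<le> (\<integral>\<^sup>+r. ennreal (r * exp (- (r\<^sup>2 / 2))) * indicator {a..} r \<partial>lborel)"
    unfolding layered_def using assms by (intro nn_integral_mono) (auto simp: indicator_def)
  then show ?thesis by (simp add: gauss_tail assms)
qed

lemma layered_eq_0:
  assumes "\<And>r. r \<in> S \<Longrightarrow> 0 < r \<Longrightarrow> inverse r *\<^sub>R y \<notin> P"
  shows "layered S P y = 0"
proof -
  have "layered S P y = (\<integral>\<^sup>+r. 0 \<partial>(lborel :: real measure))"
    unfolding layered_def using assms by (intro nn_integral_cong) (auto simp: indicator_def)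
  then show ?thesis by simp
qed

text \<open>
  If \<open>a\<close> and \<open>b\<close> are the least scales at which \<open>y\<close> enters a dilate of \<open>P\<close> and \<open>x\<close> one of \<open>K\<close>, then
  \<open>x \<bullet> y \<le> a * b \<le> (a\<^sup>2 + b\<^sup>2) / 2\<close>.
\<close>

lemma layered_mult_le:
  fixes P K :: "'a::euclidean_space set"
  assumes PK: "\<And>x y. x \<in> K \<Longrightarrow> y \<in> P \<Longrightarrow> x \<bullet> y \<le> 1"
  shows "layered S P y * layered S K x \<le> ennreal (exp (- (y \<bullet> x)))"
proof -
  define A where "A = {r. 0 < r \<and> inverse r *\<^sub>R y \<in> P}"
  define D where "D = {s. 0 < s \<and> inverse s *\<^sub>R x \<in> K}"
  have xy: "x \<bullet> y \<le> r * s" if "r \<in> A" "s \<in> D" for r s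
  proof -
    have "inverse s *\<^sub>R x \<in> K" "inverse r *\<^sub>R y \<in> P" using that by (auto simp: A_def D_def)
    then have "(inverse s *\<^sub>R x) \<bullet> (inverse r *\<^sub>R y) \<le> 1" by (rule PK)
    then have "(x \<bullet> y) / (r * s) \<le> 1" by (simp add: divide_inverse ac_simps)
    then show ?thesis using that by (auto simp: A_def D_def pos_divide_le_eq)
  qed
  show ?thesis
  proof (cases "A = {} \<or> D = {}")
    case True
    then have "layered S P y = 0 \<or> layered S K x = 0"
      unfolding A_def D_def by (auto intro!: layered_eq_0)
    then show ?thesis by auto
  next
    case False
    define a where "a = Inf A"
    define b where "b = Inf D"
    have bd: "bdd_below A" "bdd_below D" unfolding A_def D_def by (auto intro!: bdd_belowI[of _ 0])
    have a: "0 \<le> a" and b: "0 \<le> b"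
      unfolding a_def b_def using False by (auto intro!: cInf_greatest simp: A_def D_def)
    have ar: "a \<le> r" if "r \<in> A" for r unfolding a_def using bd that by (intro cInf_lower)
    have bs: "b \<le> s" if "s \<in> D" for s unfolding b_def using bd that by (intro cInf_lower)
    have as: "x \<bullet> y \<le> a * s" if s: "s \<in> D" for s
    proof -
      have s0: "0 < s" using s by (simp add: D_def)
      have "x \<bullet> y / s \<le> a" unfolding a_def
        using False xy[OF _ s] s0 by (intro cInf_greatest) (auto simp: pos_divide_le_eq)
      then show ?thesis using s0 by (simp add: pos_divide_le_eq)
    qed
    have ab: "x \<bullet> y \<le> a * b"
    proof (cases "a = 0")
      case True
      then show ?thesis using as False by auto
    next
      case False': False
      then have a0: "0 < a" using a by simp
      have "x \<bullet> y / a \<le> b" unfolding b_def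
        using False as a0 by (intro cInf_greatest) (auto simp: pos_divide_le_eq mult.commute)
      then show ?thesis using a0 by (simp add: pos_divide_le_eq mult.commute)
    qed
    have "layered S P y * layered S K x \<le> ennreal (exp (- (a\<^sup>2 / 2))) * ennreal (exp (- (b\<^sup>2 / 2)))"
      using a b ar bs by (intro mult_mono layered_le) (auto simp: A_def D_def)
    also have "\<dots> = ennreal (exp (- ((a\<^sup>2 + b\<^sup>2) / 2)))"
      by (simp add: ennreal_mult[symmetric] exp_add[symmetric] add_divide_distrib)
    also have "\<dots> \<le> ennreal (exp (- (y \<bullet> x)))"
      using ab sum_squares_bound[of a b] by (intro ennreal_leI) (simp add: inner_commute)
    finally show ?thesis .
  qed
qed

lemma layered_ball:
  fixes y :: "'a::euclidean_space"
  shows "layered UNIV (cball 0 1) y = ennreal (exp (- ((norm y)\<^sup>2 / 2)))"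
proof -
  have "layered UNIV (cball 0 1) y = (\<integral>\<^sup>+r. ennreal (r * exp (- (r\<^sup>2 / 2))) * indicator {norm y..} r \<partial>lborel)"
    unfolding layered_def
  proof (intro nn_integral_cong)
    fix r :: real
    have "r > 0 \<Longrightarrow> norm (inverse r *\<^sub>R y) \<le> 1 \<longleftrightarrow> norm y \<le> r" by (simp add: field_simps)
    moreover have "\<not> r > 0 \<Longrightarrow> norm y \<le> r \<Longrightarrow> r = 0" using norm_ge_zero[of y] by linarith
    ultimately show "(ennreal (r * exp (- (r\<^sup>2 / 2))) * indicator UNIV r) * indicator {0<..} r * indicator (cball 0 1) (inverse r *\<^sub>R y)
       = ennreal (r * exp (- (r\<^sup>2 / 2))) * indicator {norm y..} r"
      by (cases "r > 0") (auto simp: indicator_def)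
  qed
  then show ?thesis by (simp add: gauss_tail)
qed

lemma nn_integral_gauss_euclidean:
  "(\<integral>\<^sup>+y. ennreal (exp (- ((norm y)\<^sup>2 / 2))) \<partial>(lborel :: 'a::euclidean_space measure)) = ennreal ((2 * gauss_half) ^ DIM('a))"
proof -
  have "(\<integral>\<^sup>+y. ennreal (exp (- ((norm y)\<^sup>2 / 2))) \<partial>(lborel :: 'a measure))
      = (\<integral>\<^sup>+y. (\<Prod>b\<in>Basis. ennreal (exp (- ((y \<bullet> b)\<^sup>2 / 2)))) \<partial>(lborel :: 'a measure))"
  proof (intro nn_integral_cong)
    fix y :: 'a
    have "(norm y)\<^sup>2 = (\<Sum>b\<in>Basis. (y \<bullet> b)\<^sup>2)"
      unfolding power2_norm_eq_inner euclidean_inner[of y y] by (simp only: power2_eq_square)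
    then show "ennreal (exp (- ((norm y)\<^sup>2 / 2))) = (\<Prod>b\<in>Basis. ennreal (exp (- ((y \<bullet> b)\<^sup>2 / 2))))"
      by (simp add: prod_ennreal exp_sum[symmetric] sum_negf sum_divide_distrib)
  qed
  also have "\<dots> = (\<Prod>b\<in>(Basis::'a set). (\<integral>\<^sup>+s. ennreal (exp (- (s\<^sup>2 / 2))) \<partial>lborel))"
    by (rule nn_integral_lborel_prod) auto
  also have "\<dots> = ennreal ((2 * gauss_half) ^ DIM('a))"
    using gauss_half_nonneg by (simp add: nn_integral_gauss ennreal_power)
  finally show ?thesis .
qed

text \<open>
  The profile of the unit ball is the Gaussian; this identifies the constant in terms of the volume
  of the ball.
\<close>

lemma layered_const_ball:
  "emeasure lborel (ball (0::'a::euclidean_space) 1) * layered_const UNIV (DIM('a)) = ennreal ((2 * gauss_half) ^ DIM('a))"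
proof -
  have "ennreal ((2 * gauss_half) ^ DIM('a)) = (\<integral>\<^sup>+y. 1 * layered UNIV (cball 0 1) y \<partial>(lborel :: 'a measure))"
    by (simp add: layered_ball nn_integral_gauss_euclidean)
  also have "\<dots> = (\<integral>\<^sup>+y. 1 * indicator (cball 0 1) y \<partial>(lborel :: 'a measure)) * layered_const UNIV (DIM('a) + 0)"
    by (rule nn_integral_layered) auto
  also have "\<dots> = emeasure lborel (ball (0::'a) 1) * layered_const UNIV (DIM('a))"
    by (simp add: emeasure_ball emeasure_cball)
  finally show ?thesis ..
qed

lemma layered_const_LIMSEQ: "(\<lambda>n. layered_const {..real n} d) \<longlonglongrightarrow> layered_const UNIV d"
  unfolding layered_const_def
proof (rule nn_integral_LIMSEQ)
  show "incseq (\<lambda>n r. ennreal (r ^ d) * (ennreal (r * exp (- (r\<^sup>2 / 2))) * indicator {..real n} r) * indicator {0<..} r)"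
    by (auto simp: incseq_def le_fun_def intro!: mult_right_mono mult_left_mono indicator_leI)
  fix r :: real
  have "indicator {..real n} r = (1::ennreal)" if "n \<ge> nat \<lceil>r\<rceil>" for n
  proof -
    have "r \<le> real n" using that by linarith
    then show ?thesis by (simp add: indicator_def)
  qed
  then show "(\<lambda>n. ennreal (r ^ d) * (ennreal (r * exp (- (r\<^sup>2 / 2))) * indicator {..real n} r) * indicator {0<..} r)
     \<longlonglongrightarrow> ennreal (r ^ d) * (ennreal (r * exp (- (r\<^sup>2 / 2))) * indicator UNIV r) * indicator {0<..} r"
    by (intro tendsto_eventually) (auto simp: eventually_sequentially intro!: exI[of _ "nat \<lceil>r\<rceil>"])
qed auto

text \<open>
  The Blaschke-Santalo inequality when the centroid of \<open>P\<close> is at the origin. The functional inequality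
  is applied to the profiles of \<open>P\<close> and \<open>K\<close>, cut off at scale \<open>n\<close>. Both integrals are volumes times the
  same constant \<open>c n\<close>, and as \<open>n\<close> grows this constant tends to the one for the ball.
\<close>

theorem blaschke_santalo_centred:
  fixes P K :: "'a::euclidean_space set"
  assumes [measurable]: "P \<in> sets borel" "K \<in> sets borel" and bd: "bounded P" "bounded K"
    and PK: "\<And>x y. x \<in> K \<Longrightarrow> y \<in> P \<Longrightarrow> x \<bullet> y \<le> 1"
    and bar: "\<And>b. b \<in> Basis \<Longrightarrow> (\<integral>\<^sup>+y. ennreal (y \<bullet> b) * indicator P y \<partial>lborel) = (\<integral>\<^sup>+y. ennreal (- (y \<bullet> b)) * indicator P y \<partial>lborel)"
  shows "emeasure lborel K * emeasure lborel P \<le> (emeasure lborel (ball (0::'a) 1))\<^sup>2"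
proof -
  obtain R where R: "R > 0" "\<And>y. y \<in> P \<Longrightarrow> norm y \<le> R" "\<And>y. y \<in> K \<Longrightarrow> norm y \<le> R"
  proof -
    obtain R1 R2 where "\<forall>y\<in>P. norm y \<le> R1" "\<forall>y\<in>K. norm y \<le> R2" using bd by (auto simp: bounded_iff)
    then show thesis by (intro that[of "max 1 (max R1 R2)"]) (auto simp: le_max_iff_disj)
  qed
  define V where "V = emeasure lborel (ball (0::'a) 1)"
  define c where "c n = layered_const {..real n} (DIM('a))" for n
  define ci where "ci = layered_const UNIV (DIM('a))"
  have Vci: "V * ci = ennreal ((2 * gauss_half) ^ DIM('a))"
    unfolding V_def ci_def by (rule layered_const_ball)
  have main: "(emeasure lborel P * c n) * (emeasure lborel K * c n) \<le> (V * ci)\<^sup>2" for n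
  proof -
    let ?S = "{..real n}"
    have le1: "layered ?S Q y \<le> 1" for Q and y :: 'a
      using layered_le[of 0 y Q ?S] by simp
    have en: "ennreal (enn2real (layered ?S Q y)) = layered ?S Q y" for Q and y :: 'a
      using le1[of Q y] by (intro ennreal_enn2real) (auto intro: order.strict_trans1)
    have supp: "norm y \<le> real n * R" if Q: "\<And>y. y \<in> Q \<Longrightarrow> norm y \<le> R" and ne: "enn2real (layered ?S Q y) \<noteq> 0" for Q and y :: 'a
    proof (rule ccontr)
      assume y: "\<not> norm y \<le> real n * R"
      have "layered ?S Q y = 0"
      proof (rule layered_eq_0)
        fix r assume r: "r \<in> ?S" "0 < r"
        show "inverse r *\<^sub>R y \<notin> Q"
        proof
          assume "inverse r *\<^sub>R y \<in> Q"
          then have "norm y \<le> r * R" using Q[of "inverse r *\<^sub>R y"] r by (simp add: field_simps)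
          also have "\<dots> \<le> real n * R" using r R(1) by (intro mult_right_mono) auto
          finally show False using y by simp
        qed
      qed
      then show False using ne by simp
    qed
    define f where "f y = enn2real (layered ?S P y)" for y
    define g where "g y = enn2real (layered ?S K y)" for y
    have [measurable]: "f \<in> borel_measurable borel" "g \<in> borel_measurable borel"
      unfolding f_def g_def by measurable
    have f: "0 \<le> f y" "ennreal (f y) = layered ?S P y" "f y \<le> 1" and g: "0 \<le> g y" "ennreal (g y) = layered ?S K y" "g y \<le> 1" for y
      using en le1[of P y] le1[of K y] by (auto simp: f_def g_def intro: enn2real_leI)
    have nf: "(\<integral>\<^sup>+y. ennreal (f y) \<partial>lborel) = emeasure lborel P * c n"
      and ng: "(\<integral>\<^sup>+y. ennreal (g y) \<partial>lborel) = emeasure lborel K * c n"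
      using nn_integral_layered[of P ?S "\<lambda>_. 1" 0] nn_integral_layered[of K ?S "\<lambda>_. 1" 0]
      by (auto simp: f g c_def)
    define B where "B = max 1 (real n * R)"
    have "(LINT y|lborel. f y) * (LINT y|lborel. g y) \<le> (2 * gauss_half) ^ (2 * DIM('a))"
    proof (rule exp_santalo_euclidean[where B=B])
      show "f y \<le> B" "g y \<le> B" for y using f(3)[of y] g(3)[of y] by (auto simp: B_def le_max_iff_disj)
      show "norm y \<le> B" if "f y \<noteq> 0" for y using supp[of P y, OF R(2)] that by (auto simp: B_def f_def le_max_iff_disj)
      show "norm y \<le> B" if "g y \<noteq> 0" for y using supp[of K y, OF R(3)] that by (auto simp: B_def g_def le_max_iff_disj)
      show "f x * g y \<le> exp (- (x \<bullet> y))" for x y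
        using layered_mult_le[where K=K and P=P and S="?S" and y=x and x=y, OF PK] f(1)[of x] g(1)[of y]
        by (simp add: f(2)[symmetric] g(2)[symmetric] ennreal_mult[symmetric])
    next
      fix b :: 'a assume b: "b \<in> Basis"
      have sgn: "(\<integral>\<^sup>+y. ennreal (s * (y \<bullet> b) * f y) \<partial>lborel) = (\<integral>\<^sup>+y. ennreal (s * (y \<bullet> b)) * indicator P y \<partial>lborel) * layered_const ?S (DIM('a) + 1)" for s
      proof -
        have "(\<integral>\<^sup>+y. ennreal (s * (y \<bullet> b) * f y) \<partial>lborel) = (\<integral>\<^sup>+y. ennreal (s * (y \<bullet> b)) * layered ?S P y \<partial>lborel)"
          by (intro nn_integral_cong) (simp add: f(1) f(2)[symmetric] ennreal_mult'')
        also have "\<dots> = (\<integral>\<^sup>+y. ennreal (s * (y \<bullet> b)) * indicator P y \<partial>lborel) * layered_const ?S (DIM('a) + 1)"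
          by (rule nn_integral_layered) (auto simp: ennreal_mult'[symmetric] ac_simps)
        finally show ?thesis .
      qed
      have "(\<integral>\<^sup>+y. ennreal ((y \<bullet> b) * f y) \<partial>lborel) = (\<integral>\<^sup>+y. ennreal (- ((y \<bullet> b) * f y)) \<partial>lborel)"
        using sgn[of 1] sgn[of "-1"] bar[OF b] by simp
      then show "(LINT y|lborel. (y \<bullet> b) * f y) = 0"
        by (cases "integrable lborel (\<lambda>y. (y \<bullet> b) * f y)") (auto simp: real_lebesgue_integral_def not_integrable_integral_eq)
    qed (use f g in auto)
    moreover have "(LINT y|lborel. f y) = enn2real (emeasure lborel P * c n)" "(LINT y|lborel. g y) = enn2real (emeasure lborel K * c n)"
      using nf ng f g by (auto simp: integral_eq_nn_integral)
    moreover have fin: "emeasure lborel P * c n < \<top>" "emeasure lborel K * c n < \<top>"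
    proof -
      have cl: "emeasure lborel (cball (0::'a) (real n * R)) < \<top>"
        using emeasure_bounded_finite[OF bounded_cball] by (simp add: less_top)
      have "(\<integral>\<^sup>+y. ennreal (h y) \<partial>lborel) \<le> (\<integral>\<^sup>+y. indicator (cball (0::'a) (real n * R)) y \<partial>lborel)"
        if "\<And>y. h y \<le> 1" "\<And>y. h y \<noteq> 0 \<Longrightarrow> norm y \<le> real n * R" for h :: "'a \<Rightarrow> real"
      proof (intro nn_integral_mono)
        fix y show "ennreal (h y) \<le> indicator (cball 0 (real n * R)) y"
          using that[of y] by (cases "h y = 0") (auto simp: ennreal_le_1)
      qed
      from this[of f] this[of g] show "emeasure lborel P * c n < \<top>" "emeasure lborel K * c n < \<top>"
        using f(3) g(3) supp[of P, OF R(2)] supp[of K, OF R(3)] cl unfolding nf ng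
        by (auto simp: f_def g_def intro: order.strict_trans1)
    qed
    moreover have "(2 * gauss_half) ^ (2 * DIM('a)) = ((2 * gauss_half) ^ DIM('a))\<^sup>2"
      by (metis mult.commute power_mult)
    ultimately have "enn2real (emeasure lborel P * c n) * enn2real (emeasure lborel K * c n) \<le> ((2 * gauss_half) ^ DIM('a))\<^sup>2"
      by metis
    then have "ennreal (enn2real (emeasure lborel P * c n) * enn2real (emeasure lborel K * c n)) \<le> ennreal (((2 * gauss_half) ^ DIM('a))\<^sup>2)"
      by (rule ennreal_leI)
    then show ?thesis using fin gauss_half_nonneg unfolding Vci
      by (simp add: ennreal_mult ennreal_power[symmetric] less_top)
  qed
  have Vfin: "V < \<top>" "V \<noteq> 0" unfolding V_def
  proof -
    have pos: "0 < unit_ball_vol (real DIM('a))" by (rule unit_ball_vol_pos) simp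
    have eq: "emeasure lborel (ball (0::'a) 1) = ennreal (unit_ball_vol (real DIM('a)))" by (simp add: emeasure_ball)
    have "ennreal v < \<top>" "ennreal v \<noteq> 0" if "0 < v" for v using that by auto
    from this[OF pos] show "emeasure lborel (ball (0::'a) 1) < \<top>" "emeasure lborel (ball (0::'a) 1) \<noteq> 0"
      unfolding eq .
  qed
  have g0: "0 < (2 * gauss_half) ^ DIM('a)" using gauss_half_pos by simp
  have cifin: "ci \<noteq> \<top>" "ci \<noteq> 0"
  proof -
    have "ennreal G \<noteq> 0" "ennreal G \<noteq> \<top>" if "0 < G" for G using that by auto
    from this[OF g0] have "V * ci \<noteq> 0" "V * ci \<noteq> \<top>" unfolding Vci .
    then show "ci \<noteq> \<top>" "ci \<noteq> 0" using Vfin by (auto simp: ennreal_mult_eq_top_iff)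
  qed
  have Pfin: "emeasure lborel P < \<top>" and Kfin: "emeasure lborel K < \<top>"
    using bd emeasure_bounded_finite by auto
  obtain p k v s where pk: "emeasure lborel P = ennreal p" "emeasure lborel K = ennreal k" "V = ennreal v" "ci = ennreal s"
      "0 \<le> p" "0 \<le> k" "0 \<le> v" "0 \<le> s"
    using Pfin Kfin Vfin cifin by (metis ennreal_cases less_top)
  have s0: "0 < s" using pk cifin by (cases "s = 0") auto
  have clim: "c \<longlonglongrightarrow> ennreal s"
    unfolding pk(4)[symmetric] c_def ci_def by (rule layered_const_LIMSEQ)
  have cle: "c n \<le> ennreal s" for n
    unfolding pk(4)[symmetric] c_def ci_def layered_const_def
    by (intro nn_integral_mono mult_right_mono mult_left_mono) (auto simp: indicator_def)
  define t where "t n = enn2real (c n)" for n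
  have ct: "c n = ennreal (t n)" "0 \<le> t n" for n
    using cle[of n] unfolding t_def by (auto simp: ennreal_enn2real le_less_trans[OF cle] )
  have "c = (\<lambda>n. ennreal (t n))" by (rule ext) (rule ct)
  then have "(\<lambda>n. ennreal (t n)) \<longlonglongrightarrow> ennreal s" using clim by simp
  then have tl: "t \<longlonglongrightarrow> s" using ct(2) pk(8) by (simp add: tendsto_ennreal_iff)
  have "p * t n * (k * t n) \<le> (v * s)\<^sup>2" for n
    using main[of n] pk ct[of n] by (simp add: ennreal_mult[symmetric] ennreal_power)
  moreover have "(\<lambda>n. p * t n * (k * t n)) \<longlonglongrightarrow> p * s * (k * s)"
    by (intro tendsto_intros tl)
  ultimately have "p * s * (k * s) \<le> (v * s)\<^sup>2"
    by (intro LIMSEQ_le_const2) auto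
  then have "(k * p) * s\<^sup>2 \<le> v\<^sup>2 * s\<^sup>2" by (simp add: power2_eq_square ac_simps)
  then have "k * p \<le> v\<^sup>2" using s0 by (simp add: mult_le_cancel_right)
  then show ?thesis
    using pk by (simp add: V_def[symmetric] ennreal_mult[symmetric] ennreal_power)
qed

section \<open>Polar bodies and their exponential weight\<close>

definition sup_inner :: "'a::euclidean_space set \<Rightarrow> 'a \<Rightarrow> real" where
  "sup_inner K y = (SUP X\<in>K. y \<bullet> X)"

definition polar_at :: "'a::euclidean_space set \<Rightarrow> 'a \<Rightarrow> 'a set" where
  "polar_at K z = {y. \<forall>X\<in>K. y \<bullet> (X - z) \<le> 1}"

lemma sup_inner_bdd: "compact K \<Longrightarrow> bdd_above ((\<lambda>X. y \<bullet> X) ` K)"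
  by (intro bounded_imp_bdd_above compact_imp_bounded compact_continuous_image continuous_intros)

lemma sup_inner_le_iff:
  assumes "compact K" "K \<noteq> {}"
  shows "sup_inner K y \<le> a \<longleftrightarrow> (\<forall>X\<in>K. y \<bullet> X \<le> a)"
  unfolding sup_inner_def using assms by (rule_tac cSUP_le_iff[OF _ sup_inner_bdd]) auto

lemma sup_inner_ge: "compact K \<Longrightarrow> X \<in> K \<Longrightarrow> y \<bullet> X \<le> sup_inner K y"
  using sup_inner_le_iff[of K y "sup_inner K y"] by blast

lemma sup_inner_measurable:
  assumes "compact K" "K \<noteq> {}"
  shows "sup_inner K \<in> borel_measurable borel"
proof (rule borel_measurable_iff_le[THEN iffD2], rule allI)
  fix a
  have "{y. sup_inner K y \<le> a} = (\<Inter>X\<in>K. {y. y \<bullet> X \<le> a})"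
    using sup_inner_le_iff[OF assms] by auto
  moreover have "closed (\<Inter>X\<in>K. {y. y \<bullet> X \<le> a})"
    by (intro closed_INT ballI closed_Collect_le continuous_intros)
  ultimately show "{w \<in> space borel. sup_inner K w \<le> a} \<in> sets borel" by (simp add: borel_closed)
qed

lemma polar_at_eq:
  assumes "compact K" "K \<noteq> {}"
  shows "polar_at K z = {y. sup_inner K y - y \<bullet> z \<le> 1}"
proof -
  have "(\<forall>X\<in>K. y \<bullet> (X - z) \<le> 1) \<longleftrightarrow> sup_inner K y \<le> 1 + y \<bullet> z" for y
    unfolding sup_inner_le_iff[OF assms] by (auto simp: inner_diff_right algebra_simps)
  then show ?thesis by (auto simp: polar_at_def algebra_simps)
qed

lemma closed_polar_at: "closed (polar_at K z)"
proof -
  have "polar_at K z = (\<Inter>X\<in>K. {y. y \<bullet> (X - z) \<le> 1})" by (auto simp: polar_at_def)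
  then show ?thesis by (simp add: closed_INT closed_Collect_le continuous_on_inner continuous_on_const continuous_on_id)
qed

text \<open>
  The weight is a superposition of the dilates of the polar body, since \<open>y\<close> lies in \<open>r\<close> times the polar
  exactly if the support function of \<open>K - z\<close> at \<open>y\<close> is at most \<open>r\<close>. So moments of the weight are, up to a
  factorial, moments of the polar body.
\<close>

lemma exp_weight_layered:
  fixes K :: "'a::euclidean_space set"
  assumes K: "compact K" "K \<noteq> {}" and nn: "\<And>y. 0 \<le> sup_inner K y - y \<bullet> z"
  shows "ennreal (exp (- (sup_inner K y - y \<bullet> z)))
    = (\<integral>\<^sup>+r. ennreal (exp (- r)) * indicator {0<..} r * indicator (polar_at K z) (inverse r *\<^sub>R y) \<partial>lborel)"
proof -
  define h where "h = sup_inner K y - y \<bullet> z"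
  have mem: "inverse r *\<^sub>R y \<in> polar_at K z \<longleftrightarrow> h \<le> r" if r: "0 < r" for r
  proof -
    have "(inverse r *\<^sub>R y) \<bullet> (X - z) \<le> 1 \<longleftrightarrow> y \<bullet> X \<le> r + y \<bullet> z" for X
    proof -
      have "(inverse r *\<^sub>R y) \<bullet> (X - z) = (y \<bullet> X - y \<bullet> z) / r" by (simp add: inner_diff_right divide_inverse algebra_simps)
      then show ?thesis using r by (simp add: pos_divide_le_eq algebra_simps)
    qed
    then have "inverse r *\<^sub>R y \<in> polar_at K z \<longleftrightarrow> sup_inner K y \<le> r + y \<bullet> z"
      unfolding polar_at_def sup_inner_le_iff[OF K] by simp
    then show ?thesis by (auto simp: h_def)
  qed
  have "((\<lambda>r::real. - exp (- r)) \<longlongrightarrow> 0) at_top" by real_asymp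
  then have "(\<integral>\<^sup>+r. ennreal (exp (- r)) * indicator {h..} r \<partial>lborel) = ennreal (0 - - exp (- h))"
    by (intro nn_integral_FTC_atLeast) (auto intro!: derivative_eq_intros)
  moreover have "(\<integral>\<^sup>+r. ennreal (exp (- r)) * indicator {h..} r \<partial>lborel)
    = (\<integral>\<^sup>+r. ennreal (exp (- r)) * indicator {0<..} r * indicator (polar_at K z) (inverse r *\<^sub>R y) \<partial>lborel)"
  proof (rule nn_integral_cong_AE, rule AE_mp[OF AE_lborel_singleton[of "0::real"]], rule AE_I2, rule impI)
    fix r :: real assume "r \<noteq> 0"
    then show "ennreal (exp (- r)) * indicator {h..} r = ennreal (exp (- r)) * indicator {0<..} r * indicator (polar_at K z) (inverse r *\<^sub>R y)"
      using mem[of r] nn[of y] by (cases "0 < r") (auto simp: indicator_def h_def[symmetric])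
  qed
  ultimately show ?thesis by (simp add: h_def)
qed

lemma nn_integral_power_exp_pos:
  "(\<integral>\<^sup>+r. ennreal (r ^ n) * ennreal (exp (- r)) * indicator {0<..} r \<partial>lborel) = ennreal (fact n)"
proof -
  have "(\<integral>\<^sup>+r. ennreal (r ^ n) * ennreal (exp (- r)) * indicator {0<..} r \<partial>lborel)
     = (\<integral>\<^sup>+r. ennreal (r ^ n * exp (- r)) * indicator {0..} r \<partial>lborel)"
    by (rule nn_integral_cong_AE, rule AE_mp[OF AE_lborel_singleton[of "0::real"]], rule AE_I2)
       (auto simp: indicator_def ennreal_mult'')
  then show ?thesis using nn_intergal_power_times_exp_Ici[of n] by simp
qed

lemma nn_integral_exp_weight:
  fixes K :: "'a::euclidean_space set"
  assumes K: "compact K" "K \<noteq> {}" and nn: "\<And>y. 0 \<le> sup_inner K y - y \<bullet> z"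
    and u: "u \<in> borel_measurable borel" "\<And>r y. 0 < r \<Longrightarrow> u (r *\<^sub>R y) = ennreal (r ^ d) * u y"
  shows "(\<integral>\<^sup>+y. u y * ennreal (exp (- (sup_inner K y - y \<bullet> z))) \<partial>lborel)
    = (\<integral>\<^sup>+y. u y * indicator (polar_at K z) y \<partial>lborel) * ennreal (fact (DIM('a) + d))"
  unfolding exp_weight_layered[OF K nn]
  by (subst radial_nn_integral[OF _ u(1) _ u(2)])
     (auto simp: nn_integral_power_exp_pos borel_closed closed_polar_at)

lemma bounded_polar_at:
  fixes K :: "'a::euclidean_space set"
  assumes K: "compact K" "K \<noteq> {}" and c: "0 < c" "\<And>y. c * norm y \<le> sup_inner K y - y \<bullet> z"
  shows "bounded (polar_at K z)"
proof (rule boundedI)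
  fix y assume "y \<in> polar_at K z"
  then have "c * norm y \<le> 1" using c(2)[of y] by (simp add: polar_at_eq[OF K])
  then show "norm y \<le> 1 / c" using c(1) by (simp add: pos_le_divide_eq mult.commute)
qed

lemma exp_weight_finite:
  fixes K :: "'a::euclidean_space set"
  assumes K: "compact K" "K \<noteq> {}" and c: "0 < c" "\<And>y. c * norm y \<le> sup_inner K y - y \<bullet> z"
  shows "(\<integral>\<^sup>+y. ennreal (exp (- (sup_inner K y - y \<bullet> z))) \<partial>lborel) < \<top>"
proof -
  have nn: "0 \<le> sup_inner K y - y \<bullet> z" for y
    using c(2)[of y] mult_nonneg_nonneg[OF less_imp_le[OF c(1)] norm_ge_zero[of y]] by linarith
  have "(\<integral>\<^sup>+y. 1 * ennreal (exp (- (sup_inner K y - y \<bullet> z))) \<partial>lborel)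
    = (\<integral>\<^sup>+y. 1 * indicator (polar_at K z) y \<partial>lborel) * ennreal (fact (DIM('a) + 0))"
    by (rule nn_integral_exp_weight[OF K nn]) auto
  moreover have "emeasure lborel (polar_at K z) < \<top>"
    using emeasure_bounded_finite[OF bounded_polar_at[OF K c]] by simp
  ultimately show ?thesis using closed_polar_at[of K z] by (simp add: ennreal_mult_less_top borel_closed)
qed

text \<open>
  The quadratic remainder is dominated uniformly in \<open>s\<close> by functions whose integrals against the weight
  are finite at neighbouring points; this replaces differentiation under the integral sign.
\<close>

lemma exp_quadratic_bound:
  fixes s x :: real
  assumes "\<bar>s\<bar> \<le> 1"
  shows "exp (s * x) \<le> 1 + s * x + s\<^sup>2 * (exp (2 * x) + exp (- (2 * x)))"
proof -
  obtain t where t: "\<bar>t\<bar> \<le> \<bar>s * x\<bar>" "exp (s * x) = (\<Sum>m<2. (s * x) ^ m / fact m) + exp t / fact 2 * (s * x) ^ 2"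
    using Maclaurin_exp_le[of "s * x" 2] by blast
  have sx: "\<bar>s * x\<bar> \<le> \<bar>x\<bar>" using assms by (simp add: abs_mult mult_left_le_one_le)
  have "exp t \<le> exp \<bar>x\<bar>" using t(1) sx by simp
  moreover have "x\<^sup>2 / 2 \<le> exp \<bar>x\<bar>" using exp_lower_Taylor_quadratic[of "\<bar>x\<bar>"] by simp
  ultimately have "exp t * (x\<^sup>2 / 2) \<le> exp \<bar>x\<bar> * exp \<bar>x\<bar>" by (intro mult_mono) auto
  also have "\<dots> = exp (2 * \<bar>x\<bar>)" by (simp add: exp_add[symmetric])
  also have "\<dots> \<le> exp (2 * x) + exp (- (2 * x))" by (cases "x \<ge> 0") auto
  finally have "s\<^sup>2 * (exp t * (x\<^sup>2 / 2)) \<le> s\<^sup>2 * (exp (2 * x) + exp (- (2 * x)))"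
    by (rule mult_left_mono) simp
  moreover have "exp (s * x) = 1 + s * x + s\<^sup>2 * (exp t * (x\<^sup>2 / 2))"
    unfolding t(2) by (simp add: numeral_2_eq_2 power2_eq_square)
  ultimately show ?thesis by linarith
qed

text \<open>
  The first variation at a minimum: \<open>0 \<le> s * M + s\<^sup>2 * g\<close> for all small \<open>s\<close> of both signs forces the first
  moment \<open>M\<close> to vanish.
\<close>

lemma stationary_moment:
  fixes w u :: "'a::euclidean_space \<Rightarrow> real"
  assumes [measurable]: "w \<in> borel_measurable borel" "u \<in> borel_measurable borel"
    and w: "\<And>y. 0 \<le> w y" and t0: "0 < t0"
    and fin: "\<And>t. \<bar>t\<bar> \<le> t0 \<Longrightarrow> (\<integral>\<^sup>+y. ennreal (w y * exp (t * u y)) \<partial>lborel) < \<top>"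
    and min: "\<And>t. \<bar>t\<bar> \<le> t0 \<Longrightarrow> (\<integral>\<^sup>+y. ennreal (w y) \<partial>lborel) \<le> (\<integral>\<^sup>+y. ennreal (w y * exp (t * u y)) \<partial>lborel)"
  shows "(\<integral>\<^sup>+y. ennreal (u y * w y) \<partial>lborel) = (\<integral>\<^sup>+y. ennreal (- (u y * w y)) \<partial>lborel)"
proof -
  have int: "integrable lborel (\<lambda>y. w y * exp (t * u y))" if "\<bar>t\<bar> \<le> t0" for t
    using fin[OF that] w by (intro integrableI_nonneg) (auto simp: zero_le_mult_iff)
  have int0: "integrable lborel w" using int[of 0] t0 by simp
  define x where "x y = (t0 / 2) * u y" for y
  define G where "G y = w y * exp (t0 * u y) + w y * exp (- t0 * u y)" for y
  have intG: "integrable lborel G" unfolding G_def using int[of t0] int[of "- t0"] t0 by (intro Bochner_Integration.integrable_add) auto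
  have Geq: "w y * (exp (2 * x y) + exp (- (2 * x y))) = G y" for y
    by (simp add: G_def x_def distrib_left)
  have intx: "integrable lborel (\<lambda>y. w y * x y)"
  proof (rule Bochner_Integration.integrable_bound[OF intG])
    have "\<bar>x y\<bar> \<le> exp (2 * x y) + exp (- (2 * x y))" for y
      using exp_ge_add_one_self[of "2 * x y"] exp_ge_add_one_self[of "- (2 * x y)"]
        exp_gt_zero[of "2 * x y"] exp_gt_zero[of "- (2 * x y)"] by linarith
    then have "w y * \<bar>x y\<bar> \<le> G y" for y unfolding Geq[symmetric] by (intro mult_left_mono w)
    then show "AE y in lborel. norm (w y * x y) \<le> norm (G y)"
      using w by (intro AE_I2) (auto simp: abs_mult intro: order_trans[OF _ abs_ge_self])
  qed (simp add: x_def)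
  define M where "M = (LINT y|lborel. w y * x y)"
  define g where "g = (LINT y|lborel. G y)"
  have var: "0 \<le> s * M + s\<^sup>2 * g" if s: "\<bar>s\<bar> \<le> 1" for s
  proof -
    define t where "t = s * (t0 / 2)"
    have t: "\<bar>t\<bar> \<le> t0" using s t0 mult_right_mono[of "\<bar>s\<bar>" 1 "t0 / 2"] by (simp add: t_def abs_mult)
    have "ennreal (LINT y|lborel. w y) \<le> ennreal (LINT y|lborel. w y * exp (t * u y))"
      using min[OF t] nn_integral_eq_integral[OF int0] nn_integral_eq_integral[OF int[OF t]] w by simp
    moreover have "0 \<le> (LINT y|lborel. w y * exp (t * u y))" using w by (intro Bochner_Integration.integral_nonneg) simp
    ultimately have "(LINT y|lborel. w y) \<le> (LINT y|lborel. w y * exp (t * u y))" by simp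
    also have "\<dots> \<le> (LINT y|lborel. w y + s * (w y * x y) + s\<^sup>2 * G y)"
    proof (rule integral_mono)
      fix y
      have "w y * exp (s * x y) \<le> w y * (1 + s * x y + s\<^sup>2 * (exp (2 * x y) + exp (- (2 * x y))))"
        by (rule mult_left_mono[OF exp_quadratic_bound[OF s] w])
      also have "\<dots> = w y + s * (w y * x y) + s\<^sup>2 * G y" unfolding Geq[symmetric] by (simp add: algebra_simps)
      finally show "w y * exp (t * u y) \<le> w y + s * (w y * x y) + s\<^sup>2 * G y"
        by (simp add: t_def x_def mult.assoc)
    qed (use int[OF t] int0 intx intG in auto)
    also have "\<dots> = (LINT y|lborel. w y) + s * M + s\<^sup>2 * g"
      unfolding M_def g_def using int0 intx intG by simp
    finally show ?thesis by simp
  qed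
  have "M = 0"
  proof (rule ccontr)
    assume M: "M \<noteq> 0"
    define s where "s = min 1 (\<bar>M\<bar> / (2 * (\<bar>g\<bar> + 1)))"
    have s: "0 < s" "s \<le> 1" using M by (auto simp: s_def)
    have "s \<le> \<bar>M\<bar> / (2 * (\<bar>g\<bar> + 1))" by (simp add: s_def)
    then have sg: "s * (\<bar>g\<bar> + 1) \<le> \<bar>M\<bar> / 2" by (simp add: pos_le_divide_eq algebra_simps)
    have "s * g \<le> s * (\<bar>g\<bar> + 1)" using s by (intro mult_left_mono) auto
    then have "s * g \<le> \<bar>M\<bar> / 2" using sg by linarith
    moreover have "0 \<le> s * (M + s * g)" using var[of s] s by (simp add: power2_eq_square algebra_simps)
    moreover have "0 \<le> s * (- M + s * g)" using var[of "- s"] s by (simp add: power2_eq_square algebra_simps)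
    ultimately have "0 \<le> M + \<bar>M\<bar> / 2" "0 \<le> - M + \<bar>M\<bar> / 2" using s(1) by (auto simp: zero_le_mult_iff)
    then show False using M by (auto simp: abs_if split: if_splits)
  qed
  have intu: "integrable lborel (\<lambda>y. u y * w y)"
  proof -
    have "(\<lambda>y. u y * w y) = (\<lambda>y. (2 / t0) * (w y * x y))" using t0 by (auto simp: x_def)
    then show ?thesis using intx by simp
  qed
  have "(LINT y|lborel. u y * w y) = (2 / t0) * M"
  proof -
    have "(\<lambda>y. u y * w y) = (\<lambda>y. (2 / t0) * (w y * x y))" using t0 by (auto simp: x_def)
    then show ?thesis unfolding M_def by simp
  qed
  then have "(LINT y|lborel. u y * w y) = 0" using \<open>M = 0\<close> by simp
  then have "enn2real (\<integral>\<^sup>+y. ennreal (u y * w y) \<partial>lborel) = enn2real (\<integral>\<^sup>+y. ennreal (- (u y * w y)) \<partial>lborel)"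
    using intu by (simp add: real_lebesgue_integral_def)
  moreover have "(\<integral>\<^sup>+y. ennreal (u y * w y) \<partial>lborel) < \<top>" "(\<integral>\<^sup>+y. ennreal (- (u y * w y)) \<partial>lborel) < \<top>"
    using intu by (auto simp: real_integrable_def less_top)
  ultimately show ?thesis by (metis ennreal_enn2real)
qed

section \<open>Bodies doubled by reflection\<close>

text \<open>
  The tube contains infinitely many disjoint balls of the same radius.
\<close>

lemma nn_integral_top_if_tube:
  fixes f :: "'a::euclidean_space \<Rightarrow> ennreal"
  assumes [measurable]: "f \<in> borel_measurable borel" and a: "norm a = 1" and e: "0 < \<epsilon>"
    and le: "\<And>k y. y \<in> ball ((3 * real k) *\<^sub>R a) 1 \<Longrightarrow> ennreal \<epsilon> \<le> f y"
  shows "(\<integral>\<^sup>+y. f y \<partial>lborel) = \<top>"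
proof -
  let ?B = "\<lambda>k. ball ((3 * real k) *\<^sub>R a) 1"
  define v where "v = unit_ball_vol (real DIM('a))"
  have v: "0 < v" unfolding v_def by (rule unit_ball_vol_pos) simp
  have em: "emeasure lborel (?B k) = ennreal v" for k by (simp add: emeasure_ball v_def)
  have uniq: "j = k" if "y \<in> ?B j" "y \<in> ?B k" for j k y
  proof -
    have d: "dist ((3 * real j) *\<^sub>R a) ((3 * real k) *\<^sub>R a) < 2"
      using that dist_triangle2[of "(3 * real j) *\<^sub>R a" "(3 * real k) *\<^sub>R a" y] by simp
    have "(3 * real j) *\<^sub>R a - (3 * real k) *\<^sub>R a = (3 * (real j - real k)) *\<^sub>R a"
      by (simp add: scaleR_left_diff_distrib[symmetric] right_diff_distrib)
    then have e: "dist ((3 * real j) *\<^sub>R a) ((3 * real k) *\<^sub>R a) = \<bar>3 * (real j - real k)\<bar>"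
      unfolding dist_norm using a by simp
    have "3 * \<bar>real j - real k\<bar> < 2" using d unfolding e by (simp add: abs_mult)
    moreover have "1 \<le> \<bar>real j - real k\<bar>" if "j \<noteq> k"
      using that by (cases j k rule: linorder_cases) auto
    ultimately show ?thesis by fastforce
  qed
  have [measurable]: "?B k \<in> sets borel" for k by simp
  have one: "(\<integral>\<^sup>+y. ennreal \<epsilon> * indicator (?B k) y \<partial>lborel) = ennreal (\<epsilon> * v)" for k
    using e v by (subst nn_integral_cmult_indicator) (simp_all add: em ennreal_mult)
  have bound: "of_nat n * ennreal (\<epsilon> * v) \<le> (\<integral>\<^sup>+y. f y \<partial>lborel)" for n
  proof -
    have "of_nat n * ennreal (\<epsilon> * v) = (\<Sum>k<n. \<integral>\<^sup>+y. ennreal \<epsilon> * indicator (?B k) y \<partial>lborel)"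
      unfolding one by simp
    also have "\<dots> = (\<integral>\<^sup>+y. (\<Sum>k<n. ennreal \<epsilon> * indicator (?B k) y) \<partial>lborel)"
      by (rule nn_integral_sum[symmetric]) measurable
    also have "\<dots> \<le> (\<integral>\<^sup>+y. f y \<partial>lborel)"
    proof (rule nn_integral_mono)
      fix y
      show "(\<Sum>k<n. ennreal \<epsilon> * indicator (?B k) y) \<le> f y"
      proof (cases "\<exists>k<n. y \<in> ?B k")
        case True
        then obtain k where k: "k < n" "y \<in> ?B k" by blast
        have "(\<Sum>j<n. ennreal \<epsilon> * indicator (?B j) y) = (\<Sum>j<n. if j = k then ennreal \<epsilon> else 0)"
          using uniq k by (intro sum.cong refl) (auto simp: indicator_def)
        also have "\<dots> = ennreal \<epsilon>" using k(1) by simp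
        finally show ?thesis using le[OF k(2)] by simp
      next
        case False
        have z0: "(\<Sum>j<n. ennreal \<epsilon> * indicator (?B j) y) = 0"
        proof (intro sum.neutral ballI)
          fix j assume "j \<in> {..<n}"
          then have "y \<notin> ?B j" using False by blast
          then show "ennreal \<epsilon> * indicator (?B j) y = 0" by simp
        qed
        show ?thesis unfolding z0 by (rule zero_le)
      qed
    qed
    finally show ?thesis .
  qed
  show ?thesis
  proof (cases "\<integral>\<^sup>+y. f y \<partial>lborel")
    case (real r)
    obtain n :: nat where n: "r < real n * (\<epsilon> * v)" using reals_Archimedean3[of "\<epsilon> * v"] e v by auto
    have "ennreal (real n * (\<epsilon> * v)) \<le> ennreal r"
      using bound[of n] real e v by (simp add: ennreal_mult ennreal_of_nat_eq_real_of_nat)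
    then show ?thesis using n real by simp
  qed
qed

text \<open>
  The integral is lower semicontinuous by Fatou's lemma, hence attains its infimum on a compact set.
\<close>

lemma exp_weight_minimiser:
  fixes H :: "'a::euclidean_space \<Rightarrow> real" and g :: "'b::euclidean_space \<Rightarrow> 'a"
  defines "\<Phi> z \<equiv> (\<integral>\<^sup>+y. ennreal (exp (- (H y - y \<bullet> g z))) \<partial>lborel)"
  assumes [measurable]: "H \<in> borel_measurable borel" and D: "compact D" and g: "continuous_on D g"
    and fin: "z1 \<in> D" "\<Phi> z1 < \<top>"
  obtains z where "z \<in> D" "\<And>z'. z' \<in> D \<Longrightarrow> \<Phi> z \<le> \<Phi> z'"
proof -
  define m where "m = (INF z\<in>D. \<Phi> z)"
  have mfin: "m < \<top>" unfolding m_def using fin by (auto simp: INF_less_iff)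
  have "\<exists>z\<in>D. \<Phi> z < m + ennreal (1 / (real n + 1))" for n
  proof -
    have "m < m + ennreal (1 / (real n + 1))" using mfin by (cases m) (auto simp: ennreal_plus[symmetric] ennreal_less_iff simp del: ennreal_plus)
    then show ?thesis unfolding m_def INF_less_iff by blast
  qed
  then obtain Z where Z: "\<And>n. Z n \<in> D" "\<And>n. \<Phi> (Z n) < m + ennreal (1 / (real n + 1))" by metis
  obtain l r where l: "l \<in> D" "strict_mono r" "(Z \<circ> r) \<longlonglongrightarrow> l"
    using D Z(1) unfolding compact_def by meson
  have gl: "(\<lambda>n. g (Z (r n))) \<longlonglongrightarrow> g l"
    using continuous_on_tendsto_compose[OF g l(3) l(1)] Z(1) by (simp add: comp_def)
  have "\<Phi> l = (\<integral>\<^sup>+y. liminf (\<lambda>n. ennreal (exp (- (H y - y \<bullet> g (Z (r n)))))) \<partial>lborel)"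
    unfolding \<Phi>_def
  proof (rule nn_integral_cong)
    fix y
    have "(\<lambda>n. ennreal (exp (- (H y - y \<bullet> g (Z (r n)))))) \<longlonglongrightarrow> ennreal (exp (- (H y - y \<bullet> g l)))"
      by (intro tendsto_ennrealI tendsto_intros gl)
    from lim_imp_Liminf[OF _ this] show "ennreal (exp (- (H y - y \<bullet> g l))) = liminf (\<lambda>n. ennreal (exp (- (H y - y \<bullet> g (Z (r n))))))"
      by simp
  qed
  also have "\<dots> \<le> liminf (\<lambda>n. \<Phi> (Z (r n)))"
    unfolding \<Phi>_def by (rule nn_integral_liminf) measurable
  also have "\<dots> \<le> liminf (\<lambda>n. m + ennreal (1 / (real (r n) + 1)))"
    using Z(2) by (intro Liminf_mono always_eventually allI less_imp_le)
  also have "\<dots> = m"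
  proof (rule lim_imp_Liminf)
    have "(\<lambda>n. 1 / (real n + 1)) \<longlonglongrightarrow> 0" by real_asymp
    from LIMSEQ_subseq_LIMSEQ[OF this l(2)] have "(\<lambda>n. 1 / (real (r n) + 1)) \<longlonglongrightarrow> 0" by (simp add: comp_def)
    then have "(\<lambda>n. ennreal (1 / (real (r n) + 1))) \<longlonglongrightarrow> ennreal 0" by (rule tendsto_ennrealI)
    from tendsto_add[OF tendsto_const this] show "(\<lambda>n. m + ennreal (1 / (real (r n) + 1))) \<longlonglongrightarrow> m" by simp
  qed simp
  finally have "\<Phi> l \<le> m" .
  then show thesis using l(1) by (intro that[of l]) (auto simp: m_def intro: order_trans INF_lower)
qed

lemma emeasure_translate:
  fixes A :: "'a::euclidean_space set"
  assumes "closed A"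
  shows "(\<lambda>X. X + z) ` A \<in> sets borel" "emeasure lborel ((\<lambda>X. X + z) ` A) = emeasure lborel A"
proof -
  have e: "(\<lambda>X. X + z) ` A = (+) z ` A" by (intro image_cong) (auto simp: add.commute)
  have "closed ((\<lambda>X. X + z) ` A)" unfolding e by (rule closed_translation[OF assms])
  then show b: "(\<lambda>X. X + z) ` A \<in> sets borel" by (rule borel_closed)
  have "emeasure lborel ((\<lambda>X. X + z) ` A) = emeasure (distr lborel borel ((+) z)) ((+) z ` A)"
    unfolding e lborel_distr_plus ..
  also have "\<dots> = emeasure lborel ((+) z -` ((+) z ` A) \<inter> space lborel)"
    using b unfolding e by (intro emeasure_distr) simp_all
  also have "(+) z -` ((+) z ` A) \<inter> space lborel = A" by auto
  finally show "emeasure lborel ((\<lambda>X. X + z) ` A) = emeasure lborel A" .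
qed

definition flip :: "'n::finite space \<Rightarrow> 'n space" where
  "flip x = (fst x, - snd x)"

lemma flip_measurable [measurable]: "flip \<in> borel_measurable borel"
  unfolding flip_def by (intro borel_measurable_continuous_onI continuous_intros)

lemma flip_flip [simp]: "flip (flip x) = x"
  by (simp add: flip_def)

lemma inner_flip: "flip y \<bullet> X = y \<bullet> flip X"
  by (simp add: flip_def inner_prod_def)

lemma nn_integral_flip:
  fixes \<phi> :: "'n::finite space \<Rightarrow> ennreal"
  assumes [measurable]: "\<phi> \<in> borel_measurable borel"
  shows "(\<integral>\<^sup>+y. \<phi> (flip y) \<partial>lborel) = (\<integral>\<^sup>+y. \<phi> y \<partial>lborel)"
proof -
  have int: "(\<integral>\<^sup>+y. \<psi> y \<partial>lborel) = (\<integral>\<^sup>+x. \<integral>\<^sup>+t. \<psi> (x, t) \<partial>lborel \<partial>lborel)"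
    if "\<psi> \<in> borel_measurable borel" for \<psi> :: "'n space \<Rightarrow> ennreal"
  proof -
    have "\<psi> \<in> borel_measurable (lborel \<Otimes>\<^sub>M lborel)" using that by (simp add: lborel_prod)
    from lborel.nn_integral_fst[OF this] show ?thesis by (simp add: lborel_prod)
  qed
  have "(\<integral>\<^sup>+y. \<phi> (flip y) \<partial>lborel) = (\<integral>\<^sup>+x. \<integral>\<^sup>+t. \<phi> (x, - t) \<partial>lborel \<partial>lborel)"
  proof -
    have "(\<lambda>y. \<phi> (flip y)) \<in> borel_measurable borel" by measurable
    from int[OF this] show ?thesis by (simp add: flip_def)
  qed
  also have "\<dots> = (\<integral>\<^sup>+x. \<integral>\<^sup>+t. \<phi> (x, t) \<partial>lborel \<partial>lborel)"
  proof (rule nn_integral_cong)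
    fix x
    have [measurable]: "(\<lambda>t. \<phi> (x, t)) \<in> borel_measurable borel"
      by (rule measurable_compose[of _ _ borel]) (auto intro!: borel_measurable_continuous_onI continuous_intros)
    show "(\<integral>\<^sup>+t. \<phi> (x, - t) \<partial>lborel) = (\<integral>\<^sup>+t. \<phi> (x, t) \<partial>lborel)"
      by (subst (2) nn_integral_real_affine[where c="-1" and t=0]) auto
  qed
  also have "\<dots> = (\<integral>\<^sup>+y. \<phi> y \<partial>lborel)" by (rule int[symmetric]) simp
  finally show ?thesis .
qed

text \<open>
  The set and its mirror image meet only in the plane, which has measure zero.
\<close>

lemma emeasure_doubled:
  fixes Q :: "'n::finite space set"
  assumes [measurable]: "Q \<in> sets borel" and half: "Q \<subseteq> closed_half_space"
  shows "2 * emeasure lborel Q \<le> emeasure lborel (Q \<union> flip ` Q)"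
proof -
  have fl: "flip ` Q = flip -` Q" by (force simp: image_iff intro: flip_flip[symmetric])
  have [measurable]: "flip ` Q \<in> sets borel" unfolding fl using measurable_sets_borel[OF flip_measurable, of Q] by simp
  have b: "(0, 1) \<in> (Basis :: 'n space set)" by (simp add: Basis_prod_def)
  have "2 * emeasure lborel Q = (\<integral>\<^sup>+y. indicator Q y \<partial>lborel) + (\<integral>\<^sup>+y. indicator Q (flip y) \<partial>lborel)"
    by (subst nn_integral_flip) (auto simp: mult_2)
  also have "\<dots> = (\<integral>\<^sup>+y. indicator Q y + indicator Q (flip y) \<partial>lborel)"
    by (rule nn_integral_add[symmetric]) auto
  also have "\<dots> \<le> (\<integral>\<^sup>+y. indicator (Q \<union> flip ` Q) y \<partial>lborel)"
  proof (rule nn_integral_mono_AE, rule AE_mp[OF AE_lborel_inner_neq[OF b, of 0]], rule AE_I2, rule impI)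
    fix y :: "'n space" assume "y \<bullet> (0, 1) \<noteq> 0"
    then have "snd y \<noteq> 0" by (simp add: inner_prod_def)
    have "\<not> (y \<in> Q \<and> flip y \<in> Q)"
    proof
      assume "y \<in> Q \<and> flip y \<in> Q"
      then have "y \<in> closed_half_space" "flip y \<in> closed_half_space" using half by blast+
      with \<open>snd y \<noteq> 0\<close> show False by (simp add: closed_half_space_def flip_def)
    qed
    then show "indicator Q y + indicator Q (flip y) \<le> (indicator (Q \<union> flip ` Q) y :: ennreal)"
      unfolding fl by (auto simp: indicator_def)
  qed
  also have "\<dots> = emeasure lborel (Q \<union> flip ` Q)" by simp
  finally show ?thesis .
qed

context
  fixes Q K :: "'n::finite space set" and D :: "(real ^ 'n) set"
  assumes Q: "compact Q" "convex Q" "interior Q \<noteq> {}" "Q \<subseteq> closed_half_space"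
    and proj: "\<And>x t. (x, t) \<in> Q \<Longrightarrow> (x, 0) \<in> Q"
  defines "D \<equiv> {x. (x, 0) \<in> Q}" and "K \<equiv> Q \<union> flip ` Q"
begin

lemma interior_point_above: "\<exists>x0 t0. (x0, t0) \<in> interior Q \<and> 0 < t0"
proof -
  obtain x0 t0 where x: "(x0, t0) \<in> interior Q" using Q(3) by (metis ex_in_conv surj_pair)
  obtain e where e: "0 < e" "cball (x0, t0) e \<subseteq> Q" using x by (auto simp: mem_interior_cball)
  have "(x0, t0 - e) \<in> cball (x0, t0) e" using e(1) by (simp add: dist_Pair_Pair dist_real_def)
  then have "(x0, t0 - e) \<in> closed_half_space" using e(2) Q(4) by blast
  then have "0 \<le> t0 - e" by (simp add: closed_half_space_def)
  then show ?thesis using x e(1) by force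
qed

lemma base_compact: "compact D"
proof -
  have "D = fst ` (Q \<inter> bounding_plane)" unfolding D_def bounding_plane_def by force
  moreover have "closed (bounding_plane :: 'n space set)"
    unfolding bounding_plane_def by (intro closed_Collect_eq continuous_intros)
  ultimately show ?thesis
    using Q(1) by (auto intro!: compact_continuous_image compact_Int_closed continuous_intros)
qed

lemma base_convex: "convex D"
  unfolding convex_def
proof (intro ballI allI impI)
  fix x y and u v :: real assume "x \<in> D" "y \<in> D" and uv: "0 \<le> u" "0 \<le> v" "u + v = 1"
  then have "u *\<^sub>R (x, 0) + v *\<^sub>R (y, 0) \<in> Q" using Q(2) unfolding D_def convex_def by blast
  then show "u *\<^sub>R x + v *\<^sub>R y \<in> D" by (simp add: D_def)
qed

lemma base_interior_nonempty: "interior D \<noteq> {}"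
proof -
  obtain x0 t0 where x0: "(x0, t0) \<in> interior Q" using interior_point_above by blast
  obtain e where e: "0 < e" "cball (x0, t0) e \<subseteq> Q" using x0 by (auto simp: mem_interior_cball)
  have "cball x0 e \<subseteq> D"
  proof
    fix x assume "x \<in> cball x0 e"
    then have "(x, t0) \<in> Q" using e(2) by (auto simp: dist_Pair_Pair)
    then show "x \<in> D" using proj by (simp add: D_def)
  qed
  then show ?thesis using e(1) by (metis mem_interior_cball empty_iff)
qed

lemma double_compact: "compact K" "K \<noteq> {}"
proof -
  have "compact (flip ` Q)" unfolding flip_def using Q(1) by (intro compact_continuous_image continuous_intros)
  then show "compact K" unfolding K_def using Q(1) by (rule compact_Un[rotated])
  show "K \<noteq> {}" using Q(3) interior_subset by (fastforce simp: K_def)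
qed

lemma double_flip: "flip ` K = K"
  unfolding K_def by (simp add: image_Un image_image Un_commute)

lemma double_projection: "X \<in> K \<Longrightarrow> fst X \<in> D"
  unfolding K_def D_def flip_def using proj by (auto; metis prod.collapse)

text \<open>
  The double contains a horizontal ball about \<open>z\<close> and a vertical segment centred at \<open>z\<close>, so the support
  function about \<open>z\<close> grows linearly in all directions.
\<close>

lemma double_coercive:
  assumes z: "z \<in> interior D"
  shows "\<exists>c>0. \<forall>y. c * norm y \<le> sup_inner K y - y \<bullet> (z, 0)"
proof -
  obtain r where r: "0 < r" "cball z r \<subseteq> D" using z by (auto simp: mem_interior_cball)
  obtain x0 t0 where x0: "(x0, t0) \<in> Q" "0 < t0" using interior_point_above interior_subset by blast
  have "\<exists>t1>0. (z, t1) \<in> Q"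
  proof -
    define s where "s = r / (norm (x0 - z) + 1)"
    have nv: "0 < norm (x0 - z) + 1" using norm_ge_zero[of "x0 - z"] by linarith
    have s: "0 < s" using r(1) nv by (simp add: s_def)
    have "s * norm (x0 - z) \<le> s * (norm (x0 - z) + 1)" using s by simp
    also have "\<dots> = r" using nv by (simp add: s_def)
    finally have "z - s *\<^sub>R (x0 - z) \<in> cball z r" using s by (simp add: dist_norm)
    then have "z - s *\<^sub>R (x0 - z) \<in> D" using r(2) by blast
    then have d: "(z - s *\<^sub>R (x0 - z), 0) \<in> Q" by (simp only: D_def mem_Collect_eq)
    have "(1 / (1 + s)) *\<^sub>R (z - s *\<^sub>R (x0 - z), 0) + (s / (1 + s)) *\<^sub>R (x0, t0) \<in> Q"
      using s by (intro convexD[OF Q(2) d x0(1)]) (simp_all add: add_divide_distrib[symmetric])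
    also have "(1 / (1 + s)) *\<^sub>R (z - s *\<^sub>R (x0 - z), 0) + (s / (1 + s)) *\<^sub>R (x0, t0) = (z, s / (1 + s) * t0)"
    proof -
      have "(1 / (1 + s)) *\<^sub>R (z - s *\<^sub>R (x0 - z)) + (s / (1 + s)) *\<^sub>R x0 = (1 / (1 + s)) *\<^sub>R ((1 + s) *\<^sub>R z)"
        by (simp add: algebra_simps divide_inverse)
      also have "\<dots> = z" using s by simp
      finally show ?thesis by simp
    qed
    finally show ?thesis using s x0(2) by (intro exI[of _ "s / (1 + s) * t0"]) simp
  qed
  then obtain t1 where t1: "0 < t1" "(z, t1) \<in> Q" by blast
  define c where "c = min r t1 / 2"
  have "c * norm y \<le> sup_inner K y - y \<bullet> (z, 0)" for y
  proof -
    let ?h = "sup_inner K y - y \<bullet> (z, 0)"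
    have ge: "y \<bullet> X - y \<bullet> (z, 0) \<le> ?h" if "X \<in> K" for X
      using sup_inner_ge[OF double_compact(1) that, of y] by simp
    have h1: "r * norm (fst y) \<le> ?h"
    proof -
      define d where "d = (if fst y = 0 then 0 else (r / norm (fst y)) *\<^sub>R fst y)"
      have "z + d \<in> cball z r" using r(1) by (auto simp: d_def dist_norm)
      then have "(z + d, 0) \<in> K" using r(2) by (auto simp: K_def D_def)
      from ge[OF this] have "fst y \<bullet> d \<le> ?h" by (simp add: inner_prod_def inner_add_right)
      moreover have "fst y \<bullet> d = r * norm (fst y)"
        by (simp add: d_def power2_norm_eq_inner[symmetric] power2_eq_square)
      ultimately show ?thesis by simp
    qed
    have h2: "t1 * \<bar>snd y\<bar> \<le> ?h"
    proof -
      have "(z, t1) \<in> K" "(z, - t1) \<in> K" using t1(2) by (force simp: K_def flip_def)+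
      from ge[OF this(1)] ge[OF this(2)] have "t1 * snd y \<le> ?h" "- (t1 * snd y) \<le> ?h"
        by (simp_all add: inner_prod_def mult.commute)
      then show ?thesis using t1(1) by (simp add: abs_if)
    qed
    have "norm y \<le> norm (fst y) + \<bar>snd y\<bar>" using norm_Pair_le[of "fst y" "snd y"] by simp
    then have "c * norm y \<le> c * (norm (fst y) + \<bar>snd y\<bar>)"
      using r(1) t1(1) by (intro mult_left_mono) (auto simp: c_def)
    also have "\<dots> \<le> (r * norm (fst y) + t1 * \<bar>snd y\<bar>) / 2"
      using mult_right_mono[of "min r t1" r "norm (fst y)"] mult_right_mono[of "min r t1" t1 "\<bar>snd y\<bar>"]
      by (simp add: c_def distrib_left)
    also have "\<dots> \<le> ?h" using h1 h2 by simp
    finally show ?thesis .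
  qed
  moreover have "0 < c" using r(1) t1(1) by (simp add: c_def)
  ultimately show ?thesis by blast
qed

text \<open>
  A line that separates \<open>z\<close> from the base also separates it from the double, because the double projects
  into the base. In the direction of its normal the weight stays bounded below along a tube.
\<close>

lemma exp_weight_infinite:
  assumes z: "z \<notin> interior D"
  shows "(\<integral>\<^sup>+y. ennreal (exp (- (sup_inner K y - y \<bullet> (z, 0)))) \<partial>lborel) = \<top>"
proof -
  have "\<exists>a b. a \<noteq> 0 \<and> (\<forall>x\<in>interior D. a \<bullet> x \<le> b) \<and> (\<forall>x\<in>{z}. b \<le> a \<bullet> x)"
    using base_interior_nonempty z base_convex by (intro separating_hyperplane_sets convex_interior) auto
  then obtain a0 b where a0: "a0 \<noteq> 0" "\<And>x. x \<in> interior D \<Longrightarrow> a0 \<bullet> x \<le> b" "b \<le> a0 \<bullet> z" by auto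
  have "closed {x. a0 \<bullet> x \<le> b}" by (rule closed_halfspace_le)
  then have "closure (interior D) \<subseteq> {x. a0 \<bullet> x \<le> b}" using a0(2) by (intro closure_minimal) auto
  then have aD: "a0 \<bullet> x \<le> a0 \<bullet> z" if "x \<in> D" for x
    using that a0(3) convex_closure_interior[OF base_convex base_interior_nonempty] closure_subset[of D] by force
  define a :: "'n space" where "a = ((1 / norm a0) *\<^sub>R a0, 0)"
  have na: "norm a = 1" using a0(1) by (simp add: a_def norm_Pair)
  have aK: "a \<bullet> (X - (z, 0)) \<le> 0" if "X \<in> K" for X
  proof -
    have "a \<bullet> (X - (z, 0)) = (1 / norm a0) * (a0 \<bullet> fst X - a0 \<bullet> z)"
      by (simp add: a_def inner_prod_def inner_diff_right diff_divide_distrib)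
    also have "\<dots> \<le> 0" using aD[OF double_projection[OF that]] a0(1) by (simp add: divide_le_0_iff)
    finally show ?thesis .
  qed
  obtain B where B: "\<And>X. X \<in> K \<Longrightarrow> norm (X - (z, 0)) \<le> B"
  proof -
    have "bounded ((\<lambda>X. X - (z, 0)) ` K)"
      by (intro compact_imp_bounded compact_continuous_image double_compact continuous_intros)
    then show thesis using that unfolding bounded_iff by auto
  qed
  have [measurable]: "sup_inner K \<in> borel_measurable borel" by (rule sup_inner_measurable[OF double_compact])
  show ?thesis
  proof (rule nn_integral_top_if_tube[OF _ na])
    show "0 < exp (- B)" by simp
    fix k y assume y: "y \<in> ball ((3 * real k) *\<^sub>R a) 1"
    have "sup_inner K y \<le> B + y \<bullet> (z, 0)"
      unfolding sup_inner_le_iff[OF double_compact]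
    proof
      fix X assume X: "X \<in> K"
      define b where "b = y - (3 * real k) *\<^sub>R a"
      have nb: "norm b \<le> 1" using y by (simp add: b_def dist_norm norm_minus_commute)
      have "y \<bullet> (X - (z, 0)) = (3 * real k) * (a \<bullet> (X - (z, 0))) + b \<bullet> (X - (z, 0))"
        by (simp add: b_def inner_diff_left)
      moreover have "(3 * real k) * (a \<bullet> (X - (z, 0))) \<le> 0" using aK[OF X] by (intro mult_nonneg_nonpos) auto
      moreover have "b \<bullet> (X - (z, 0)) \<le> norm b * norm (X - (z, 0))" by (rule norm_cauchy_schwarz)
      moreover have "norm b * norm (X - (z, 0)) \<le> 1 * B" using nb B[OF X] by (intro mult_mono) auto
      ultimately have "y \<bullet> (X - (z, 0)) \<le> B" by linarith
      then show "y \<bullet> X \<le> B + y \<bullet> (z, 0)" by (simp add: inner_diff_right)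
    qed
    then show "ennreal (exp (- B)) \<le> ennreal (exp (- (sup_inner K y - y \<bullet> (z, 0))))" by (intro ennreal_leI) simp
  qed measurable
qed

lemma sup_inner_flip: "sup_inner K (flip y) = sup_inner K y"
proof -
  have "(\<lambda>X. flip y \<bullet> X) ` K = (\<lambda>X. y \<bullet> X) ` (flip ` K)" by (simp add: image_image inner_flip)
  then show ?thesis unfolding sup_inner_def double_flip by simp
qed

text \<open>
  The minimiser of the weight integral over the base is interior. It makes the horizontal first moments
  of the polar vanish, and the vertical one vanishes by symmetry.
\<close>

theorem double_santalo:
  "\<exists>z\<in>interior D. emeasure lborel Q * emeasure lborel (polar_at K (z, 0)) \<le> 1 / 2 * (emeasure lborel (ball (0 :: 'n space) 1))\<^sup>2"
proof -
  let ?H = "sup_inner K"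
  define \<Phi> where "\<Phi> z = (\<integral>\<^sup>+y. ennreal (exp (- (?H y - y \<bullet> (z, 0)))) \<partial>lborel)" for z
  have [measurable]: "?H \<in> borel_measurable borel" by (rule sup_inner_measurable[OF double_compact])
  have fin: "\<Phi> z < \<top>" if "z \<in> interior D" for z
    using double_coercive[OF that] exp_weight_finite[OF double_compact] unfolding \<Phi>_def by blast
  obtain z1 where z1: "z1 \<in> interior D" using base_interior_nonempty by blast
  obtain z where z: "z \<in> D" "\<And>z'. z' \<in> D \<Longrightarrow> \<Phi> z \<le> \<Phi> z'"
    unfolding \<Phi>_def
  proof (rule exp_weight_minimiser[of ?H D "\<lambda>z. (z, 0)" z1])
    show "continuous_on D (\<lambda>z. (z, 0 :: real))" by (intro continuous_intros)
    show "(\<integral>\<^sup>+y. ennreal (exp (- (?H y - y \<bullet> (z1, 0)))) \<partial>lborel) < \<top>" using fin[OF z1] by (simp add: \<Phi>_def)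
  qed (use base_compact z1 interior_subset in auto)
  have zi: "z \<in> interior D"
  proof (rule ccontr)
    assume "z \<notin> interior D"
    then have "\<Phi> z = \<top>" unfolding \<Phi>_def by (rule exp_weight_infinite)
    moreover have "z1 \<in> D" using z1 interior_subset by blast
    ultimately show False using z(2)[of z1] fin[OF z1] by simp
  qed
  obtain c where c: "0 < c" "\<And>y. c * norm y \<le> ?H y - y \<bullet> (z, 0)" using double_coercive[OF zi] by blast
  have nn: "0 \<le> ?H y - y \<bullet> (z, 0)" for y
    using c(2)[of y] mult_nonneg_nonneg[OF less_imp_le[OF c(1)] norm_ge_zero[of y]] by linarith
  define w where "w y = exp (- (?H y - y \<bullet> (z, 0)))" for y
  have wm [measurable]: "w \<in> borel_measurable borel" unfolding w_def by measurable
  let ?P = "polar_at K (z, 0)"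
  have moment: "(\<integral>\<^sup>+y. ennreal ((y \<bullet> b) * w y) \<partial>lborel) = (\<integral>\<^sup>+y. ennreal (- ((y \<bullet> b) * w y)) \<partial>lborel)"
    if b: "b \<in> Basis" for b :: "'n space"
  proof -
    consider v where "b = (v, 0)" "v \<in> Basis" | "b = (0, 1)" using b by (auto simp: Basis_prod_def)
    then show ?thesis
    proof cases
      case 1
      obtain r where r: "0 < r" "cball z r \<subseteq> interior D"
        using zi open_interior open_contains_cball by blast
      have zt: "z + t *\<^sub>R v \<in> interior D" if "\<bar>t\<bar> \<le> r" for t
        using r(2) that 1(2) by (auto simp: dist_norm)
      have eq: "(\<integral>\<^sup>+y. ennreal (w y * exp (t * (y \<bullet> b))) \<partial>lborel) = \<Phi> (z + t *\<^sub>R v)" for t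
        unfolding \<Phi>_def w_def 1(1)
        by (intro nn_integral_cong arg_cong[where f=ennreal]) (simp add: exp_add[symmetric] inner_prod_def inner_add_right algebra_simps)
      have w0: "(\<integral>\<^sup>+y. ennreal (w y) \<partial>lborel) = \<Phi> z" by (simp add: \<Phi>_def w_def)
      show ?thesis
      proof (rule stationary_moment[OF wm _ _ r(1)])
        show "(\<integral>\<^sup>+y. ennreal (w y * exp (t * (y \<bullet> b))) \<partial>lborel) < \<top>" if "\<bar>t\<bar> \<le> r" for t
          unfolding eq by (rule fin[OF zt[OF that]])
        show "(\<integral>\<^sup>+y. ennreal (w y) \<partial>lborel) \<le> (\<integral>\<^sup>+y. ennreal (w y * exp (t * (y \<bullet> b))) \<partial>lborel)" if "\<bar>t\<bar> \<le> r" for t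
          unfolding eq w0 using z(2) zt[OF that] interior_subset by blast
      qed (auto simp: w_def)
    next
      case 2
      have "w (flip y) = w y" for y
        unfolding w_def sup_inner_flip by (simp add: inner_flip) (simp add: flip_def)
      moreover have "flip y \<bullet> b = - (y \<bullet> b)" for y by (simp add: 2 flip_def inner_prod_def)
      ultimately show ?thesis
        using nn_integral_flip[of "\<lambda>y. ennreal ((y \<bullet> b) * w y)"] by simp
    qed
  qed
  have bar: "(\<integral>\<^sup>+y. ennreal (y \<bullet> b) * indicator ?P y \<partial>lborel) = (\<integral>\<^sup>+y. ennreal (- (y \<bullet> b)) * indicator ?P y \<partial>lborel)"
    if b: "b \<in> Basis" for b :: "'n space"
  proof -
    have s: "(\<integral>\<^sup>+y. ennreal (s * (y \<bullet> b) * w y) \<partial>lborel) = (\<integral>\<^sup>+y. ennreal (s * (y \<bullet> b)) * indicator ?P y \<partial>lborel) * ennreal (fact (DIM('n space) + 1))" for s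
    proof -
      have "(\<integral>\<^sup>+y. ennreal (s * (y \<bullet> b) * w y) \<partial>lborel) = (\<integral>\<^sup>+y. ennreal (s * (y \<bullet> b)) * ennreal (exp (- (?H y - y \<bullet> (z, 0)))) \<partial>lborel)"
        by (intro nn_integral_cong) (simp add: w_def ennreal_mult'')
      also have "\<dots> = (\<integral>\<^sup>+y. ennreal (s * (y \<bullet> b)) * indicator ?P y \<partial>lborel) * ennreal (fact (DIM('n space) + 1))"
        by (rule nn_integral_exp_weight[OF double_compact nn]) (auto simp: ennreal_mult'[symmetric] ac_simps)
      finally show ?thesis .
    qed
    have "(\<integral>\<^sup>+y. ennreal (y \<bullet> b) * indicator ?P y \<partial>lborel) * ennreal (fact (DIM('n space) + 1))
        = (\<integral>\<^sup>+y. ennreal (- (y \<bullet> b)) * indicator ?P y \<partial>lborel) * ennreal (fact (DIM('n space) + 1))"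
      using moment[OF b] s[of 1] s[of "-1"] by simp
    moreover have "x = y" if "x * ennreal F = y * ennreal F" "0 < F" for x y F
      using that ennreal_mult_cancel_left[of "ennreal F" x y] by (auto simp: mult.commute)
    ultimately show ?thesis using fact_gt_zero by blast
  qed
  define K' where "K' = (\<lambda>X. X - (z, 0)) ` K"
  have K'c: "compact K'" unfolding K'_def by (intro compact_continuous_image double_compact continuous_intros)
  have "emeasure lborel K' * emeasure lborel ?P \<le> (emeasure lborel (ball (0 :: 'n space) 1))\<^sup>2"
  proof (rule blaschke_santalo_centred)
    show "?P \<in> sets borel" by (intro borel_closed closed_polar_at)
    show "K' \<in> sets borel" by (intro borel_compact K'c)
    show "bounded ?P" by (rule bounded_polar_at[OF double_compact c])
    show "bounded K'" by (rule compact_imp_bounded[OF K'c])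
    show "x \<bullet> y \<le> 1" if "x \<in> K'" "y \<in> ?P" for x y
      using that by (auto simp: K'_def polar_at_def inner_commute)
  qed (use bar in blast)
  moreover have "emeasure lborel K' = emeasure lborel K"
  proof -
    have e: "K' = (\<lambda>X. X + - (z, 0)) ` K" unfolding K'_def by (simp only: diff_conv_add_uminus)
    show ?thesis unfolding e by (rule emeasure_translate(2)[OF compact_imp_closed[OF double_compact(1)]])
  qed
  ultimately have main: "emeasure lborel K * emeasure lborel ?P \<le> (emeasure lborel (ball (0 :: 'n space) 1))\<^sup>2" by simp
  have "2 * emeasure lborel Q \<le> emeasure lborel K"
    unfolding K_def by (rule emeasure_doubled[OF borel_compact[OF Q(1)] Q(4)])
  then have "(2 * emeasure lborel Q) * emeasure lborel ?P \<le> (emeasure lborel (ball (0 :: 'n space) 1))\<^sup>2"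
    using main by (meson mult_right_mono order_trans zero_le)
  then have "(1 / 2) * ((2 * emeasure lborel Q) * emeasure lborel ?P) \<le> (1 / 2) * (emeasure lborel (ball (0 :: 'n space) 1))\<^sup>2"
    by (rule mult_left_mono) simp
  moreover have "(1 / 2) * ((2 * emeasure lborel Q) * emeasure lborel ?P) = emeasure lborel Q * emeasure lborel ?P"
  proof -
    have "(1 / 2 :: ennreal) = ennreal (1 / 2)" using divide_ennreal[of 1 2] by simp
    moreover have "ennreal (1 / 2) * ennreal 2 = 1" by (subst ennreal_mult[symmetric]) simp_all
    ultimately have "(1 / 2) * 2 = (1 :: ennreal)" by simp
    then show ?thesis by (metis mult.assoc mult_1)
  qed
  ultimately show ?thesis using zi by auto
qed

end

section \<open>Charts, normals and sides of a hypersurface\<close>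

lemma diffeo_onE:
  assumes "diffeo_on U V \<phi>"
  obtains \<psi> where "open U" "open V" "homeomorphism U V \<phi> \<psi>"
    "\<And>x. x \<in> U \<Longrightarrow> (\<phi> has_derivative frechet_derivative \<phi> (at x)) (at x)"
    "\<And>y. y \<in> V \<Longrightarrow> (\<psi> has_derivative frechet_derivative \<psi> (at y)) (at y)"
    "\<And>v. continuous_on U (\<lambda>x. frechet_derivative \<phi> (at x) v)"
proof -
  obtain \<psi> where *: "open U" "open V" "homeomorphism U V \<phi> \<psi>" "smooth_on U \<phi>" "smooth_on V \<psi>"
    using assms unfolding diffeo_on_def by blast
  have "Ck_on 1 \<phi> U" "Ck_on 1 \<psi> V" using *(4,5) unfolding smooth_on_def by blast+
  then show thesis
    using * by (intro that[of \<psi>]) (auto simp: frechet_derivative_works[symmetric])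
qed

lemma derivative_inverse:
  assumes "open U" "p \<in> U" "\<And>x. x \<in> U \<Longrightarrow> \<psi> (\<phi> x) = x"
    and "(\<phi> has_derivative D) (at p)" "(\<psi> has_derivative D') (at (\<phi> p))"
  shows "D' (D v) = v"
proof -
  have "((\<lambda>x. \<psi> (\<phi> x)) has_derivative (\<lambda>v. D' (D v))) (at p)"
    by (rule has_derivative_compose[OF assms(4,5)])
  then have "((\<lambda>x. x) has_derivative (\<lambda>v. D' (D v))) (at p)"
    by (rule has_derivative_transform_within_open[OF _ assms(1,2)]) (use assms(3) in auto)
  from has_derivative_unique[OF this has_derivative_ident] show ?thesis
    by (metis)
qed

text \<open>
  The initial velocities of which \<open>tangent_space\<close> is the span; one-sided information on them, such as an
  extremality, is lost in the span.
\<close>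

definition velocity :: "'n::finite space set \<Rightarrow> 'n space \<Rightarrow> 'n space \<Rightarrow> bool" where
  "velocity S p v \<longleftrightarrow> (\<exists>\<gamma> :: real \<Rightarrow> 'n space.
     \<gamma> 0 = p \<and> \<gamma> ` {0..1} \<subseteq> S \<and> (\<gamma> has_vector_derivative v) (at 0 within {0..1}))"

lemma velocity_in_tangent_space: "velocity S p v \<Longrightarrow> v \<in> tangent_space S p"
  unfolding velocity_def tangent_space_def by (rule span_base) blast

lemma chart_velocity:
  fixes S :: "'n::finite space set"
  assumes hom: "homeomorphism U V \<phi> \<psi>" and p: "p \<in> U"
    and der: "(\<psi> has_derivative D') (at (\<phi> p))"
    and A: "\<phi> ` (S \<inter> U) = A"
    and w: "\<And>t. 0 \<le> t \<Longrightarrow> t \<le> 1 \<Longrightarrow> \<phi> p + (t * \<epsilon>) *\<^sub>R w \<in> A"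
  shows "velocity S p (\<epsilon> *\<^sub>R D' w)"
proof -
  let ?\<gamma> = "\<lambda>t::real. \<psi> (\<phi> p + (t * \<epsilon>) *\<^sub>R w)"
  have inv: "\<psi> (\<phi> x) = x" if "x \<in> U" for x using hom that by (simp add: homeomorphism_def)
  have 1: "?\<gamma> 0 = p" using inv[OF p] by simp
  have 2: "?\<gamma> ` {0..1} \<subseteq> S"
  proof (rule image_subsetI)
    fix t :: real assume "t \<in> {0..1}"
    then have "\<phi> p + (t * \<epsilon>) *\<^sub>R w \<in> \<phi> ` (S \<inter> U)" using w A by auto
    then obtain x where x: "x \<in> S" "x \<in> U" "\<phi> p + (t * \<epsilon>) *\<^sub>R w = \<phi> x" by blast
    then show "?\<gamma> t \<in> S" using inv[OF x(2)] by simp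
  qed
  have lin: "linear D'" using der by (rule has_derivative_linear)
  have a: "((\<lambda>t. \<phi> p + (t * \<epsilon>) *\<^sub>R w) has_derivative (\<lambda>t. (t * \<epsilon>) *\<^sub>R w)) (at 0 within {0..1})"
    by (auto intro!: derivative_eq_intros)
  have "(?\<gamma> has_derivative (\<lambda>t. D' ((t * \<epsilon>) *\<^sub>R w))) (at 0 within {0..1})"
    by (rule has_derivative_compose[OF a]) (use der in simp)
  moreover have "(\<lambda>t. D' ((t * \<epsilon>) *\<^sub>R w)) = (\<lambda>t. t *\<^sub>R (\<epsilon> *\<^sub>R D' w))"
    by (simp add: linear_scale[OF lin])
  ultimately have "(?\<gamma> has_vector_derivative \<epsilon> *\<^sub>R D' w) (at 0 within {0..1})"
    unfolding has_vector_derivative_def by simp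
  with 1 2 show ?thesis unfolding velocity_def by (intro exI[of _ ?\<gamma>]) blast
qed

lemma open_segment_steps:
  fixes y w :: "'a::real_normed_vector"
  assumes "open V" "y \<in> V"
  obtains \<epsilon> where "\<epsilon> > 0" "\<And>t. \<bar>t\<bar> \<le> \<epsilon> \<Longrightarrow> y + t *\<^sub>R w \<in> V"
proof -
  obtain r where r: "r > 0" "ball y r \<subseteq> V" using assms open_contains_ball by blast
  define \<epsilon> where "\<epsilon> = r / (2 * (norm w + 1))"
  have pos: "norm w + 1 > 0" using norm_ge_zero[of w] by linarith
  show thesis
  proof (rule that[of \<epsilon>])
    show "\<epsilon> > 0" using r pos by (simp add: \<epsilon>_def)
    fix t :: real assume t: "\<bar>t\<bar> \<le> \<epsilon>"
    have "norm (t *\<^sub>R w) \<le> \<epsilon> * (norm w + 1)" using t by (auto intro!: mult_mono)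
    also have "\<epsilon> * (norm w + 1) = r / 2"
    proof -
      have "r / (2 * m) * m = r / 2" if "m > 0" for m :: real using that by simp
      from this[OF pos] show ?thesis by (simp only: \<epsilon>_def)
    qed
    also have "\<dots> < r" using r by simp
    finally show "y + t *\<^sub>R w \<in> V" using r(2) by (auto simp: dist_norm)
  qed
qed

lemma interior_velocities:
  fixes S :: "'n::finite space set"
  assumes "p \<in> surface_interior S"
  obtains D' :: "'n space \<Rightarrow> 'n space" where "linear D'" "surj D'"
    "\<And>w. snd w = 0 \<Longrightarrow> \<exists>\<epsilon>>0. velocity S p (\<epsilon> *\<^sub>R D' w)"
proof -
  obtain U V and \<phi> :: "'n space \<Rightarrow> 'n space" where
    d: "diffeo_on U V \<phi>" and p: "p \<in> U" "p \<in> S" and A: "\<phi> ` (S \<inter> U) = {y \<in> V. snd y = 0}"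
    using assms unfolding surface_interior_def by blast
  obtain \<psi> where \<psi>: "open U" "open V" "homeomorphism U V \<phi> \<psi>"
    "\<And>x. x \<in> U \<Longrightarrow> (\<phi> has_derivative frechet_derivative \<phi> (at x)) (at x)"
    "\<And>y. y \<in> V \<Longrightarrow> (\<psi> has_derivative frechet_derivative \<psi> (at y)) (at y)"
    using diffeo_onE[OF d] by metis
  have pV: "\<phi> p \<in> V" using \<psi>(3) p(1) by (auto simp: homeomorphism_def)
  define D' where "D' = frechet_derivative \<psi> (at (\<phi> p))"
  have der: "(\<psi> has_derivative D') (at (\<phi> p))" unfolding D'_def by (rule \<psi>(5)[OF pV])
  have "D' (frechet_derivative \<phi> (at p) v) = v" for v
    by (rule derivative_inverse[OF \<psi>(1) p(1) _ \<psi>(4)[OF p(1)] der]) (use \<psi>(3) in \<open>auto simp: homeomorphism_def\<close>)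
  then have "surj D'" by (metis surjI)
  moreover have "\<exists>\<epsilon>>0. velocity S p (\<epsilon> *\<^sub>R D' w)" if w: "snd w = 0" for w
  proof -
    obtain \<epsilon> where e: "\<epsilon> > 0" "\<And>t. \<bar>t\<bar> \<le> \<epsilon> \<Longrightarrow> \<phi> p + t *\<^sub>R w \<in> V"
      using open_segment_steps[OF \<psi>(2) pV] by blast
    have s0: "snd (\<phi> p) = 0" using A p by blast
    have "velocity S p (\<epsilon> *\<^sub>R D' w)"
      by (rule chart_velocity[OF \<psi>(3) p(1) der A]) (use e w s0 mult_left_le_one_le[of \<epsilon>] in \<open>auto simp: abs_mult\<close>)
    then show ?thesis using e(1) by blast
  qed
  ultimately show thesis using that has_derivative_linear[OF der] by blast
qed

text \<open>
  At a boundary point only half of the directions in the slice are velocities, but their span is the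
  whole image of the slice.
\<close>

lemma tangent_chart:
  fixes S :: "'n::finite space set"
  assumes "p \<in> surface_interior S \<union> surface_boundary S"
  obtains D' :: "'n space \<Rightarrow> 'n space" where "linear D'" "surj D'" "\<And>w. snd w = 0 \<Longrightarrow> D' w \<in> tangent_space S p"
proof -
  have sub: "subspace (tangent_space S p)" unfolding tangent_space_def by (rule subspace_span)
  from assms consider "p \<in> surface_interior S" | "p \<in> surface_boundary S" by blast
  then show thesis
  proof cases
    case 1
    obtain D' :: "'n space \<Rightarrow> 'n space" where D': "linear D'" "surj D'"
      "\<And>w. snd w = 0 \<Longrightarrow> \<exists>\<epsilon>>0. velocity S p (\<epsilon> *\<^sub>R D' w)"
      using interior_velocities[OF 1] by blast
    have "D' w \<in> tangent_space S p" if w: "snd w = 0" for w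
    proof -
      obtain \<epsilon> where e: "\<epsilon> > 0" "velocity S p (\<epsilon> *\<^sub>R D' w)" using D'(3)[OF w] by blast
      then have "(1 / \<epsilon>) *\<^sub>R (\<epsilon> *\<^sub>R D' w) \<in> tangent_space S p"
        using subspace_scale[OF sub] velocity_in_tangent_space by blast
      then show ?thesis using e(1) by simp
    qed
    then show thesis using that D' by blast
  next
    case 2
    then obtain U V and \<phi> :: "'n space \<Rightarrow> 'n space" and i where
      d: "diffeo_on U V \<phi>" and p: "p \<in> U" "p \<in> S" and i: "fst (\<phi> p) $ i = 0"
      and A: "\<phi> ` (S \<inter> U) = {y \<in> V. snd y = 0 \<and> fst y $ i \<ge> 0}"
      unfolding surface_boundary_def by blast
    obtain \<psi> where \<psi>: "open U" "open V" "homeomorphism U V \<phi> \<psi>"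
      "\<And>x. x \<in> U \<Longrightarrow> (\<phi> has_derivative frechet_derivative \<phi> (at x)) (at x)"
      "\<And>y. y \<in> V \<Longrightarrow> (\<psi> has_derivative frechet_derivative \<psi> (at y)) (at y)"
      using diffeo_onE[OF d] by metis
    have pV: "\<phi> p \<in> V" using \<psi>(3) p(1) by (auto simp: homeomorphism_def)
    define D' where "D' = frechet_derivative \<psi> (at (\<phi> p))"
    have der: "(\<psi> has_derivative D') (at (\<phi> p))" unfolding D'_def by (rule \<psi>(5)[OF pV])
    have "D' (frechet_derivative \<phi> (at p) v) = v" for v
      by (rule derivative_inverse[OF \<psi>(1) p(1) _ \<psi>(4)[OF p(1)] der]) (use \<psi>(3) in \<open>auto simp: homeomorphism_def\<close>)
    then have "surj D'" by (metis surjI)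
    moreover have half: "D' w \<in> tangent_space S p" if w: "snd w = 0" "fst w $ i \<ge> 0" for w
    proof -
      obtain \<epsilon> where e: "\<epsilon> > 0" "\<And>t. \<bar>t\<bar> \<le> \<epsilon> \<Longrightarrow> \<phi> p + t *\<^sub>R w \<in> V"
        using open_segment_steps[OF \<psi>(2) pV] by blast
      have s0: "snd (\<phi> p) = 0" using A p by blast
      have "velocity S p (\<epsilon> *\<^sub>R D' w)"
        by (rule chart_velocity[OF \<psi>(3) p(1) der A]) (use e w s0 i mult_left_le_one_le[of \<epsilon>] in \<open>auto simp: abs_mult\<close>)
      then have "(1 / \<epsilon>) *\<^sub>R (\<epsilon> *\<^sub>R D' w) \<in> tangent_space S p"
        using subspace_scale[OF sub] velocity_in_tangent_space by blast
      then show ?thesis using e(1) by simp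
    qed
    have lin: "linear D'" by (rule has_derivative_linear[OF der])
    moreover have "D' w \<in> tangent_space S p" if w: "snd w = 0" for w
    proof (cases "fst w $ i \<ge> 0")
      case False
      then have "D' (- w) \<in> tangent_space S p" using w by (intro half) auto
      then show ?thesis using subspace_neg[OF sub] linear_neg[OF lin, of w] by (metis minus_minus)
    qed (use half w in blast)
    ultimately show thesis using that by blast
  qed
qed

text \<open>
  The image of the slice has codimension one, so its orthogonal complement is a line.
\<close>

lemma parallel_normals:
  fixes D' :: "'n::finite space \<Rightarrow> 'n space"
  assumes D': "linear D'" "surj D'"
    and n: "\<And>w. snd w = 0 \<Longrightarrow> n \<bullet> D' w = 0" "norm n = 1"
    and u: "\<And>w. snd w = 0 \<Longrightarrow> u \<bullet> D' w = 0"
  shows "u = (u \<bullet> n) *\<^sub>R n"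
proof -
  define c where "c a = a \<bullet> D' (0, 1)" for a
  have dec: "a \<bullet> D' w = snd w * c a" if a: "\<And>w. snd w = 0 \<Longrightarrow> a \<bullet> D' w = 0" for a w
  proof -
    have "w = (fst w, 0) + snd w *\<^sub>R (0, 1)" by (cases w) simp
    then have "D' w = D' (fst w, 0) + snd w *\<^sub>R D' (0, 1)"
      by (metis linear_add[OF D'(1)] linear_scale[OF D'(1)])
    then show ?thesis using a[of "(fst w, 0)"] by (simp add: inner_right_distrib c_def)
  qed
  have z: "a = 0" if "\<forall>w. a \<bullet> D' w = 0" for a
    using that D'(2) by (metis inner_eq_zero_iff surjD)
  have cn: "c n \<noteq> 0"
  proof
    assume "c n = 0"
    then have "n = 0" using dec[OF n(1)] by (intro z) auto
    then show False using n(2) by simp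
  qed
  have "c n *\<^sub>R u - c u *\<^sub>R n = 0"
    by (rule z) (simp add: inner_diff_left dec[OF n(1)] dec[OF u])
  then have "(1 / c n) *\<^sub>R (c n *\<^sub>R u) = (1 / c n) *\<^sub>R (c u *\<^sub>R n)" by simp
  then have e: "u = (c u / c n) *\<^sub>R n" using cn by simp
  have "u \<bullet> n = (c u / c n) * (n \<bullet> n)" by (subst e) simp
  also have "n \<bullet> n = 1" using n(2) by (simp add: norm_eq_1)
  finally show ?thesis using e by simp
qed

lemma normal_unique:
  fixes S :: "'n::finite space set"
  assumes p: "p \<in> surface_interior S \<union> surface_boundary S"
    and n: "\<And>v. v \<in> tangent_space S p \<Longrightarrow> n \<bullet> v = 0" "norm n = 1"
    and u: "\<And>v. v \<in> tangent_space S p \<Longrightarrow> u \<bullet> v = 0"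
  shows "u = (u \<bullet> n) *\<^sub>R n"
proof -
  obtain D' :: "'n space \<Rightarrow> 'n space" where D': "linear D'" "surj D'" "\<And>w. snd w = 0 \<Longrightarrow> D' w \<in> tangent_space S p"
    using tangent_chart[OF p] by blast
  show ?thesis by (rule parallel_normals[OF D'(1,2) _ n(2)]) (use n u D'(3) in auto)
qed

lemma directional_increase:
  fixes f :: "'a::real_normed_vector \<Rightarrow> real"
  assumes "(f has_derivative f') (at q)" "f q = 0" "f' u > 0"
  shows "\<forall>\<^sub>F t in at_right 0. f (q + t *\<^sub>R u) > 0"
proof -
  have "((\<lambda>t. f (q + t *\<^sub>R u)) has_derivative (\<lambda>t. f' (t *\<^sub>R u))) (at 0)"
    by (rule has_derivative_compose[where g=f and g'=f']) (use assms(1) in \<open>auto intro!: derivative_eq_intros\<close>)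
  then have "((\<lambda>t. f (q + t *\<^sub>R u)) has_derivative (\<lambda>t. t * f' u)) (at 0)"
    using linear_scale[OF has_derivative_linear[OF assms(1)]] by simp
  then have "DERIV (\<lambda>t. f (q + t *\<^sub>R u)) 0 :> f' u"
    by (simp add: has_field_derivative_def mult_commute_abs)
  from DERIV_pos_inc_right[OF this assms(3)] obtain d where
    "d > 0" "\<And>h. h > 0 \<Longrightarrow> h < d \<Longrightarrow> f (q + 0 *\<^sub>R u) < f (q + (0 + h) *\<^sub>R u)" by auto
  then show ?thesis using assms(2) by (auto simp: eventually_at_right_field)
qed

text \<open>
  Moving from a nearest point along the surface does not decrease the distance to \<open>x\<close>.
\<close>

lemma nearest_point_normal:
  fixes S :: "'n::finite space set"
  assumes "velocity S q v" and near: "\<And>y. y \<in> S \<Longrightarrow> dist x q \<le> dist x y"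
  shows "(x - q) \<bullet> v \<le> 0"
proof (rule ccontr)
  assume pos: "\<not> (x - q) \<bullet> v \<le> 0"
  obtain \<gamma> where g: "\<gamma> 0 = q" "\<gamma> ` {0..1} \<subseteq> S" "(\<gamma> has_vector_derivative v) (at 0 within {0..1})"
    using assms(1) unfolding velocity_def by blast
  define h where "h t = (x - \<gamma> t) \<bullet> (x - \<gamma> t)" for t
  have "(h has_derivative (\<lambda>t. t * (- 2 * ((x - q) \<bullet> v)))) (at 0 within {0..1})"
    unfolding h_def using g(3)[unfolded has_vector_derivative_def]
    by (auto intro!: derivative_eq_intros simp: g(1) inner_commute algebra_simps)
  then have "(h has_real_derivative (- 2 * ((x - q) \<bullet> v))) (at 0 within {0..1})"
    unfolding has_field_derivative_def mult_commute_abs .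
  then have "((\<lambda>t. (h t - h 0) / (t - 0)) \<longlongrightarrow> - 2 * ((x - q) \<bullet> v)) (at 0 within {0..1})"
    by (simp add: has_field_derivative_iff)
  then have ev: "\<forall>\<^sub>F t in at 0 within {0..1}. (h t - h 0) / (t - 0) < 0"
    by (rule order_tendstoD) (use pos in simp)
  moreover have "\<forall>\<^sub>F t in at (0::real) within {0..1}. 0 \<le> (h t - h 0) / (t - 0)"
    unfolding eventually_at_filter
  proof (intro always_eventually allI impI)
    fix t :: real assume t: "t \<noteq> 0" "t \<in> {0..1}"
    then have "dist x q \<le> dist x (\<gamma> t)" using g(2) near by blast
    then have "h 0 \<le> h t" unfolding h_def g(1) dist_norm
      by (metis norm_ge_zero power2_norm_eq_inner power_mono)
    then show "0 \<le> (h t - h 0) / (t - 0)" using t by auto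
  qed
  ultimately have "\<forall>\<^sub>F t in at (0::real) within {0..1}. False"
    by eventually_elim simp
  moreover have "at (0::real) within {0..1} \<noteq> bot"
    by (simp add: at_within_Icc_at_right)
  ultimately show False by simp
qed

text \<open>
  Near an interior point the surface is the zero set of a chart coordinate \<open>\<kappa>\<close>, oriented so that it
  increases along the normal. If \<open>q\<close> is a nearest point to \<open>x\<close>, then \<open>x - q\<close> is normal to the surface at \<open>q\<close>
  and the segment from \<open>q\<close> to \<open>x\<close> does not meet the surface again; so the sign of \<open>\<kappa> x\<close> can be read off
  from \<open>(x - q) \<bullet> \<nu> q\<close>, an expression that does not depend on the chart.
\<close>

lemma local_sides:
  fixes S :: "'n::finite space set"
  assumes p: "p \<in> surface_interior S" and W: "open W" "p \<in> W"
    and cont: "continuous_on S \<nu>"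
    and nu: "\<And>q. q \<in> S \<Longrightarrow> norm (\<nu> q) = 1" "\<And>q v. q \<in> S \<Longrightarrow> v \<in> tangent_space S q \<Longrightarrow> \<nu> q \<bullet> v = 0"
  obtains r \<kappa> where "0 < r" "ball p r \<subseteq> W" "continuous_on (ball p r) \<kappa>"
    "\<And>x. x \<in> ball p r \<Longrightarrow> \<kappa> x = 0 \<longleftrightarrow> x \<in> S"
    "\<And>x q. x \<in> ball p r \<Longrightarrow> q \<in> ball p r \<Longrightarrow> x \<notin> S \<Longrightarrow> q \<in> S \<Longrightarrow> (\<And>y. y \<in> S \<Longrightarrow> dist x q \<le> dist x y)
       \<Longrightarrow> 0 < \<kappa> x \<longleftrightarrow> 0 < (x - q) \<bullet> \<nu> q"
    "\<forall>\<^sub>F t in at_right 0. 0 < \<kappa> (p + t *\<^sub>R \<nu> p)"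
    "\<forall>\<^sub>F t in at_right 0. \<kappa> (p - t *\<^sub>R \<nu> p) < (0::real)"
proof -
  obtain U V and \<phi> :: "'n space \<Rightarrow> 'n space" where
    d: "diffeo_on U V \<phi>" and pU: "p \<in> U" and pS: "p \<in> S" and A: "\<phi> ` (S \<inter> U) = {y \<in> V. snd y = 0}"
    using p unfolding surface_interior_def by blast
  obtain \<psi> where \<psi>: "open U" "open V" "homeomorphism U V \<phi> \<psi>"
    "\<And>x. x \<in> U \<Longrightarrow> (\<phi> has_derivative frechet_derivative \<phi> (at x)) (at x)"
    "\<And>y. y \<in> V \<Longrightarrow> (\<psi> has_derivative frechet_derivative \<psi> (at y)) (at y)"
    "\<And>v. continuous_on U (\<lambda>x. frechet_derivative \<phi> (at x) v)"
    using diffeo_onE[OF d] by metis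
  have inv: "\<psi> (\<phi> x) = x" "\<phi> x \<in> V" if "x \<in> U" for x
    using \<psi>(3) that by (auto simp: homeomorphism_def)
  have onS: "snd (\<phi> x) = 0 \<longleftrightarrow> x \<in> S" if "x \<in> U" for x
  proof
    assume "snd (\<phi> x) = 0"
    then have "\<phi> x \<in> \<phi> ` (S \<inter> U)" using A inv(2)[OF that] by auto
    then obtain y where "y \<in> S" "y \<in> U" "\<phi> x = \<phi> y" by blast
    then show "x \<in> S" using inv(1) that by metis
  next
    assume "x \<in> S" then show "snd (\<phi> x) = 0" using A that by blast
  qed
  define D where "D q = frechet_derivative \<phi> (at q)" for q
  define D' where "D' q = frechet_derivative \<psi> (at (\<phi> q))" for q
  have D: "(\<phi> has_derivative D q) (at q)" "(\<psi> has_derivative D' q) (at (\<phi> q))" "D' q (D q v) = v" if "q \<in> U" for q v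
  proof -
    show 1: "(\<phi> has_derivative D q) (at q)" unfolding D_def by (rule \<psi>(4)[OF that])
    show 2: "(\<psi> has_derivative D' q) (at (\<phi> q))" unfolding D'_def by (rule \<psi>(5)[OF inv(2)[OF that]])
    show "D' q (D q v) = v" by (rule derivative_inverse[OF \<psi>(1) that _ 1 2]) (use inv in auto)
  qed
  have vel: "\<exists>\<epsilon>>0. velocity S q (\<epsilon> *\<^sub>R D' q w)" if q: "q \<in> U" "q \<in> S" and w: "snd w = 0" for q w
  proof -
    obtain \<epsilon> where e: "\<epsilon> > 0" "\<And>t. \<bar>t\<bar> \<le> \<epsilon> \<Longrightarrow> \<phi> q + t *\<^sub>R w \<in> V"
      using open_segment_steps[OF \<psi>(2) inv(2)[OF q(1)]] by blast
    have "velocity S q (\<epsilon> *\<^sub>R D' q w)"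
      by (rule chart_velocity[OF \<psi>(3) q(1) D(2)[OF q(1)] A]) (use e w onS q mult_left_le_one_le[of \<epsilon>] in \<open>auto simp: abs_mult\<close>)
    then show ?thesis using e(1) by blast
  qed
  have dnz: "snd (D q (\<nu> q)) \<noteq> 0" if q: "q \<in> U" "q \<in> S" for q
  proof
    assume "snd (D q (\<nu> q)) = 0"
    then obtain \<epsilon> where "\<epsilon> > 0" "velocity S q (\<epsilon> *\<^sub>R D' q (D q (\<nu> q)))" using vel[OF q] by blast
    then have "\<nu> q \<bullet> (\<epsilon> *\<^sub>R \<nu> q) = 0"
      using nu(2)[OF q(2) velocity_in_tangent_space] D(3)[OF q(1)] by metis
    then show False using \<open>\<epsilon> > 0\<close> nu(1)[OF q(2)] by auto
  qed
  define s where "s = sgn (snd (D p (\<nu> p)))"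
  have s: "s = 1 \<or> s = -1" "s * snd (D p (\<nu> p)) > 0" using dnz[OF pU pS] by (auto simp: s_def sgn_if)
  have contD: "continuous_on (S \<inter> U) (\<lambda>q. s * snd (D q (\<nu> q)))"
  proof -
    have eq: "D q (\<nu> q) = (\<Sum>b\<in>Basis. (\<nu> q \<bullet> b) *\<^sub>R D q b)" if "q \<in> S \<inter> U" for q
    proof -
      have lin: "linear (D q)" using that has_derivative_linear[OF D(1)] by auto
      have "D q (\<nu> q) = D q (\<Sum>b\<in>Basis. (\<nu> q \<bullet> b) *\<^sub>R b)" by (simp only: euclidean_representation)
      also have "\<dots> = (\<Sum>b\<in>Basis. (\<nu> q \<bullet> b) *\<^sub>R D q b)"
        by (simp only: linear_sum[OF lin] linear_scale[OF lin])
      finally show ?thesis .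
    qed
    have "continuous_on (S \<inter> U) (\<lambda>q. \<Sum>b\<in>Basis. (\<nu> q \<bullet> b) *\<^sub>R D q b)"
      unfolding D_def
      by (intro continuous_intros continuous_on_subset[OF cont] continuous_on_subset[OF \<psi>(6)]) auto
    then have "continuous_on (S \<inter> U) (\<lambda>q. D q (\<nu> q))"
      by (rule continuous_on_eq) (use eq in auto)
    then show ?thesis by (intro continuous_intros)
  qed
  have "open (U \<inter> W)" "p \<in> U \<inter> W" using \<psi>(1) W pU by (auto intro: open_Int)
  then obtain r1 where r1: "r1 > 0" "ball p r1 \<subseteq> U \<inter> W"
    by (meson open_contains_ball)
  have "\<forall>\<^sub>F q in at p within (S \<inter> U). s * snd (D q (\<nu> q)) > 0"
    using contD pS pU s(2) by (intro order_tendstoD(1)[of _ "s * snd (D p (\<nu> p))"]) (auto simp: continuous_on_def)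
  then obtain r2 where r2: "r2 > 0" "\<And>q. q \<in> S \<inter> U \<Longrightarrow> q \<noteq> p \<Longrightarrow> dist q p < r2 \<Longrightarrow> s * snd (D q (\<nu> q)) > 0"
    unfolding eventually_at by auto
  define r where "r = min r1 r2"
  have r: "r > 0" "ball p r \<subseteq> U" "ball p r \<subseteq> W" using r1 r2 by (auto simp: r_def)
  have dpos: "s * snd (D q (\<nu> q)) > 0" if "q \<in> S" "q \<in> ball p r" for q
    using that r2(2)[of q] s(2) r(2) by (cases "q = p") (auto simp: r_def dist_commute)
  define \<kappa> where "\<kappa> x = s * snd (\<phi> x)" for x
  have contk: "continuous_on (ball p r) \<kappa>"
    unfolding \<kappa>_def using \<psi>(3) r(2) continuous_on_subset
    by (intro continuous_intros) (auto simp: homeomorphism_def)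
  have k0: "\<kappa> x = 0 \<longleftrightarrow> x \<in> S" if "x \<in> ball p r" for x
    using onS[of x] that r(2) s(1) by (auto simp: \<kappa>_def)
  have kder: "(\<kappa> has_derivative (\<lambda>v. s * snd (D q v))) (at q)" if "q \<in> ball p r" for q
  proof -
    have "(\<phi> has_derivative D q) (at q)" using D(1) that r(2) by blast
    then show ?thesis unfolding \<kappa>_def by (auto intro!: derivative_eq_intros)
  qed
  have lin: "linear (D q)" if "q \<in> ball p r" for q using has_derivative_linear[OF D(1)] that r(2) by blast
  have pr: "p \<in> ball p r" using r(1) by simp
  show thesis
  proof (rule that[OF r(1,3) contk k0])
    show "\<forall>\<^sub>F t in at_right 0. 0 < \<kappa> (p + t *\<^sub>R \<nu> p)"
      by (rule directional_increase[OF kder[OF pr]]) (use k0[OF pr] pS s in auto)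
    have "\<forall>\<^sub>F t in at_right 0. 0 < - \<kappa> (p + t *\<^sub>R (- \<nu> p))"
      by (rule directional_increase[OF has_derivative_minus[OF kder[OF pr]]])
         (use k0[OF pr] pS s linear_neg[OF lin[OF pr]] in auto)
    then show "\<forall>\<^sub>F t in at_right 0. \<kappa> (p - t *\<^sub>R \<nu> p) < 0" by simp
  next
    fix x q assume x: "x \<in> ball p r" and q: "q \<in> ball p r" and xS: "x \<notin> S" and qS: "q \<in> S"
      and near: "\<And>y. y \<in> S \<Longrightarrow> dist x q \<le> dist x y"
    define u where "u = x - q"
    have qU: "q \<in> U" using q r(2) by blast
    have u0: "u \<noteq> 0" using xS qS by (auto simp: u_def)
    have "u \<bullet> D' q w = 0" if w: "snd w = 0" for w
    proof -
      have le: "u \<bullet> D' q w \<le> 0" if w: "snd w = 0" for w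
      proof -
        obtain \<epsilon> where e: "\<epsilon> > 0" "velocity S q (\<epsilon> *\<^sub>R D' q w)" using vel[OF qU qS w] by blast
        from nearest_point_normal[OF e(2) near] e(1) show ?thesis
          by (simp add: u_def mult_le_0_iff)
      qed
      have "linear (D' q)" using has_derivative_linear[OF D(2)[OF qU]] .
      then show ?thesis using le[of w] le[of "- w"] w by (simp add: linear_neg)
    qed
    then have tang: "u \<bullet> D' q w = 0" if "snd w = 0" for w using that by blast
    define k where "k = u \<bullet> \<nu> q"
    have uk: "u = k *\<^sub>R \<nu> q"
      unfolding k_def
    proof (rule parallel_normals[of "D' q"])
      show "linear (D' q)" using has_derivative_linear[OF D(2)[OF qU]] .
      show "surj (D' q)" using D(3)[OF qU] by (metis surjI)
      show "\<nu> q \<bullet> D' q w = 0" if w: "snd w = 0" for w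
      proof -
        obtain \<epsilon> where "\<epsilon> > 0" "velocity S q (\<epsilon> *\<^sub>R D' q w)" using vel[OF qU qS w] by blast
        then show ?thesis using nu(2)[OF qS velocity_in_tangent_space, of "\<epsilon> *\<^sub>R D' q w"] by simp
      qed
    qed (use tang nu(1)[OF qS] in auto)
    have k0': "k \<noteq> 0" using uk u0 by auto
    define f where "f t = \<kappa> (q + t *\<^sub>R u)" for t
    have seg: "q + t *\<^sub>R u \<in> ball p r" if "0 \<le> t" "t \<le> 1" for t
    proof -
      have "q + t *\<^sub>R u = (1 - t) *\<^sub>R q + t *\<^sub>R x" by (simp add: u_def algebra_simps)
      then show ?thesis using convexD_alt[OF convex_ball q x that] by simp
    qed
    have fnz: "f t \<noteq> 0" if t: "0 < t" "t \<le> 1" for t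
    proof
      assume "f t = 0"
      then have "q + t *\<^sub>R u \<in> S" using k0[OF seg] t by (simp add: f_def)
      then have "dist x q \<le> dist x (q + t *\<^sub>R u)" by (rule near)
      also have "x - (q + t *\<^sub>R u) = (1 - t) *\<^sub>R u" by (simp add: u_def algebra_simps)
      then have "dist x (q + t *\<^sub>R u) = (1 - t) * norm u" using t by (simp add: dist_norm)
      finally have "norm u \<le> (1 - t) * norm u" by (simp add: dist_norm u_def)
      moreover have "0 < t * norm u" using u0 t by simp
      ultimately show False by (simp add: left_diff_distrib)
    qed
    have fc: "continuous_on {0..1} f"
      unfolding f_def by (intro continuous_on_compose2[OF contk] continuous_intros) (use seg in auto)
    have f0: "f 0 = 0" using k0[OF q] qS by (simp add: f_def)
    have sign: "0 < c * f 1" if c: "c * k > 0" for c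
    proof -
      have "\<forall>\<^sub>F t in at_right 0. c * \<kappa> (q + t *\<^sub>R u) > 0"
      proof (rule directional_increase[where f="\<lambda>x. c * \<kappa> x"])
        show "((\<lambda>x. c * \<kappa> x) has_derivative (\<lambda>v. c * (s * snd (D q v)))) (at q)"
          by (rule has_derivative_mult_right[OF kder[OF q]])
        have "D q u = k *\<^sub>R D q (\<nu> q)" by (metis uk linear_scale[OF lin[OF q]])
        then have eq: "c * (s * snd (D q u)) = (c * k) * (s * snd (D q (\<nu> q)))" by simp
        show "0 < c * (s * snd (D q u))" unfolding eq by (rule mult_pos_pos[OF c dpos[OF qS q]])
      qed (use f0 in \<open>simp add: f_def\<close>)
      then obtain b where b: "b > 0" "\<And>t. 0 < t \<Longrightarrow> t < b \<Longrightarrow> c * f t > 0"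
        unfolding eventually_at_right_field f_def by auto
      define t0 where "t0 = min (b/2) 1"
      have t0: "0 < t0" "t0 \<le> 1" "t0 < b" using b(1) by (auto simp: t0_def)
      show ?thesis
      proof (rule ccontr)
        assume "\<not> 0 < c * f 1"
        then have "c * f 1 \<le> 0" by simp
        moreover have "0 \<le> c * f t0" using b(2)[of t0] t0 by simp
        ultimately have "\<exists>t\<ge>t0. t \<le> 1 \<and> c * f t = 0"
          using t0 continuous_on_subset[OF fc, of "{t0..1}"]
          by (intro IVT2' continuous_intros) auto
        then obtain t where t: "t0 \<le> t" "t \<le> 1" "c * f t = 0" by blast
        then show False using fnz[of t] t0 c by auto
      qed
    qed
    have "f 1 = \<kappa> x" by (simp add: f_def u_def)
    then show "0 < \<kappa> x \<longleftrightarrow> 0 < (x - q) \<bullet> \<nu> q"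
      using sign[of 1] sign[of "-1"] k0' unfolding k_def u_def by (cases "0 < (x - q) \<bullet> \<nu> q") auto
  qed
qed

section \<open>Separation of the half-space by the surface\<close>

lemma open_half_space: "open half_space"
  unfolding half_space_def by (intro open_Collect_less continuous_intros)

lemma convex_half_space: "convex (half_space :: 'n::finite space set)"
proof -
  have e: "half_space = {x :: 'n space. (0, 1) \<bullet> x > 0}" by (simp add: half_space_def inner_prod_def)
  show ?thesis unfolding e by (rule convex_halfspace_gt)
qed

lemma continuous_on_sign_mult:
  fixes g \<sigma> :: "'a::metric_space \<Rightarrow> real"
  assumes g: "continuous_on A g" and \<sigma>: "\<And>x. \<bar>\<sigma> x\<bar> \<le> 1"
    and loc: "\<And>x. x \<in> A \<Longrightarrow> g x = 0 \<or> (\<forall>\<^sub>F y in at x within A. \<sigma> y = \<sigma> x)"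
  shows "continuous_on A (\<lambda>x. \<sigma> x * g x)"
  unfolding continuous_on_def
proof
  fix x assume x: "x \<in> A"
  have gx: "(g \<longlongrightarrow> g x) (at x within A)" using g x by (auto simp: continuous_on_def)
  from loc[OF x] show "((\<lambda>x. \<sigma> x * g x) \<longlongrightarrow> \<sigma> x * g x) (at x within A)"
  proof
    assume 0: "g x = 0"
    have "((\<lambda>y. \<sigma> y * g y) \<longlongrightarrow> 0) (at x within A)"
    proof (rule Lim_null_comparison)
      show "\<forall>\<^sub>F y in at x within A. norm (\<sigma> y * g y) \<le> \<bar>g y\<bar>"
        using \<sigma> by (auto simp: abs_mult intro!: always_eventually mult_left_le_one_le)
      show "((\<lambda>y. \<bar>g y\<bar>) \<longlongrightarrow> 0) (at x within A)" using tendsto_rabs[OF gx] 0 by simp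
    qed
    then show ?thesis using 0 by simp
  next
    assume "\<forall>\<^sub>F y in at x within A. \<sigma> y = \<sigma> x"
    then have "\<forall>\<^sub>F y in at x within A. \<sigma> x * g y = \<sigma> y * g y" by eventually_elim simp
    moreover have "((\<lambda>y. \<sigma> x * g y) \<longlongrightarrow> \<sigma> x * g x) (at x within A)" by (intro tendsto_intros gx)
    ultimately show ?thesis by (rule Lim_transform_eventually[rotated])
  qed
qed

text \<open>
  Radial rescaling makes the set a continuous image of the convex set of pairs of a point of the
  half-space and a radius above \<open>R\<close>.
\<close>

lemma connected_far_half_space:
  fixes R :: real
  assumes "0 \<le> R"
  shows "connected {x \<in> (half_space :: 'n::finite space set). R < norm x}"
proof -
  let ?f = "\<lambda>(x, r). (r / norm x) *\<^sub>R x :: 'n space"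
  have nz: "x \<noteq> 0" if "x \<in> half_space" for x :: "'n space" using that by (auto simp: half_space_def)
  have "{x \<in> half_space. R < norm x} = ?f ` (half_space \<times> {R<..})"
  proof (rule set_eqI, rule iffI)
    fix x :: "'n space" assume x: "x \<in> {x \<in> half_space. R < norm x}"
    then have "x \<in> half_space" by blast
    then have "norm x \<noteq> 0" using nz[of x] by simp
    then have e: "?f (x, norm x) = x" by simp
    have "(x, norm x) \<in> half_space \<times> {R<..}" using x by blast
    then have "?f (x, norm x) \<in> ?f ` (half_space \<times> {R<..})" by (rule imageI)
    then show "x \<in> ?f ` (half_space \<times> {R<..})" unfolding e .
  next
    fix y :: "'n space" assume "y \<in> ?f ` (half_space \<times> {R<..})"
    then obtain q where q: "q \<in> half_space \<times> {R<..}" "y = ?f q" by (rule imageE)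
    define x where "x = fst q"
    define r where "r = snd q"
    have x: "x \<in> half_space" "R < r" "y = (r / norm x) *\<^sub>R x"
      using q by (simp_all add: x_def r_def mem_Times_iff case_prod_beta)
    have pos: "r > 0" "norm x > 0" using assms x(1,2) nz[of x] by simp_all
    have "snd y = (r / norm x) * snd x" unfolding x(3) by simp
    moreover have "0 < snd x" using x(1) by (simp add: half_space_def)
    ultimately have "y \<in> half_space" using pos by (simp add: half_space_def)
    moreover have "norm y = r" unfolding x(3) using pos by simp
    ultimately show "y \<in> {x \<in> half_space. R < norm x}" using x(2) by simp
  qed
  moreover have "connected (?f ` (half_space \<times> {R<..}))"
  proof (rule connected_continuous_image)
    show "continuous_on (half_space \<times> {R<..}) ?f"
      unfolding split_beta' using nz by (intro continuous_intros) auto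
    show "connected ((half_space :: 'n space set) \<times> {R<..})"
      by (intro connected_Times convex_connected convex_half_space) auto
  qed
  ultimately show ?thesis by simp
qed

lemma connected_in_half_space:
  fixes C :: "'n::finite space set"
  assumes "connected C" "y \<in> C" "y \<in> half_space" "C \<inter> bounding_plane = {}"
  shows "C \<subseteq> half_space"
proof
  fix w assume w: "w \<in> C"
  have c: "connected (snd ` C)" by (intro connected_continuous_image continuous_intros assms(1))
  show "w \<in> half_space"
  proof (rule ccontr)
    assume "w \<notin> half_space"
    then have le: "snd w \<le> 0" "0 \<le> snd y" using assms(3) by (simp_all add: half_space_def)
    have "{snd w..snd y} \<subseteq> snd ` C"
      by (rule connected_contains_Icc[OF c imageI[OF w] imageI[OF assms(2)]])
    moreover have "0 \<in> {snd w..snd y}" using le by simp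
    ultimately obtain v where "v \<in> C" "snd v = 0" by (metis imageE subsetD)
    then show False using assms(4) by (auto simp: bounding_plane_def)
  qed
qed

text \<open>
  Let \<open>\<sigma>\<close> be the side of a point relative to its nearest surface point and \<open>\<tau>\<close> a function that is \<open>1\<close>
  on the surface and \<open>0\<close> away from it. The map \<open>cos (pi \<tau>) + i \<sigma> sin (pi \<tau>)\<close> is continuous on the half-space,
  because \<open>\<sigma>\<close> is locally constant wherever the sine does not vanish. The half-space is contractible, so
  the map has a continuous argument \<open>a\<close>, and \<open>k = (a - pi \<sigma> \<tau>) / (2 pi)\<close> is an integer that is constant on
  connected sets off the surface and jumps by one across it. If \<open>p\<close> were not in the closure of the
  inside, both sides of \<open>p\<close> would be connected to the far part of the half-space, where \<open>k\<close> takes a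
  single value.
\<close>

lemma surface_in_closure_inside:
  fixes S :: "'n::finite space set"
  assumes S: "compact S" and int: "S \<inter> half_space \<subseteq> surface_interior S"
    and cont: "continuous_on S \<nu>"
    and nu: "\<And>q. q \<in> S \<Longrightarrow> norm (\<nu> q) = 1" "\<And>q v. q \<in> S \<Longrightarrow> v \<in> tangent_space S q \<Longrightarrow> \<nu> q \<bullet> v = 0"
  shows "S \<inter> half_space \<subseteq> closure (inside (S \<union> bounding_plane))"
proof
  fix p assume p: "p \<in> S \<inter> half_space"
  let ?H = "half_space :: 'n space set"
  have clS: "closed S" "S \<noteq> {}" using S p compact_imp_closed by auto
  define loc where "loc p r \<kappa> \<longleftrightarrow> 0 < r \<and> ball p r \<subseteq> ?H \<and> continuous_on (ball p r) \<kappa> \<and>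
     (\<forall>x\<in>ball p r. \<kappa> x = 0 \<longleftrightarrow> x \<in> S) \<and>
     (\<forall>x\<in>ball p r. \<forall>q\<in>ball p r. x \<notin> S \<longrightarrow> q \<in> S \<longrightarrow> (\<forall>y\<in>S. dist x q \<le> dist x y) \<longrightarrow> (0 < \<kappa> x \<longleftrightarrow> 0 < (x - q) \<bullet> \<nu> q)) \<and>
     (\<forall>\<^sub>F t in at_right 0. 0 < \<kappa> (p + t *\<^sub>R \<nu> p)) \<and> (\<forall>\<^sub>F t in at_right 0. \<kappa> (p - t *\<^sub>R \<nu> p) < (0::real))" for p r \<kappa>
  have locD: "0 < r" "ball p r \<subseteq> ?H" "continuous_on (ball p r) \<kappa>" "\<forall>x\<in>ball p r. \<kappa> x = 0 \<longleftrightarrow> x \<in> S"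
     "\<forall>x\<in>ball p r. \<forall>q\<in>ball p r. x \<notin> S \<longrightarrow> q \<in> S \<longrightarrow> (\<forall>y\<in>S. dist x q \<le> dist x y) \<longrightarrow> (0 < \<kappa> x \<longleftrightarrow> 0 < (x - q) \<bullet> \<nu> q)"
     "\<forall>\<^sub>F t in at_right 0. 0 < \<kappa> (p + t *\<^sub>R \<nu> p)" "\<forall>\<^sub>F t in at_right 0. \<kappa> (p - t *\<^sub>R \<nu> p) < 0"
    if "loc p r \<kappa>" for p r \<kappa>
    using that unfolding loc_def by - (elim conjE, assumption)+
  have ex_loc: "\<exists>r \<kappa>. loc p r \<kappa>" if p: "p \<in> S \<inter> ?H" for p
  proof -
    have pi: "p \<in> surface_interior S" "p \<in> ?H" using p int by auto
    show ?thesis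
    proof (rule local_sides[OF pi(1) open_half_space pi(2) cont nu])
      fix r and \<kappa> :: "'n space \<Rightarrow> real"
      assume a: "0 < r" "ball p r \<subseteq> ?H" "continuous_on (ball p r) \<kappa>"
        and b: "\<And>x. x \<in> ball p r \<Longrightarrow> \<kappa> x = 0 \<longleftrightarrow> x \<in> S"
        and c: "\<And>x q. x \<in> ball p r \<Longrightarrow> q \<in> ball p r \<Longrightarrow> x \<notin> S \<Longrightarrow> q \<in> S \<Longrightarrow>
          (\<And>y. y \<in> S \<Longrightarrow> dist x q \<le> dist x y) \<Longrightarrow> 0 < \<kappa> x \<longleftrightarrow> 0 < (x - q) \<bullet> \<nu> q"
        and d: "\<forall>\<^sub>F t in at_right 0. 0 < \<kappa> (p + t *\<^sub>R \<nu> p)" "\<forall>\<^sub>F t in at_right 0. \<kappa> (p - t *\<^sub>R \<nu> p) < 0"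
      have "\<forall>x\<in>ball p r. \<forall>q\<in>ball p r. x \<notin> S \<longrightarrow> q \<in> S \<longrightarrow> (\<forall>y\<in>S. dist x q \<le> dist x y) \<longrightarrow>
          (0 < \<kappa> x \<longleftrightarrow> 0 < (x - q) \<bullet> \<nu> q)"
      proof (intro ballI impI)
        fix x q assume *: "x \<in> ball p r" "q \<in> ball p r" "x \<notin> S" "q \<in> S" "\<forall>y\<in>S. dist x q \<le> dist x y"
        show "0 < \<kappa> x \<longleftrightarrow> 0 < (x - q) \<bullet> \<nu> q" by (rule c[OF *(1-4)]) (rule bspec[OF *(5)])
      qed
      moreover have "\<forall>x\<in>ball p r. \<kappa> x = 0 \<longleftrightarrow> x \<in> S" using b by (rule ballI)
      ultimately have "loc p r \<kappa>" unfolding loc_def using a d by (intro conjI)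
      then show ?thesis by blast
    qed
  qed
  define \<sigma> :: "'n space \<Rightarrow> real" where
    "\<sigma> x = (if 0 < (x - closest_point S x) \<bullet> \<nu> (closest_point S x) then 1 else - 1)" for x
  have sk: "\<sigma> y = (if 0 < \<kappa> y then 1 else - 1)" if l: "loc p r \<kappa>" and p: "p \<in> S" and y: "y \<in> ball p (r / 2)" "y \<notin> S" for p r \<kappa> y
  proof -
    define q where "q = closest_point S y"
    have q: "q \<in> S" "\<And>x. x \<in> S \<Longrightarrow> dist y q \<le> dist y x"
      unfolding q_def by (rule closest_point_in_set[OF clS], rule closest_point_le[OF clS(1)])
    have "dist y q < r / 2" using q(2)[OF p] y(1) by (simp add: dist_commute)
    then have qb: "q \<in> ball p r" using y(1) dist_triangle[of p q y] unfolding mem_ball by linarith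
    have yb: "y \<in> ball p r" using y(1) zero_le_dist[of p y] unfolding mem_ball by linarith
    have "0 < \<kappa> y \<longleftrightarrow> 0 < (y - q) \<bullet> \<nu> q"
      using q(2) by (intro locD(5)[OF l, rule_format, OF yb qb y(2) q(1)])
    then show ?thesis by (simp add: \<sigma>_def q_def)
  qed
  define N where "N = (\<Union>p\<in>S \<inter> ?H. \<Union>r\<in>{r. \<exists>\<kappa>. loc p r \<kappa>}. ball p (r / 2))"
  have oN: "open N" unfolding N_def by (intro open_UN ballI open_ball)
  have SN: "S \<inter> ?H \<subseteq> N"
  proof
    fix p assume p: "p \<in> S \<inter> ?H"
    obtain r \<kappa> where l: "loc p r \<kappa>" using ex_loc[OF p] by blast
    then have "p \<in> ball p (r / 2)" using locD(1) by simp
    then show "p \<in> N" unfolding N_def using p l by (intro UN_I CollectI exI)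
  qed
  have lc: "\<forall>\<^sub>F y in nhds x. \<sigma> y = \<sigma> x" if x: "x \<in> N" "x \<notin> S" for x
  proof -
    obtain p r \<kappa> where l: "loc p r \<kappa>" and p: "p \<in> S" and xb: "x \<in> ball p (r / 2)"
      using x(1) unfolding N_def by (elim UN_E CollectE exE IntE)
    have r: "r > 0" by (rule locD(1)[OF l])
    have kc: "continuous_on (ball p r) \<kappa>" by (rule locD(3)[OF l])
    have k0: "\<kappa> x = 0 \<longleftrightarrow> x \<in> S" if "x \<in> ball p r" for x by (rule locD(4)[OF l, rule_format, OF that])
    have xr: "x \<in> ball p r" using xb r unfolding mem_ball by linarith
    have kx: "\<kappa> x \<noteq> 0" using k0[OF xr] x(2) by simp
    have "isCont \<kappa> x" using kc xr continuous_on_eq_continuous_at open_ball by blast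
    then have lim: "(\<kappa> \<longlongrightarrow> \<kappa> x) (nhds x)" by (simp add: isCont_def tendsto_at_iff_tendsto_nhds)
    have "\<forall>\<^sub>F y in nhds x. \<kappa> y \<noteq> 0 \<and> (0 < \<kappa> y \<longleftrightarrow> 0 < \<kappa> x)"
    proof (cases "0 < \<kappa> x")
      case True
      show ?thesis by (rule eventually_mono[OF order_tendstoD(1)[OF lim True]]) (use True in auto)
    next
      case False
      then have n: "\<kappa> x < 0" using kx by simp
      show ?thesis by (rule eventually_mono[OF order_tendstoD(2)[OF lim n]]) (use n in auto)
    qed
    moreover have "\<forall>\<^sub>F y in nhds x. y \<in> ball p (r / 2)"
      using xb by (intro eventually_nhds_in_open) auto
    ultimately show ?thesis
    proof eventually_elim
      case (elim y)
      then have "y \<in> ball p r" using r unfolding mem_ball by linarith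
      then have "y \<notin> S" using k0 elim by blast
      then show ?case using sk[OF l p] elim xb x(2) by simp
    qed
  qed
  obtain \<tau> :: "'n space \<Rightarrow> real" where \<tau>: "continuous_on ?H \<tau>" "\<And>x. x \<in> ?H \<Longrightarrow> \<tau> x \<in> closed_segment 1 0"
      "\<And>x. x \<in> ?H \<Longrightarrow> \<tau> x = 1 \<longleftrightarrow> x \<in> S \<inter> ?H" "\<And>x. x \<in> ?H \<Longrightarrow> \<tau> x = 0 \<longleftrightarrow> x \<in> ?H - N"
  proof (rule Urysohn_local_strong[of ?H "S \<inter> ?H" "?H - N" "1::real" 0])
    show "closedin (top_of_set ?H) (S \<inter> ?H)" using clS(1) by (metis closedin_closed_Int inf_commute)
    show "closedin (top_of_set ?H) (?H - N)" using oN by (simp add: Diff_eq closedin_closed_Int closed_Compl)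
    show "S \<inter> ?H \<inter> (?H - N) = {}" using SN by blast
  qed auto
  have lcw: "\<forall>\<^sub>F y in at x within A. \<sigma> y = \<sigma> x" if "x \<in> N" "x \<notin> S" for x A
    unfolding eventually_at_filter by (rule eventually_mono[OF lc[OF that]]) simp
  define f where "f x = Complex (cos (pi * \<tau> x)) (\<sigma> x * sin (pi * \<tau> x))" for x
  have s1: "\<bar>\<sigma> x\<bar> \<le> 1" "\<sigma> x = 1 \<or> \<sigma> x = -1" for x by (auto simp: \<sigma>_def)
  have fc: "continuous_on ?H f"
  proof -
    have "continuous_on ?H (\<lambda>x. \<sigma> x * sin (pi * \<tau> x))"
    proof (rule continuous_on_sign_mult[OF _ s1(1)])
      show "continuous_on ?H (\<lambda>x. sin (pi * \<tau> x))"
        by (rule continuous_on_sin[OF continuous_on_mult_left[OF \<tau>(1)]])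
      fix x assume x: "x \<in> ?H"
      show "sin (pi * \<tau> x) = 0 \<or> (\<forall>\<^sub>F y in at x within ?H. \<sigma> y = \<sigma> x)"
      proof (cases "x \<in> N - S")
        case True
        then have "x \<in> N" "x \<notin> S" by blast+
        then have "\<forall>\<^sub>F y in at x within ?H. \<sigma> y = \<sigma> x" by (rule lcw)
        then show ?thesis by (rule disjI2)
      next
        case False
        then have "x \<in> S \<inter> ?H \<or> x \<in> ?H - N" using x by blast
        then have "\<tau> x = 1 \<or> \<tau> x = 0" unfolding \<tau>(3,4)[OF x] .
        then have "sin (pi * \<tau> x) = 0" by (elim disjE) simp_all
        then show ?thesis by (rule disjI1)
      qed
    qed
    moreover have "continuous_on ?H (\<lambda>x. cos (pi * \<tau> x))"
      by (rule continuous_on_cos[OF continuous_on_mult_left[OF \<tau>(1)]])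
    ultimately show ?thesis unfolding f_def by (rule continuous_on_Complex[rotated])
  qed
  have nf: "norm (f x) = 1" for x
  proof -
    have "(\<sigma> x * sin (pi * \<tau> x))\<^sup>2 = (sin (pi * \<tau> x))\<^sup>2" using s1(2)[of x] by auto
    then show ?thesis by (simp add: f_def cmod_def)
  qed
  obtain g where g: "continuous_on ?H g" "\<And>x. x \<in> ?H \<Longrightarrow> f x = exp (g x)"
  proof (rule continuous_logarithm_on_contractible[OF fc convex_imp_contractible[OF convex_half_space]])
    show "f z \<noteq> 0" for z
    proof
      assume "f z = 0"
      then have "norm (f z) = 0" by (simp only: norm_zero)
      then show False unfolding nf by simp
    qed
  qed blast
  define a where "a x = Im (g x)" for x
  have ac: "continuous_on ?H a" unfolding a_def by (intro continuous_intros g)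
  have a: "cos (a x) = cos (pi * \<tau> x)" "sin (a x) = \<sigma> x * sin (pi * \<tau> x)" if x: "x \<in> ?H" for x
  proof -
    have "exp (Re (g x)) = 1" using nf[of x] g(2)[OF x] by simp
    then have "f x = Complex (cos (a x)) (sin (a x))"
      unfolding g(2)[OF x] a_def by (simp add: complex_eq_iff Re_exp Im_exp)
    then show "cos (a x) = cos (pi * \<tau> x)" "sin (a x) = \<sigma> x * sin (pi * \<tau> x)" by (auto simp: f_def)
  qed
  define k where "k x = (a x - pi * (\<sigma> x * \<tau> x)) / (2 * pi)" for x
  have kint: "k x \<in> \<int>" if x: "x \<in> ?H" for x
  proof -
    have "cos (pi * (\<sigma> x * \<tau> x)) = cos (pi * \<tau> x)" "sin (pi * (\<sigma> x * \<tau> x)) = \<sigma> x * sin (pi * \<tau> x)"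
      using s1(2)[of x] by auto
    then have "cos (a x - pi * (\<sigma> x * \<tau> x)) = (cos (pi * \<tau> x))\<^sup>2 + (\<sigma> x * \<sigma> x) * (sin (pi * \<tau> x))\<^sup>2"
      unfolding cos_diff a[OF x] by (simp add: power2_eq_square)
    also have "\<sigma> x * \<sigma> x = 1" using s1(2)[of x] by auto
    finally have "cos (a x - pi * (\<sigma> x * \<tau> x)) = 1" by simp
    then obtain n :: int where "a x - pi * (\<sigma> x * \<tau> x) = of_int n * 2 * pi" using cos_one_2pi_int by blast
    then have "k x = of_int n" by (simp add: k_def)
    then show ?thesis by simp
  qed
  have kc: "continuous_on (?H - S) k"
  proof -
    have "continuous_on (?H - S) (\<lambda>x. \<sigma> x * \<tau> x)"
    proof (rule continuous_on_sign_mult[OF _ s1(1)])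
      show "continuous_on (?H - S) \<tau>" using \<tau>(1) by (rule continuous_on_subset) auto
      fix x assume x: "x \<in> ?H - S"
      show "\<tau> x = 0 \<or> (\<forall>\<^sub>F y in at x within ?H - S. \<sigma> y = \<sigma> x)"
        using lcw[of x] \<tau>(4)[of x] x by (cases "x \<in> N") auto
    qed
    then have "continuous_on (?H - S) (\<lambda>x. a x - pi * (\<sigma> x * \<tau> x))"
      by (intro continuous_on_diff continuous_on_mult_left continuous_on_subset[OF ac]) auto
    then show ?thesis unfolding k_def
      by (intro continuous_on_divide continuous_on_const) auto
  qed
  have kconst: "k x = k y" if C: "connected C" "C \<subseteq> ?H - S" "x \<in> C" "y \<in> C" for C x y
  proof -
    have "k constant_on C"
    proof (rule continuous_discrete_range_constant[OF C(1) continuous_on_subset[OF kc C(2)]])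
      fix x assume x: "x \<in> C"
      have "1 \<le> norm (k y - k x)" if "y \<in> C" "k y \<noteq> k x" for y
      proof -
        have "k y - k x \<in> \<int>" using kint[of x] kint[of y] C(2) x that(1) by (blast intro: Ints_diff)
        then show ?thesis using Ints_nonzero_abs_ge1[of "k y - k x"] that(2) by simp
      qed
      then show "\<exists>e>0. \<forall>y. y \<in> C \<and> k y \<noteq> k x \<longrightarrow> e \<le> norm (k y - k x)" by (intro exI[of _ 1]) auto
    qed
    then show ?thesis using C(3,4) by (metis constant_on_def)
  qed
  show "p \<in> closure (inside (S \<union> bounding_plane))"
  proof (rule ccontr)
    assume "p \<notin> closure (inside (S \<union> bounding_plane))"
    then obtain e where e: "e > 0" "ball p e \<inter> inside (S \<union> bounding_plane) = {}"
      unfolding closure_approachable by (fastforce simp: dist_commute)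
    obtain R where R: "R > 0" "\<And>x. x \<in> S \<Longrightarrow> norm x \<le> R"
      using compact_imp_bounded[OF S] bounded_pos by blast
    define far where "far = {x \<in> ?H. R < norm x}"
    have cfar: "connected far" unfolding far_def using R(1) by (intro connected_far_half_space) simp
    have sfar: "far \<subseteq> ?H - S" using R(2) by (force simp: far_def)
    have reach: "\<exists>x\<in>far. k y = k x" if y: "y \<in> ball p e" "y \<in> ?H" "y \<notin> S" for y
    proof -
      have yp: "y \<notin> S \<union> bounding_plane" using y by (auto simp: half_space_def bounding_plane_def)
      then have "y \<in> outside (S \<union> bounding_plane)"
        using e(2) y(1) by (auto simp: outside_inside)
      define C where "C = connected_component_set (- (S \<union> bounding_plane)) y"
      have "\<not> bounded C" using \<open>y \<in> outside _\<close> unfolding C_def outside by simp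
      have C: "connected C" "y \<in> C" "C \<subseteq> - (S \<union> bounding_plane)"
        unfolding C_def using yp connected_component_subset by (auto simp: connected_component_refl)
      have CH: "C \<subseteq> ?H" by (rule connected_in_half_space[OF C(1,2) y(2)]) (use C(3) in blast)
      obtain x where x: "x \<in> C" "R < norm x" using \<open>\<not> bounded C\<close> by (metis boundedI not_le)
      then have "x \<in> far" using CH by (auto simp: far_def)
      moreover have "k y = k x" using kconst[OF C(1) _ C(2) x(1)] CH C(3) by blast
      ultimately show ?thesis by blast
    qed
    have same: "k y = k y'" if "y \<in> ball p e" "y \<in> ?H" "y \<notin> S" "y' \<in> ball p e" "y' \<in> ?H" "y' \<notin> S" for y y'
      using reach[OF that(1-3)] reach[OF that(4-6)] kconst[OF cfar sfar] by metis
    obtain r \<kappa> where l: "loc p r \<kappa>" using ex_loc[OF p] by blast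
    have r: "r > 0" "ball p r \<subseteq> ?H" by (rule locD(1)[OF l], rule locD(2)[OF l])
    have k0: "\<kappa> x = 0 \<longleftrightarrow> x \<in> S" if "x \<in> ball p r" for x by (rule locD(4)[OF l, rule_format, OF that])
    note up = locD(6)[OF l] and dn = locD(7)[OF l]
    have near: "\<forall>\<^sub>F t in at_right 0. p + t *\<^sub>R v \<in> ball p (min e (r / 2))" for v :: "'n space"
    proof -
      have "((\<lambda>t. p + t *\<^sub>R v) \<longlongrightarrow> p + 0 *\<^sub>R v) (at_right 0)"
        by (rule tendsto_add[OF tendsto_const tendsto_scaleR[OF tendsto_ident_at tendsto_const]])
      moreover have "p + 0 *\<^sub>R v = p" by simp
      ultimately have "((\<lambda>t. p + t *\<^sub>R v) \<longlongrightarrow> p) (at_right 0)" by (simp only:)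
      moreover have "p \<in> ball p (min e (r / 2))" using e(1) r(1) by simp
      ultimately show ?thesis by (rule topological_tendstoD[OF _ open_ball])
    qed
    have jump: "\<forall>\<^sub>F t in at_right 0. a (p + t *\<^sub>R \<nu> p) - a (p - t *\<^sub>R \<nu> p) = pi * (\<tau> (p + t *\<^sub>R \<nu> p) + \<tau> (p - t *\<^sub>R \<nu> p))"
      using up dn near[of "\<nu> p"] near[of "- \<nu> p"]
    proof eventually_elim
      case (elim t)
      define y where "y = p + t *\<^sub>R \<nu> p"
      define y' where "y' = p - t *\<^sub>R \<nu> p"
      have b: "y \<in> ball p e" "y \<in> ball p (r / 2)" "y' \<in> ball p e" "y' \<in> ball p (r / 2)"
        using elim by (auto simp: y_def y'_def)
      then have br: "y \<in> ball p r" "y' \<in> ball p r" using r(1) unfolding mem_ball by linarith+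
      have nS: "y \<notin> S" "y' \<notin> S" using elim(1,2) k0[OF br(1)] k0[OF br(2)] by (auto simp: y_def y'_def)
      have pS: "p \<in> S" using p by blast
      have "\<sigma> y = 1" "\<sigma> y' = -1"
        using sk[OF l pS b(2) nS(1)] sk[OF l pS b(4) nS(2)] elim(1,2) by (auto simp: y_def y'_def)
      moreover have "k y = k y'" using same[of y y'] b br nS r(2) by blast
      ultimately show ?case by (simp add: k_def y_def[symmetric] y'_def[symmetric] field_simps)
    qed
    have pH: "p \<in> ?H" using p by blast
    have lim: "((\<lambda>t. h (p + t *\<^sub>R v)) \<longlongrightarrow> h p) (at_right 0)" if "continuous_on ?H h" for h :: "'n space \<Rightarrow> real" and v
    proof -
      have "isCont h p" using that pH open_half_space continuous_on_eq_continuous_at by blast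
      moreover have "((\<lambda>t. p + t *\<^sub>R v) \<longlongrightarrow> p + 0 *\<^sub>R v) (at_right 0)" by (intro tendsto_intros)
      ultimately show ?thesis using isCont_tendsto_compose[of p h "\<lambda>t. p + t *\<^sub>R v"] by simp
    qed
    have "((\<lambda>t. a (p + t *\<^sub>R \<nu> p) - a (p + t *\<^sub>R (- \<nu> p))) \<longlongrightarrow> a p - a p) (at_right 0)"
      by (intro tendsto_diff lim ac)
    then have "((\<lambda>t. a (p + t *\<^sub>R \<nu> p) - a (p - t *\<^sub>R \<nu> p)) \<longlongrightarrow> 0) (at_right 0)" by simp
    then have 1: "((\<lambda>t. pi * (\<tau> (p + t *\<^sub>R \<nu> p) + \<tau> (p - t *\<^sub>R \<nu> p))) \<longlongrightarrow> 0) (at_right 0)"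
      using jump by (rule Lim_transform_eventually)
    have "((\<lambda>t. pi * (\<tau> (p + t *\<^sub>R \<nu> p) + \<tau> (p + t *\<^sub>R (- \<nu> p)))) \<longlongrightarrow> pi * (\<tau> p + \<tau> p)) (at_right 0)"
      by (intro tendsto_intros lim \<tau>(1))
    then have 2: "((\<lambda>t. pi * (\<tau> (p + t *\<^sub>R \<nu> p) + \<tau> (p - t *\<^sub>R \<nu> p))) \<longlongrightarrow> pi * (\<tau> p + \<tau> p)) (at_right 0)" by simp
    have "pi * (\<tau> p + \<tau> p) = 0" by (rule tendsto_unique[OF _ 2 1]) simp
    moreover have "\<tau> p = 1" using \<tau>(3)[OF pH] p by blast
    ultimately show False by simp
  qed
qed

section \<open>The enclosed region lies above its flat part\<close>

text \<open>
  Points from which an unbounded ray avoids the set lie in an unbounded component of the complement.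
\<close>

lemma ray_not_inside:
  fixes x v :: "'a::real_normed_vector"
  assumes "v \<noteq> 0" "\<And>t. 0 \<le> t \<Longrightarrow> x + t *\<^sub>R v \<notin> C"
  shows "x \<notin> inside C"
proof
  assume x: "x \<in> inside C"
  let ?r = "(\<lambda>t. x + t *\<^sub>R v) ` {0..}"
  have "connected ?r" by (intro connected_continuous_image continuous_intros convex_connected) auto
  moreover have "x \<in> ?r" by (rule image_eqI[of _ _ 0]) auto
  moreover have "?r \<subseteq> - C" using assms(2) by auto
  ultimately have "?r \<subseteq> connected_component_set (- C) x" by - (rule connected_component_maximal)
  moreover have "bounded (connected_component_set (- C) x)" using x by (simp add: inside_def)
  ultimately have "bounded ?r" using bounded_subset by blast
  then obtain B where B: "\<And>t. 0 \<le> t \<Longrightarrow> norm (x + t *\<^sub>R v) \<le> B" unfolding bounded_iff by auto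
  define t where "t = (\<bar>B\<bar> + norm x + 1) / norm v"
  have t: "0 \<le> t" "norm (t *\<^sub>R v) = \<bar>B\<bar> + norm x + 1" using assms(1) by (auto simp: t_def)
  have "norm (t *\<^sub>R v) \<le> norm (x + t *\<^sub>R v) + norm x" using norm_triangle_ineq4[of "x + t *\<^sub>R v" x] by simp
  then show False using B[OF t(1)] t(2) by linarith
qed

lemma inside_in_half_space:
  fixes S :: "'n::finite space set"
  assumes S: "S \<subseteq> closed_half_space" and R: "\<And>x. x \<in> S \<Longrightarrow> norm x \<le> R" "0 \<le> R"
    and x: "x \<in> inside (S \<union> bounding_plane)"
  shows "x \<in> half_space \<and> norm x \<le> R"
proof -
  have "x \<notin> bounding_plane" using x inside_no_overlap[of "S \<union> bounding_plane"] by blast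
  then have x0: "snd x \<noteq> 0" by (simp add: bounding_plane_def)
  have up: "0 < snd x"
  proof (rule ccontr)
    assume "\<not> 0 < snd x"
    then have n: "snd x < 0" using x0 by simp
    have "x + t *\<^sub>R (0, - 1) \<notin> S \<union> bounding_plane" if "0 \<le> t" for t
      using n that S by (auto simp: bounding_plane_def closed_half_space_def)
    from ray_not_inside[OF _ this] x show False by (simp add: zero_prod_def)
  qed
  have "norm x \<le> R"
  proof (rule ccontr)
    assume nx: "\<not> norm x \<le> R"
    have "x + t *\<^sub>R x \<notin> S \<union> bounding_plane" if t: "0 \<le> t" for t
    proof -
      have e: "x + t *\<^sub>R x = (1 + t) *\<^sub>R x" by (simp add: scaleR_left_distrib)
      have "norm x \<le> (1 + t) * norm x" using t by (simp add: distrib_right)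
      then have "\<not> norm ((1 + t) *\<^sub>R x) \<le> R" using nx t by simp
      then have "(1 + t) *\<^sub>R x \<notin> S" using R(1) by blast
      moreover have "snd ((1 + t) *\<^sub>R x) \<noteq> 0" using up t by simp
      then have "(1 + t) *\<^sub>R x \<notin> bounding_plane" unfolding bounding_plane_def by blast
      ultimately show ?thesis unfolding e by blast
    qed
    moreover have "x \<noteq> 0" using x0 by auto
    ultimately show False using ray_not_inside[of x x "S \<union> bounding_plane"] x by blast
  qed
  then show ?thesis using up by (simp add: half_space_def)
qed

lemma closed_bounding_plane: "closed bounding_plane"
  unfolding bounding_plane_def by (intro closed_Collect_eq continuous_intros)

text \<open>
  Off the surface a small half-ball is a connected part of the complement, and it meets the inside.
\<close>

lemma half_ball_inside:
  fixes S :: "'n::finite space set"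
  assumes S: "compact S" "S \<subseteq> closed_half_space"
    and p: "p \<in> closure (inside (S \<union> bounding_plane))" "p \<notin> S"
  obtains r where "0 < r" "ball p r \<inter> half_space \<subseteq> inside (S \<union> bounding_plane)"
proof -
  let ?C = "S \<union> bounding_plane"
  obtain R0 where "R0 > 0" "\<And>x. x \<in> S \<Longrightarrow> norm x \<le> R0" using compact_imp_bounded[OF S(1)] bounded_pos by blast
  then have iH: "x \<in> half_space" if "x \<in> inside ?C" for x
    using inside_in_half_space[OF S(2), of R0 x] that by auto
  have "open (- S)" using S(1) compact_imp_closed by blast
  then obtain r where r: "0 < r" "ball p r \<subseteq> - S" using p(2) by (meson ComplI open_contains_ball)
  obtain x where x: "x \<in> inside ?C" "dist x p < r" using p(1) r(1) unfolding closure_approachable by blast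
  let ?B = "ball p r \<inter> half_space"
  have "connected ?B" by (intro convex_connected convex_Int convex_ball convex_half_space)
  moreover have "x \<in> ?B" using x iH by (simp add: dist_commute)
  moreover have "?B \<subseteq> - ?C" using r(2) by (auto simp: half_space_def bounding_plane_def)
  ultimately have cc: "?B \<subseteq> connected_component_set (- ?C) x" by - (rule connected_component_maximal)
  have "?B \<subseteq> inside ?C"
  proof
    fix y assume "y \<in> ?B"
    then have "connected_component (- ?C) x y" using cc by blast
    then show "y \<in> inside ?C" using x(1) by (rule inside_same_component)
  qed
  then show thesis using that r(1) by blast
qed

text \<open>
  A nonzero linear form with nonnegative last coefficient has no maximum over the region at a point off
  the surface: a small half-ball around such a point belongs to the region, and the form increases in
  the direction of its coefficient vector tilted upwards.
\<close>

lemma enclosed_region_inner_bound: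
  fixes S :: "'n::finite space set"
  assumes S: "compact S" "S \<subseteq> closed_half_space" "S \<noteq> {}"
    and X: "0 \<le> snd X" "\<And>Y. Y \<in> S \<Longrightarrow> X \<bullet> Y \<le> m"
    and Q: "compact (enclosed_region S)" and Y: "Y \<in> enclosed_region S"
    and half: "enclosed_region S \<subseteq> closed_half_space"
    and X0: "X = 0 \<Longrightarrow> 0 \<le> m"
  shows "X \<bullet> Y \<le> m"
proof (cases "X = 0")
  case False
  have "enclosed_region S \<noteq> {}" using Y by blast
  then have "\<exists>p\<in>enclosed_region S. \<forall>Y\<in>enclosed_region S. X \<bullet> Y \<le> X \<bullet> p"
    by (rule continuous_attains_sup[OF Q]) (intro continuous_intros)
  then obtain p where p: "p \<in> enclosed_region S" "\<And>Y. Y \<in> enclosed_region S \<Longrightarrow> X \<bullet> Y \<le> X \<bullet> p" by blast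
  have "p \<in> S"
  proof (rule ccontr)
    assume "p \<notin> S"
    with p(1) obtain r where r: "0 < r" "ball p r \<inter> half_space \<subseteq> inside (S \<union> bounding_plane)"
      using half_ball_inside[OF S(1,2)] unfolding enclosed_region_def by blast
    define v where "v = X + (0, 1)"
    define s where "s = r / (2 * (norm v + 1))"
    have nv: "0 < norm v + 1" using norm_ge_zero[of v] by linarith
    have s: "0 < s" using r nv by (simp add: s_def)
    have "norm (s *\<^sub>R v) \<le> s * (norm v + 1)" using s by simp
    also have "s * (norm v + 1) = r / 2"
    proof -
      have "r / (2 * m) * m = r / 2" if "m > 0" for m :: real using that by simp
      from this[OF nv] show ?thesis by (simp only: s_def)
    qed
    finally have "norm (s *\<^sub>R v) < r" using r(1) by simp
    then have "p + s *\<^sub>R v \<in> ball p r" by (simp add: dist_norm)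
    moreover have "p + s *\<^sub>R v \<in> half_space"
    proof -
      have "0 < s * (snd X + 1)" using s X(1) by simp
      moreover have "0 \<le> snd p" using p(1) half by (auto simp: closed_half_space_def)
      ultimately show ?thesis by (simp add: half_space_def v_def)
    qed
    ultimately have "p + s *\<^sub>R v \<in> enclosed_region S"
      using r(2) closure_subset unfolding enclosed_region_def by blast
    then have "X \<bullet> (p + s *\<^sub>R v) \<le> X \<bullet> p" by (rule p(2))
    then have "s * (X \<bullet> X + snd X) \<le> 0" by (simp add: v_def inner_add_right inner_prod_def[of X "(0,1)"])
    moreover have "0 < X \<bullet> X + snd X" using False X(1) by (simp add: add_pos_nonneg)
    ultimately show False using s by (simp add: mult_le_0_iff)
  qed
  from X(2)[OF this] p(2)[OF Y] show ?thesis by simp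
qed (use X0 in simp)

lemma velocity_inner_nonpos:
  fixes S :: "'n::finite space set"
  assumes "velocity S p v" "open W" "p \<in> W" "\<And>y. y \<in> S \<inter> W \<Longrightarrow> (y - p) \<bullet> n \<le> 0"
  shows "v \<bullet> n \<le> 0"
proof (rule ccontr)
  assume pos: "\<not> v \<bullet> n \<le> 0"
  obtain \<gamma> where g: "\<gamma> 0 = p" "\<gamma> ` {0..1} \<subseteq> S" "(\<gamma> has_vector_derivative v) (at 0 within {0..1})"
    using assms(1) unfolding velocity_def by blast
  define h where "h t = (\<gamma> t - p) \<bullet> n" for t
  have "(h has_derivative (\<lambda>t. t * (v \<bullet> n))) (at 0 within {0..1})"
    unfolding h_def using g(3)[unfolded has_vector_derivative_def]
    by (auto intro!: derivative_eq_intros)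
  then have "(h has_real_derivative (v \<bullet> n)) (at 0 within {0..1})"
    unfolding has_field_derivative_def mult_commute_abs .
  then have "((\<lambda>t. (h t - h 0) / (t - 0)) \<longlongrightarrow> v \<bullet> n) (at 0 within {0..1})"
    by (simp add: has_field_derivative_iff)
  then have ev: "\<forall>\<^sub>F t in at 0 within {0..1}. 0 < (h t - h 0) / (t - 0)"
    by (rule order_tendstoD) (use pos in simp)
  have "(\<gamma> \<longlongrightarrow> p) (at 0 within {0..1})"
    using has_vector_derivative_continuous[OF g(3)] g(1) by (simp add: continuous_within)
  then have "\<forall>\<^sub>F t in at 0 within {0..1}. \<gamma> t \<in> W" using assms(2,3) by (rule topological_tendstoD)
  moreover have "\<forall>\<^sub>F t in at (0::real) within {0..1}. t \<noteq> 0 \<and> t \<in> {0..1}"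
    unfolding eventually_at_filter by simp
  ultimately have "\<forall>\<^sub>F t in at (0::real) within {0..1}. False"
    using ev
  proof eventually_elim
    case (elim t)
    then have "\<gamma> t \<in> S \<inter> W" using g(2) by blast
    then have "h t \<le> 0" unfolding h_def by (rule assms(4))
    moreover have "h 0 = 0" by (simp add: h_def g(1))
    ultimately show ?case using elim by (auto simp: zero_less_divide_iff)
  qed
  moreover have "at (0::real) within {0..1} \<noteq> bot"
    by (simp add: at_within_Icc_at_right)
  ultimately show False by simp
qed

text \<open>
  Otherwise the surface would lie in the bounding plane near \<open>p\<close>, so that the vertical direction would be
  normal to it; this contradicts a contact angle different from zero.
\<close>

lemma boundary_point_limit:
  fixes S :: "'n::finite space set"
  assumes S: "S \<subseteq> closed_half_space" and p: "p \<in> surface_boundary S" and n: "norm n = 1"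
    and tang: "\<And>v. v \<in> tangent_space S p \<Longrightarrow> n \<bullet> v = 0" and ang: "\<bar>snd n\<bar> < 1"
  shows "p \<in> closure (S \<inter> half_space)"
proof (rule ccontr)
  assume "p \<notin> closure (S \<inter> half_space)"
  then obtain e where e: "0 < e" "\<And>y. y \<in> S \<inter> half_space \<Longrightarrow> \<not> dist y p < e"
    unfolding closure_approachable by blast
  have pS: "p \<in> S" using p by (simp add: surface_boundary_def)
  have flat: "snd y = 0" if "y \<in> S \<inter> ball p e" for y
    using that e(2)[of y] S by (force simp: half_space_def closed_half_space_def dist_commute)
  have p0: "snd p = 0" using flat[of p] pS e(1) by simp
  have vz: "(0, 1) \<bullet> v = 0" if v: "velocity S p v" for v :: "'n space"
  proof -
    have "v \<bullet> s *\<^sub>R (0, 1) \<le> 0" for s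
      by (rule velocity_inner_nonpos[OF v open_ball[of p e]]) (use e(1) flat p0 in \<open>auto simp: inner_prod_def\<close>)
    from this[of 1] this[of "-1"] show ?thesis by (simp add: inner_prod_def)
  qed
  have sub: "tangent_space S p \<subseteq> {v. (0, 1) \<bullet> v = 0}"
    unfolding tangent_space_def
  proof (rule span_minimal)
    show "subspace {v. (0, 1) \<bullet> v = (0::real)}" by (rule subspace_hyperplane)
  qed (use vz in \<open>auto simp: velocity_def\<close>)
  have "(0, 1) = ((0, 1) \<bullet> n) *\<^sub>R n"
    by (rule normal_unique[of p S]) (use p tang n sub in auto)
  then have "snd ((0, 1) :: 'n space) = snd (((0, 1) \<bullet> n) *\<^sub>R n)" by (rule arg_cong)
  then have "1 = snd n * snd n" by (simp add: inner_prod_def)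
  moreover have "\<bar>snd n\<bar> * \<bar>snd n\<bar> < 1" using ang mult_le_one[of "\<bar>snd n\<bar>" "\<bar>snd n\<bar>"] mult_left_le[of "\<bar>snd n\<bar>" "\<bar>snd n\<bar>"] by linarith
  ultimately show False by (simp add: abs_mult[symmetric])
qed

text \<open>
  The points \<open>p + t n\<close> with small \<open>t\<close> are separated from \<open>Q\<close> by hyperplanes, whose unit normals accumulate at
  some \<open>l\<close> with \<open>l \<bullet> n \<ge> 0\<close> that supports \<open>Q\<close> at \<open>p\<close>. Since \<open>Q\<close> contains the surface near \<open>p\<close>, \<open>l\<close> is orthogonal
  to it, hence equal to \<open>n\<close>.
\<close>

lemma outward_normal_supports:
  fixes S :: "'n::finite space set"
  assumes Q: "convex Q" "closed Q" and sub: "S \<inter> half_space \<subseteq> Q"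
    and p: "p \<in> surface_interior S" "p \<in> half_space"
    and n: "norm n = 1" "\<And>v. v \<in> tangent_space S p \<Longrightarrow> n \<bullet> v = 0"
    and out: "\<forall>\<^sub>F t in at_right 0. p + t *\<^sub>R n \<notin> Q"
    and y: "y \<in> Q"
  shows "(y - p) \<bullet> n \<le> 0"
proof -
  have pQ: "p \<in> Q" using sub p by (auto simp: surface_interior_def)
  obtain b where b: "0 < b" "\<And>t. 0 < t \<Longrightarrow> t < b \<Longrightarrow> p + t *\<^sub>R n \<notin> Q"
    using out unfolding eventually_at_right_field by auto
  define t where "t k = b / (real k + 2)" for k
  have t: "0 < t k" "t k < b" for k using b(1) by (auto simp: t_def pos_divide_less_eq)
  have tl: "t \<longlonglongrightarrow> 0" unfolding t_def by real_asymp
  have "\<exists>w. norm w = 1 \<and> (\<forall>y\<in>Q. (y - p) \<bullet> w \<le> t k * (n \<bullet> w))" for k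
  proof -
    obtain a c where a: "a \<bullet> (p + t k *\<^sub>R n) < c" "\<And>x. x \<in> Q \<Longrightarrow> c < a \<bullet> x"
      using separating_hyperplane_closed_point[OF Q b(2)[OF t]] by blast
    have "a \<noteq> 0" using a(1) a(2)[OF pQ] by auto
    define w where "w = (- 1 / norm a) *\<^sub>R a"
    have "norm w = 1" using \<open>a \<noteq> 0\<close> by (simp add: w_def)
    moreover have "(y - p) \<bullet> w \<le> t k * (n \<bullet> w)" if "y \<in> Q" for y
    proof -
      have "a \<bullet> (p + t k *\<^sub>R n) \<le> a \<bullet> y" using a(1) a(2)[OF that] by simp
      then have "a \<bullet> (p + t k *\<^sub>R n - y) \<le> 0" by (simp add: inner_diff_right)
      then have "(1 / norm a) * (a \<bullet> (p + t k *\<^sub>R n - y)) \<le> 0" by (simp add: mult_le_0_iff divide_le_0_iff)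
      then have "(y - p) \<bullet> w - t k * (n \<bullet> w) \<le> 0"
        by (simp add: w_def inner_diff_left inner_diff_right inner_add_right inner_commute algebra_simps)
      then show ?thesis by simp
    qed
    ultimately show ?thesis by blast
  qed
  then obtain w where w: "\<And>k. norm (w k) = 1" "\<And>k y. y \<in> Q \<Longrightarrow> (y - p) \<bullet> w k \<le> t k * (n \<bullet> w k)" by metis
  have "\<forall>k. w k \<in> sphere 0 1" using w(1) by simp
  then obtain l r where l: "l \<in> sphere 0 1" "strict_mono r" "(w \<circ> r) \<longlonglongrightarrow> l"
    using compact_sphere[of 0 1] unfolding compact_def by meson
  have lr: "(\<lambda>k. w (r k)) \<longlonglongrightarrow> l" using l(3) by (simp add: comp_def)
  have tr: "(\<lambda>k. t (r k)) \<longlonglongrightarrow> 0" using LIMSEQ_subseq_LIMSEQ[OF tl l(2)] by (simp add: comp_def)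
  have sup: "(y - p) \<bullet> l \<le> 0" if y: "y \<in> Q" for y
  proof (rule LIMSEQ_le)
    show "(\<lambda>k. (y - p) \<bullet> w (r k)) \<longlonglongrightarrow> (y - p) \<bullet> l" by (intro tendsto_intros lr)
    have "(\<lambda>k. t (r k) * (n \<bullet> w (r k))) \<longlonglongrightarrow> 0 * (n \<bullet> l)" by (intro tendsto_intros lr tr)
    then show "(\<lambda>k. t (r k) * (n \<bullet> w (r k))) \<longlonglongrightarrow> 0" by simp
    show "\<exists>N. \<forall>k\<ge>N. (y - p) \<bullet> w (r k) \<le> t (r k) * (n \<bullet> w (r k))" using w(2)[OF y] by blast
  qed
  have nl: "0 \<le> n \<bullet> l"
  proof (rule LIMSEQ_le_const)
    show "(\<lambda>k. n \<bullet> w (r k)) \<longlonglongrightarrow> n \<bullet> l" by (intro tendsto_intros lr)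
    have "0 \<le> n \<bullet> w k" for k
      using w(2)[OF pQ, of k] t(1)[of k] by (auto simp: zero_le_mult_iff)
    then show "\<exists>N. \<forall>k\<ge>N. 0 \<le> n \<bullet> w (r k)" by blast
  qed
  obtain D' :: "'n space \<Rightarrow> 'n space" where D': "linear D'" "surj D'"
      "\<And>w. snd w = 0 \<Longrightarrow> \<exists>\<epsilon>>0. velocity S p (\<epsilon> *\<^sub>R D' w)"
    using interior_velocities[OF p(1)] by blast
  have "l = (l \<bullet> n) *\<^sub>R n"
  proof (rule parallel_normals[OF D'(1,2) _ n(1)])
    fix x :: "'n space" assume x: "snd x = 0"
    obtain \<epsilon> where "\<epsilon> > 0" "velocity S p (\<epsilon> *\<^sub>R D' x)" using D'(3)[OF x] by blast
    then show "n \<bullet> D' x = 0" using n(2)[OF velocity_in_tangent_space, of "\<epsilon> *\<^sub>R D' x"] by simp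
    have le: "D' x \<bullet> l \<le> 0" if x: "snd x = 0" for x
    proof -
      obtain \<epsilon> where e: "\<epsilon> > 0" "velocity S p (\<epsilon> *\<^sub>R D' x)" using D'(3)[OF x] by blast
      have "\<epsilon> *\<^sub>R D' x \<bullet> l \<le> 0"
        by (rule velocity_inner_nonpos[OF e(2) open_half_space p(2)]) (use sup sub in blast)
      then show ?thesis using e(1) by (simp add: mult_le_0_iff)
    qed
    show "l \<bullet> D' x = 0" using le[of x] le[of "- x"] x by (simp add: linear_neg[OF D'(1)] inner_commute)
  qed
  moreover have "norm l = 1" using l(1) by simp
  ultimately have "\<bar>l \<bullet> n\<bar> = 1" using n(1) by (metis mult.right_neutral norm_scaleR)
  then have "l \<bullet> n = 1" using nl by (simp add: inner_commute)
  then have "l = n" using \<open>l = (l \<bullet> n) *\<^sub>R n\<close> by simp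
  then show ?thesis using sup[OF y] by simp
qed

text \<open>
  Suppose \<open>(x, s)\<close> with small \<open>s > 0\<close> lies outside \<open>Q\<close>. The segment to it from an interior point of the
  same height crosses the surface at some \<open>q\<close>, where the normal points upwards. The supporting
  half-space at \<open>q\<close> excludes \<open>(x, s)\<close>, hence also every point above it. So \<open>(x, s)\<close> lies in \<open>Q\<close>, and \<open>s\<close> may
  tend to zero.
\<close>

lemma vertical_projection_in_body:
  fixes Q S :: "'n::finite space set"
  assumes Q: "compact Q" "convex Q" "interior Q \<noteq> {}" "Q \<subseteq> closed_half_space"
    and fr: "frontier Q \<subseteq> S \<union> bounding_plane"
    and p0: "p0 \<in> Q" "snd p0 = 0"
    and supp: "\<And>q y. q \<in> S \<Longrightarrow> q \<in> half_space \<Longrightarrow> y \<in> Q \<Longrightarrow> (y - q) \<bullet> \<nu> q \<le> 0"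
    and unit: "\<And>q. q \<in> S \<Longrightarrow> norm (\<nu> q) = 1"
    and low: "0 < \<delta>" "\<And>q. q \<in> S \<Longrightarrow> 0 < snd q \<Longrightarrow> snd q < \<delta> \<Longrightarrow> 0 < snd (\<nu> q)"
    and x: "(x, t) \<in> Q"
  shows "(x, 0) \<in> Q"
proof (cases "t = 0")
  case True then show ?thesis using x by simp
next
  case False
  then have t: "0 < t" using x Q(4) by (force simp: closed_half_space_def)
  obtain y0 where y0: "y0 \<in> interior Q" using Q(3) by blast
  have t0: "0 < snd y0"
  proof -
    obtain e where e: "0 < e" "cball y0 e \<subseteq> Q" using y0 by (auto simp: mem_interior_cball)
    have "y0 - e *\<^sub>R (0, 1) \<in> cball y0 e" using e(1) by (simp add: dist_norm norm_Pair)
    then have "y0 - e *\<^sub>R (0, 1) \<in> closed_half_space" using e(2) Q(4) by blast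
    then show ?thesis using e(1) by (simp add: closed_half_space_def)
  qed
  have slice: "(x, s) \<in> Q" if s: "0 < s" "s < \<delta>" "s < t" "s < snd y0" for s
  proof (rule ccontr)
    assume nQ: "(x, s) \<notin> Q"
    define c where "c = p0 - (s / snd y0) *\<^sub>R (p0 - y0)"
    have c: "c \<in> interior Q" unfolding c_def
      by (rule mem_interior_convex_shrink[OF Q(2) y0 p0(1)]) (use s t0 in auto)
    have sc: "snd c = s" using t0 p0(2) by (simp add: c_def)
    define y where "y = (x, s)"
    have yQ: "y \<notin> Q" and sy: "snd y = s" using nQ by (simp_all add: y_def)
    have "closed_segment c y \<inter> frontier Q \<noteq> {}"
    proof (rule connected_Int_frontier)
      show "closed_segment c y \<inter> Q \<noteq> {}" using c interior_subset by fastforce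
      show "closed_segment c y - Q \<noteq> {}" using yQ by auto
    qed (rule connected_segment)
    then obtain q where q: "q \<in> closed_segment c y" and qf: "q \<in> frontier Q" by blast
    then obtain u where u: "0 \<le> u" "u \<le> 1" "q = (1 - u) *\<^sub>R c + u *\<^sub>R y"
      unfolding in_segment by blast
    have sq: "snd q = s" by (simp add: u(3) sc sy algebra_simps)
    have "q \<in> S \<or> snd q = 0" using subsetD[OF fr qf] by (simp add: bounding_plane_def)
    then have qS: "q \<in> S" using sq s(1) by simp
    have qH: "q \<in> half_space" using sq s(1) by (simp add: half_space_def)
    have qc: "q \<noteq> c" using qf c unfolding frontier_def by blast
    have u0: "u \<noteq> 0" using qc by (auto simp: u(3))
    define d where "d = y - c"
    have dq: "c - q = - u *\<^sub>R d" "y - q = (1 - u) *\<^sub>R d" by (simp_all add: u(3) d_def algebra_simps)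
    obtain e where e: "0 < e" "cball c e \<subseteq> Q" using c by (auto simp: mem_interior_cball)
    have "c + e *\<^sub>R \<nu> q \<in> Q" using e unit[OF qS] by (auto simp: dist_norm)
    then have "(c + e *\<^sub>R \<nu> q - q) \<bullet> \<nu> q \<le> 0" by (rule supp[OF qS qH])
    then have "(c - q) \<bullet> \<nu> q + e * (\<nu> q \<bullet> \<nu> q) \<le> 0" by (simp add: inner_diff_left inner_add_left)
    then have "(c - q) \<bullet> \<nu> q < 0" using e(1) unit[OF qS] by (simp add: norm_eq_1)
    then have "0 < u * (d \<bullet> \<nu> q)" unfolding dq by simp
    then have dn: "0 < d \<bullet> \<nu> q" using u(1) u0 by (simp add: zero_less_mult_iff)
    have "(x, t) - q = (y - q) + (0, t - s)" by (simp add: prod_eq_iff y_def)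
    then have "((x, t) - q) \<bullet> \<nu> q = (1 - u) * (d \<bullet> \<nu> q) + (t - s) * snd (\<nu> q)"
      unfolding dq by (simp add: inner_add_left inner_prod_def[of "(0, t - s)"])
    moreover have "0 < (t - s) * snd (\<nu> q)" using low(2)[OF qS] sq s by simp
    moreover have "0 \<le> (1 - u) * (d \<bullet> \<nu> q)" using u dn by simp
    ultimately show False using supp[OF qS qH x] by linarith
  qed
  define b where "b = min \<delta> (min t (snd y0))"
  have b: "0 < b" using low(1) t t0 by (simp add: b_def)
  have lim: "(\<lambda>k. (x, b / (real k + 2))) \<longlonglongrightarrow> (x, 0)"
    by (intro tendsto_Pair tendsto_const) real_asymp
  have mem: "(x, b / (real k + 2)) \<in> Q" for k
  proof (rule slice)
    have "b / (real k + 2) < b" using b by (simp add: pos_divide_less_eq)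
    then show "b / (real k + 2) < \<delta>" "b / (real k + 2) < t" "b / (real k + 2) < snd y0" by (auto simp: b_def)
  qed (use b in simp)
  show ?thesis by (rule closed_sequentially[OF compact_imp_closed[OF Q(1)] mem lim])
qed

text \<open>
  The normal has positive last coordinate on the boundary by the contact angle condition, hence by
  compactness on the whole part of the surface below some height \<open>\<delta>\<close>.
\<close>

lemma capillary_body_geometry:
  fixes S :: "'n::finite space set"
  assumes \<theta>: "0 < \<theta>" "\<theta> < pi / 2" and cap: "capillary_hypersurface \<theta> S" and conv: "convex (enclosed_region S)"
  shows "compact (enclosed_region S)" "enclosed_region S \<subseteq> closed_half_space" "interior (enclosed_region S) \<noteq> {}"
    "\<And>x t. (x, t) \<in> enclosed_region S \<Longrightarrow> (x, 0) \<in> enclosed_region S"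
proof -
  define Q where "Q = enclosed_region S"
  let ?C = "S \<union> bounding_plane"
  have S: "compact S" "S = surface_interior S \<union> surface_boundary S" "S \<subseteq> closed_half_space"
      "S \<inter> bounding_plane = surface_boundary S" "surface_boundary S \<noteq> {}"
    using cap unfolding capillary_hypersurface_def smooth_hypersurface_def by blast+
  obtain \<nu> where \<nu>: "unit_outward_normal S \<nu>" "\<And>p. p \<in> surface_boundary S \<Longrightarrow> \<nu> p \<bullet> e_vec = - cos \<theta>"
    using cap unfolding capillary_hypersurface_def by blast
  have cont: "continuous_on S \<nu>" and unit: "\<And>q. q \<in> S \<Longrightarrow> norm (\<nu> q) = 1"
    and tang: "\<And>q v. q \<in> S \<Longrightarrow> v \<in> tangent_space S q \<Longrightarrow> \<nu> q \<bullet> v = 0"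
    and out: "\<And>p. p \<in> S \<inter> half_space \<Longrightarrow> \<forall>\<^sub>F t in at_right 0. p + t *\<^sub>R \<nu> p \<notin> Q"
    using \<nu>(1) unfolding unit_outward_normal_def Q_def by blast+
  have cs: "0 < cos \<theta>" "cos \<theta> < 1"
    using \<theta> cos_gt_zero[of \<theta>] cos_monotone_0_pi[of 0 \<theta>] pi_gt_zero by auto
  have sb: "snd (\<nu> p) = cos \<theta>" if "p \<in> surface_boundary S" for p
    using \<nu>(2)[OF that] by (simp add: e_vec_def inner_prod_def)
  obtain R where R: "0 < R" "\<And>x. x \<in> S \<Longrightarrow> norm x \<le> R"
    using compact_imp_bounded[OF S(1)] bounded_pos by blast
  have ins: "x \<in> half_space \<and> norm x \<le> R" if "x \<in> inside ?C" for x
    by (rule inside_in_half_space[OF S(3) R(2) less_imp_le[OF R(1)] that])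
  have Qc: "compact Q"
  proof -
    have "bounded (inside ?C)" unfolding bounded_iff using ins by blast
    then show ?thesis unfolding Q_def enclosed_region_def by (simp add: compact_eq_bounded_closed bounded_closure)
  qed
  have ch: "closed (closed_half_space :: 'n space set)"
    unfolding closed_half_space_def by (intro closed_Collect_le continuous_intros)
  have Qh: "Q \<subseteq> closed_half_space"
    unfolding Q_def enclosed_region_def
  proof (rule closure_minimal[OF _ ch], rule subsetI)
    fix x assume "x \<in> inside ?C"
    then have "0 < snd x" using ins[of x] by (simp add: half_space_def)
    then show "x \<in> closed_half_space" by (simp add: closed_half_space_def)
  qed
  have int: "S \<inter> half_space \<subseteq> surface_interior S"
  proof -
    have "half_space \<inter> bounding_plane = ({} :: 'n space set)" by (auto simp: half_space_def bounding_plane_def)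
    then show ?thesis using S(2,4) by blast
  qed
  have SQ: "S \<inter> half_space \<subseteq> Q"
    unfolding Q_def enclosed_region_def by (rule surface_in_closure_inside[OF S(1) int cont unit tang])
  obtain p0 where p0: "p0 \<in> surface_boundary S" using S(5) by blast
  have p0S: "p0 \<in> S" "snd p0 = 0" using p0 S(4) by (auto simp: bounding_plane_def)
  have p0c: "p0 \<in> closure (S \<inter> half_space)"
    by (rule boundary_point_limit[OF S(3) p0 unit[OF p0S(1)] tang[OF p0S(1)]]) (use sb[OF p0] cs in auto)
  have Qcl: "closed Q" using Qc compact_imp_closed by blast
  have p0Q: "p0 \<in> Q" using p0c closure_minimal[OF SQ Qcl] by blast
  have clC: "closed ?C" using S(1) compact_imp_closed closed_bounding_plane by blast
  have intQ: "interior Q \<noteq> {}"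
  proof -
    have "inside ?C \<noteq> {}" using p0Q unfolding Q_def enclosed_region_def by auto
    moreover have "inside ?C \<subseteq> interior Q"
      unfolding Q_def enclosed_region_def by (rule interior_maximal[OF closure_subset open_inside[OF clC]])
    ultimately show ?thesis by blast
  qed
  have fr: "frontier Q \<subseteq> ?C"
  proof -
    have "frontier (closure A) \<subseteq> frontier A" for A :: "'n space set"
      using interior_mono[OF closure_subset[of A]] by (auto simp: frontier_def)
    then show ?thesis unfolding Q_def enclosed_region_def using frontier_inside_subset[OF clC] by blast
  qed
  have supp: "(y - q) \<bullet> \<nu> q \<le> 0" if q: "q \<in> S" "q \<in> half_space" and y: "y \<in> Q" for q y
    by (rule outward_normal_supports[OF conv[folded Q_def] Qcl SQ _ q(2) unit[OF q(1)] tang[OF q(1)] out y]) (use q int in auto)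
  obtain \<delta> where \<delta>: "0 < \<delta>" "\<And>q. q \<in> S \<Longrightarrow> 0 < snd q \<Longrightarrow> snd q < \<delta> \<Longrightarrow> 0 < snd (\<nu> q)"
  proof -
    define B where "B = {q \<in> S. snd (\<nu> q) \<le> 0}"
    have "compact B"
    proof -
      have "closedin (top_of_set S) (S \<inter> (\<lambda>q. snd (\<nu> q)) -` {..0})"
        by (intro continuous_closedin_preimage continuous_intros cont)
      then have "compact (S \<inter> (\<lambda>q. snd (\<nu> q)) -` {..0})" by (rule closedin_compact[OF S(1)])
      moreover have "S \<inter> (\<lambda>q. snd (\<nu> q)) -` {..0} = B" by (auto simp: B_def)
      ultimately show ?thesis by simp
    qed
    have pos: "0 < snd q" if q: "q \<in> B" for q
    proof (rule ccontr)
      assume "\<not> 0 < snd q"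
      then have "snd q = 0" using q S(3) by (force simp: B_def closed_half_space_def)
      then have "q \<in> surface_boundary S" using q S(4) by (auto simp: B_def bounding_plane_def)
      then show False using sb[of q] q cs by (simp add: B_def)
    qed
    show thesis
    proof (cases "B = {}")
      case True
      then show thesis by (intro that[of 1]) (auto simp: B_def not_le)
    next
      case False
      have "\<exists>q0\<in>B. \<forall>q\<in>B. snd q0 \<le> snd q"
        by (rule continuous_attains_inf[OF \<open>compact B\<close> False]) (intro continuous_intros)
      then obtain q0 where q0: "q0 \<in> B" "\<And>q. q \<in> B \<Longrightarrow> snd q0 \<le> snd q" by blast
      show thesis
      proof (rule that[OF pos[OF q0(1)]])
        fix q assume "q \<in> S" "0 < snd q" "snd q < snd q0"
        then show "0 < snd (\<nu> q)" using q0(2)[of q] by (force simp: B_def)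
      qed
    qed
  qed
  show "compact (enclosed_region S)" "enclosed_region S \<subseteq> closed_half_space" "interior (enclosed_region S) \<noteq> {}"
    using Qc Qh intQ by (simp_all add: Q_def)
  show "(x, 0) \<in> enclosed_region S" if "(x, t) \<in> enclosed_region S" for x t
    using vertical_projection_in_body[OF Qc conv[folded Q_def] intQ Qh fr p0Q p0S(2) supp unit \<delta>] that by (simp add: Q_def)
qed

section \<open>The capillary polar body\<close>

text \<open>
  A point of the cap is a unit vector plus the centre \<open>cos \<theta> e\<close>. The unit vector contributes at most
  \<open>\<ell> \<le> 1\<close> by the definition of the polar body, and the centre a nonpositive amount, because it lies below
  the plane and \<open>Y\<close> above.
\<close>

lemma capillary_polar_body_inner_le:
  fixes S :: "'n::finite space set"
  assumes \<theta>: "0 < \<theta>" "\<theta> < pi / 2" and S: "compact S" "S \<subseteq> closed_half_space"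
    and z: "snd z = 0" and X: "X + z \<in> capillary_polar_body \<theta> S z" and Y: "Y \<in> S"
  shows "X \<bullet> (Y - z) \<le> 1"
proof -
  have cs: "0 < cos \<theta>" "cos \<theta> < 1"
    using \<theta> cos_gt_zero[of \<theta>] cos_monotone_0_pi[of 0 \<theta>] pi_gt_zero by auto
  obtain r \<xi> where r: "X = r *\<^sub>R \<xi>" "0 \<le> r" and \<xi>: "\<xi> \<in> unit_cap \<theta>" and u: "r * capillary_support_fun \<theta> S z \<xi> \<le> 1"
    using X unfolding capillary_polar_body_def by auto
  have e: "x \<bullet> e_vec = - snd x" for x :: "'n space" by (simp add: e_vec_def inner_prod_def)
  define n where "n = \<xi> - cos \<theta> *\<^sub>R e_vec"
  have n1: "norm n = 1" and sx: "0 \<le> snd \<xi>" using \<xi> by (auto simp: unit_cap_def n_def closed_half_space_def)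
  have sn: "snd n = snd \<xi> + cos \<theta>" by (simp add: n_def e_vec_def)
  have "\<bar>snd n\<bar> \<le> 1" using norm_snd_le[where x="fst n" and y="snd n"] n1 by simp
  then have sx1: "snd \<xi> + cos \<theta> \<le> 1" using sn by simp
  have ell: "cap_ell \<theta> \<xi> = 1 - cos \<theta> * snd n"
    by (simp add: cap_ell_def e sn sin_squared_eq power2_eq_square algebra_simps)
  have "cos \<theta> * snd n \<le> cos \<theta> * 1" using cs sx1 sn by (intro mult_left_mono) simp_all
  then have lpos: "0 < cap_ell \<theta> \<xi>" using ell cs(2) by linarith
  have "0 \<le> cos \<theta> * snd n" using cs sx sn by simp
  then have l1: "cap_ell \<theta> \<xi> \<le> 1" using ell by simp
  have bdd: "bdd_above ((\<lambda>X. n \<bullet> (X - z)) ` S)"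
    by (intro bounded_imp_bdd_above compact_imp_bounded compact_continuous_image continuous_intros S)
  have "n \<bullet> (Y - z) \<le> support_fun \<theta> S z \<xi>"
    unfolding support_fun_def n_def[symmetric] by (rule cSUP_upper[OF Y bdd])
  then have "r * (n \<bullet> (Y - z)) \<le> r * support_fun \<theta> S z \<xi>" using r(2) by (rule mult_left_mono)
  also have "\<dots> = (r * capillary_support_fun \<theta> S z \<xi>) * cap_ell \<theta> \<xi>"
    using lpos by (simp add: capillary_support_fun_def)
  also have "\<dots> \<le> 1 * cap_ell \<theta> \<xi>" using u lpos by (intro mult_right_mono) auto
  also have "\<dots> \<le> 1" using l1 by simp
  finally have a: "r * (n \<bullet> (Y - z)) \<le> 1" .
  have "X \<bullet> (Y - z) = r * (n \<bullet> (Y - z)) + r * cos \<theta> * (e_vec \<bullet> (Y - z))"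
    unfolding r(1) by (simp add: n_def inner_diff_left algebra_simps)
  also have "e_vec \<bullet> (Y - z) = - snd Y" using e[of "Y - z"] z by (simp add: inner_commute)
  also have "r * (n \<bullet> (Y - z)) + r * cos \<theta> * (- snd Y) \<le> 1 + 0"
  proof (rule add_mono[OF a])
    have "0 \<le> snd Y" using S(2) Y by (auto simp: closed_half_space_def)
    then show "r * cos \<theta> * (- snd Y) \<le> 0" using r(2) cs by simp
  qed
  finally show ?thesis by simp
qed

text \<open>
  Since \<open>X\<close> has nonnegative height, reflecting a point of the region does not increase its product with \<open>X\<close>.
\<close>

lemma capillary_polar_body_in_polar:
  fixes S :: "'n::finite space set"
  assumes \<theta>: "0 < \<theta>" "\<theta> < pi / 2" and S: "compact S" "S \<subseteq> closed_half_space" "S \<noteq> {}"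
    and Q: "compact (enclosed_region S)" "enclosed_region S \<subseteq> closed_half_space"
    and z: "snd z = 0"
  shows "capillary_polar_body \<theta> S z \<subseteq> (\<lambda>X. X + z) ` polar_at (enclosed_region S \<union> flip ` enclosed_region S) z"
proof
  fix W assume W: "W \<in> capillary_polar_body \<theta> S z"
  define X where "X = W - z"
  have WX: "W = X + z" by (simp add: X_def)
  have "W \<in> closed_half_space" using W unfolding capillary_polar_body_def by auto
  then have X0: "0 \<le> snd X" using z by (simp add: X_def closed_half_space_def)
  have inS: "X \<bullet> Y \<le> 1 + X \<bullet> z" if "Y \<in> S" for Y
    using capillary_polar_body_inner_le[OF \<theta> S(1,2) z _ that, of X] W WX by (simp add: inner_diff_right)
  have inQ: "X \<bullet> Y \<le> 1 + X \<bullet> z" if Y: "Y \<in> enclosed_region S" for Y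
    by (rule enclosed_region_inner_bound[OF S X0 inS Q(1) Y Q(2)]) auto
  have "X \<bullet> (Y - z) \<le> 1" if "Y \<in> enclosed_region S \<union> flip ` enclosed_region S" for Y
    using that
  proof
    assume "Y \<in> enclosed_region S" then show ?thesis using inQ[of Y] by (simp add: inner_diff_right)
  next
    assume "Y \<in> flip ` enclosed_region S"
    then obtain Y' where Y': "Y' \<in> enclosed_region S" "Y = flip Y'" by blast
    have "0 \<le> snd X * snd Y'" using X0 Y'(1) Q(2) by (auto simp: closed_half_space_def)
    then have "X \<bullet> Y \<le> X \<bullet> Y'" unfolding Y'(2) by (simp add: flip_def inner_prod_def)
    then show ?thesis using inQ[OF Y'(1)] by (simp add: inner_diff_right)
  qed
  then have "X \<in> polar_at (enclosed_region S \<union> flip ` enclosed_region S) z" by (simp add: polar_at_def)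
  then show "W \<in> (\<lambda>X. X + z) ` polar_at (enclosed_region S \<union> flip ` enclosed_region S) z" using WX by blast
qed

theorem proposition2p12:
  fixes \<theta> :: real and \<Sigma> :: "'n::finite space set"
  assumes "0 < \<theta>" and "\<theta> < pi / 2"
    and "capillary_hypersurface \<theta> \<Sigma>"
    and "enclosed_region \<Sigma> \<in> capillary_convex_bodies \<theta>"
  shows "(INF z\<in>flat_interior \<Sigma>.
            emeasure lborel (enclosed_region \<Sigma>) * emeasure lborel (capillary_polar_body \<theta> \<Sigma> z))
         \<le> 1 / 2 * (emeasure lborel (ball (0 :: 'n space) 1))\<^sup>2"
proof -
  let ?Q = "enclosed_region \<Sigma>"
  have conv: "convex ?Q" using assms(4) unfolding capillary_convex_bodies_def by auto
  note geo = capillary_body_geometry[OF assms(1-3) conv]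
  have S: "compact \<Sigma>" "\<Sigma> \<subseteq> closed_half_space" "\<Sigma> \<noteq> {}"
    using assms(3) unfolding capillary_hypersurface_def surface_boundary_def by blast+
  let ?D = "{x. (x, 0) \<in> ?Q}"
  have "\<exists>z\<in>interior ?D. emeasure lborel ?Q * emeasure lborel (polar_at (?Q \<union> flip ` ?Q) (z, 0))
      \<le> 1 / 2 * (emeasure lborel (ball (0 :: 'n space) 1))\<^sup>2"
    by (rule double_santalo[OF geo(1) conv geo(3,2)]) (rule geo(4))
  then obtain z where z: "z \<in> interior ?D" and
    bound: "emeasure lborel ?Q * emeasure lborel (polar_at (?Q \<union> flip ` ?Q) (z, 0))
      \<le> 1 / 2 * (emeasure lborel (ball (0 :: 'n space) 1))\<^sup>2"
    by blast
  have "(z, 0) \<in> flat_interior \<Sigma>"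
    unfolding flat_interior_def interior_of_def
  proof (intro CollectI exI conjI)
    show "openin (top_of_set bounding_plane) (bounding_plane \<inter> (interior ?D \<times> UNIV))"
      by (intro openin_open_Int open_Times) auto
    show "(z, 0) \<in> bounding_plane \<inter> (interior ?D \<times> UNIV)" using z by (simp add: bounding_plane_def)
    show "bounding_plane \<inter> (interior ?D \<times> UNIV) \<subseteq> flat_part \<Sigma>"
      unfolding flat_part_def bounding_plane_def using interior_subset[of ?D] by auto
  qed
  then have "(INF z\<in>flat_interior \<Sigma>. emeasure lborel ?Q * emeasure lborel (capillary_polar_body \<theta> \<Sigma> z))
      \<le> emeasure lborel ?Q * emeasure lborel (capillary_polar_body \<theta> \<Sigma> (z, 0))"
    by (rule INF_lower)
  also have "\<dots> \<le> emeasure lborel ?Q * emeasure lborel (polar_at (?Q \<union> flip ` ?Q) (z, 0))"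
  proof (rule mult_left_mono)
    have "capillary_polar_body \<theta> \<Sigma> (z, 0) \<subseteq> (\<lambda>X. X + (z, 0)) ` polar_at (?Q \<union> flip ` ?Q) (z, 0)"
      by (rule capillary_polar_body_in_polar[OF assms(1,2) S geo(1,2)]) simp
    then show "emeasure lborel (capillary_polar_body \<theta> \<Sigma> (z, 0)) \<le> emeasure lborel (polar_at (?Q \<union> flip ` ?Q) (z, 0))"
      using emeasure_translate[OF closed_polar_at] by (metis emeasure_mono sets_lborel)
  qed simp
  also note bound
  finally show ?thesis .
qed

end
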